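(* Suppose $f$ is a quasiperiodically forced circle homeomorphism given by the projective action of a quasiperiodic $\mathrm{SL}(2,\mathbb{R})$-cocycle. Then for any minimal set $K$ of $f$ one of the following holds: 1. $K$ is the whole torus; 2. $K$ is a continuous $(p,q)$-invariant graph for some $p,q\ge1$; 3. $K$ intersects generic fibres in exactly one point; 4. $K$ intersects generic fibres in exactly two points. If in addition $f$ is $\rho$-unbounded, then any minimal set of $f$ either is the whole torus, or intersects generic fibres in only one point.
   Context: $\mathbb{T}^1=\mathbb{R}/\mathbb{Z}$, $\mathbb{T}^2=\mathbb{T}^1\times\mathbb{T}^1$, $p_1(\theta,x)=\theta$. A quasiperiodically forced circle homeomorphism is a homeomorphism $f$ of $\mathbb{T}^2$, isotopic to the identity, of the form $f(\theta,x)=(\theta+\omega,f_\theta(x))$ with $\omega\in\mathbb{R}\setminus\mathbb{Q}$. It is given by the projective action of a quasiperiodic $\mathrm{SL}(2,\mathbb{R})$-cocycle if, after identifying $\mathbb{T}^2$ with $\mathbb{T}^1\times\mathbb{P}^1(\mathbb{R})$ in the standard way, each $f_\theta$ is the projective action on $\mathbb{P}^1(\mathbb{R})$ of an element of $\mathrm{SL}(2,\mathbb{R})$. A minimal set is a non-empty compact invariant set containing no strictly smaller non-empty compact invariant set. "$K$ intersects generic fibres in exactly $k$ points" means that for all $\theta$ in a dense $G_\delta$ subset of $\mathbb{T}^1$ the set $K\cap(\{\theta\}\times\mathbb{T}^1)$ has exactly $k$ elements. A continuous $(p,q)$-invariant graph is a minimal invariant subset of $\mathbb{T}^2$ on which the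 restriction of $p_1$ is a $pq$-fold covering of $\mathbb{T}^1$ and which has $p$ connected components. Given a lift $F:\mathbb{T}^1\times\mathbb{R}\to\mathbb{T}^1\times\mathbb{R}$ of $f$, $F(\theta,x)=(\theta+\omega,F_\theta(x))$, put $F^n_\theta=F_{\theta+(n-1)\omega}\circ\cdots\circ F_\theta$. The limit $\rho(F)=\lim_{n\to\infty}(F^n_\theta(x)-x)/n$ exists and does not depend on $(\theta,x)$. $f$ is $\rho$-bounded if $\sup_{n,\theta,x}|F^n_\theta(x)-x-n\rho(F)|<\infty$, and $\rho$-unbounded otherwise. *)

theory Defs
  imports "HOL-Analysis.Analysis"
begin

text \<open>
  The circle \<open>\<real>/\<int>\<close> is realised as the unit circle of \<open>\<complex>\<close>, the class of \<open>t\<close> being \<open>circ t\<close>.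
  Hence the rotation by \<open>\<omega>\<close> is multiplication by \<open>circ \<omega>\<close>.
\<close>

abbreviation circle :: "complex set" where
  "circle \<equiv> sphere 0 1"

definition circ :: "real \<Rightarrow> complex" where
  "circ t = cis (2 * pi * t)"

abbreviation torus :: "(complex \<times> complex) set" where
  "torus \<equiv> circle \<times> circle"

lemma circ_in_circle [simp]: "circ t \<in> circle"
  by (simp add: circ_def)

lemma circ_surj: "z \<in> circle \<Longrightarrow> \<exists>t. z = circ t"
proof -
  assume "z \<in> circle"
  then have "z \<noteq> 0" "cmod z = 1" by auto
  then have "z = cis (Arg z)"
    by (simp add: cis_Arg sgn_eq)
  then have "z = circ (Arg z / (2 * pi))"
    by (simp add: circ_def)
  then show ?thesis ..
qed

lemma circ_eq_iff: "circ s = circ t \<longleftrightarrow> s - t \<in> \<int>"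
proof -
  have "circ s = circ t \<longleftrightarrow> (\<exists>n::int. 2 * pi * s = 2 * pi * t + 2 * pi * n)"
    unfolding circ_def cis_conv_exp exp_eq by (simp add: complex_eq_iff mult_ac)
  also have "\<dots> \<longleftrightarrow> (\<exists>n::int. s = t + n)"
    by (simp flip: distrib_left)
  also have "\<dots> \<longleftrightarrow> s - t \<in> \<int>"
    by (auto simp: Ints_def diff_eq_eq add.commute)
  finally show ?thesis .
qed

text \<open>
  A map is isotopic to the identity if it is homotopic to the identity through homeomorphisms.
\<close>

definition qpf_circle_homeo ::
    "real \<Rightarrow> (complex \<times> complex \<Rightarrow> complex \<times> complex) \<Rightarrow> bool" where
  "qpf_circle_homeo \<omega> f \<longleftrightarrow>
     \<omega> \<notin> \<rat> \<and>
     (\<exists>g. homeomorphism torus torus f g) \<and>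
     homotopic_with_canon (\<lambda>h. \<exists>g. homeomorphism torus torus h g) torus torus id f \<and>
     (\<forall>\<theta>\<in>circle. \<forall>x\<in>circle. fst (f (\<theta>, x)) = \<theta> * circ \<omega>)"

text \<open>
  The point of \<open>\<real>/\<int>\<close> represented by \<open>t\<close> is identified with the line at angle \<open>\<pi> t\<close> to the first
  coordinate axis; a point of the projective line is a one-dimensional subspace of the plane.
\<close>

definition proj_line :: "complex \<Rightarrow> (real^2) set" where
  "proj_line z = {v. \<exists>t r. z = circ t \<and> v = r *\<^sub>R vector [cos (pi * t), sin (pi * t)]}"

lemma proj_line_circ:
  "proj_line (circ t) = span {vector [cos (pi * t), sin (pi * t)]}"
proof -
  have "\<exists>r'. r *\<^sub>R (vector [cos (pi * s), sin (pi * s)] :: real^2)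
             = r' *\<^sub>R vector [cos (pi * t), sin (pi * t)]"
    if "circ t = circ s" for r s
  proof -
    have "circ s = circ t" using that by simp
    then obtain n :: int where n: "s = t + n"
      unfolding circ_eq_iff by (auto elim!: Ints_cases simp: algebra_simps)
    have "sin (pi * of_int n) = 0" "cos (pi * of_int n) = 1 \<or> cos (pi * of_int n) = -1"
      using sin_cos_squared_add[of "pi * of_int n"] 
      by (auto simp: sin_zero_iff_int2 power2_eq_1_iff)
    then have "(vector [cos (pi * s), sin (pi * s)] :: real^2)
        = cos (pi * of_int n) *\<^sub>R vector [cos (pi * t), sin (pi * t)]"
      by (auto simp: n distrib_left cos_add sin_add vec_eq_iff forall_2)
    then show ?thesis by (metis scaleR_scaleR)
  qed
  then show ?thesis
    by (fastforce simp: proj_line_def span_singleton image_iff)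
qed

lemma bij_betw_proj_line:
  "bij_betw proj_line circle {L. subspace L \<and> dim L = 1}"
proof (rule bij_betw_imageI)
  let ?u = "\<lambda>t. vector [cos (pi * t), sin (pi * t)] :: real^2"
  show "inj_on proj_line circle"
  proof (rule inj_onI)
    fix z w assume "z \<in> circle" "w \<in> circle" and eq: "proj_line z = proj_line w"
    then obtain s t where st: "z = circ s" "w = circ t"
      using circ_surj by meson
    have "?u s \<in> span {?u t}"
      using eq span_base[of "?u s" "{?u s}"] by (simp add: st proj_line_circ)
    then obtain r where "?u s = r *\<^sub>R ?u t"
      by (auto simp: span_singleton)
    then have "cos (pi * s) = r * cos (pi * t)" "sin (pi * s) = r * sin (pi * t)"
      by (auto simp: vec_eq_iff forall_2)
    then have "sin (pi * s - pi * t) = 0"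
      by (simp add: sin_diff)
    then obtain n :: int where "pi * s - pi * t = of_int n * pi"
      by (auto simp: sin_zero_iff_int2)
    then have "pi * (s - t) = pi * of_int n"
      by (simp add: algebra_simps)
    then have "s - t = of_int n" by simp
    then show "z = w"
      by (simp add: st circ_eq_iff)
  qed
  show "proj_line ` circle = {L. subspace L \<and> dim L = 1}"
  proof (intro equalityI subsetI)
    fix L assume "L \<in> proj_line ` circle"
    then obtain t where "L = span {?u t}"
      using circ_surj by (metis imageE proj_line_circ)
    moreover have "?u t \<noteq> 0"
      using sin_zero_abs_cos_one[of "pi * t"] by (force simp: vec_eq_iff forall_2)
    ultimately show "L \<in> {L. subspace L \<and> dim L = 1}"
      by (simp add: dim_singleton)
  next
    fix L :: "(real^2) set" assume "L \<in> {L. subspace L \<and> dim L = 1}"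
    then have L: "subspace L" "dim L = 1" by auto
    obtain B where B: "B \<subseteq> L" "independent B" "L \<subseteq> span B" "card B = dim L"
      using basis_exists by blast
    then obtain v where v: "B = {v}" 
      using L(2) by (metis card_1_singletonE)
    have Lv: "L = span {v}"
      using B L(1) v span_minimal by blast
    have "v \<noteq> 0" using B(2) v dependent_zero by blast
    define z where "z = Complex (v $ 1) (v $ 2)"
    have "z \<noteq> 0" using \<open>v \<noteq> 0\<close> by (auto simp: z_def complex_eq_iff vec_eq_iff forall_2)
    define t where "t = Arg z / pi"
    have z: "z = of_real (cmod z) * cis (pi * t)"
      using rcis_cmod_Arg[of z] by (simp add: t_def rcis_def)
    have "v $ 1 = cmod z * cos (pi * t)" "v $ 2 = cmod z * sin (pi * t)"
      using arg_cong[OF z, of Re] arg_cong[OF z, of Im] by (simp_all add: z_def)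
    then have "v = cmod z *\<^sub>R ?u t"
      by (auto simp: vec_eq_iff forall_2)
    then have "span {v} = span {?u t}"
      using \<open>z \<noteq> 0\<close> span_image_scale[of "{?u t}" "\<lambda>_. cmod z"] by simp
    then have "L = proj_line (circ t)" by (simp add: Lv proj_line_circ)
    then show "L \<in> proj_line ` circle" using circ_in_circle by blast
  qed
qed

definition projective_SL2_action :: "(complex \<times> complex \<Rightarrow> complex \<times> complex) \<Rightarrow> bool" where
  "projective_SL2_action f \<longleftrightarrow>
     (\<forall>\<theta>\<in>circle. \<exists>A::real^2^2. det A = 1 \<and>
        (\<forall>x\<in>circle. proj_line (snd (f (\<theta>, x))) = (\<lambda>v. A *v v) ` proj_line x))"

definition compact_invariant ::
    "(complex \<times> complex \<Rightarrow> complex \<times> complex) \<Rightarrow> (complex \<times> complex) set \<Rightarrow> bool" where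
  "compact_invariant f K \<longleftrightarrow> K \<noteq> {} \<and> K \<subseteq> torus \<and> compact K \<and> f ` K = K"

definition minimal_set ::
    "(complex \<times> complex \<Rightarrow> complex \<times> complex) \<Rightarrow> (complex \<times> complex) set \<Rightarrow> bool" where
  "minimal_set f K \<longleftrightarrow>
     compact_invariant f K \<and> (\<forall>L. compact_invariant f L \<longrightarrow> \<not> L \<subset> K)"

definition generic_fibre_card :: "(complex \<times> complex) set \<Rightarrow> nat \<Rightarrow> bool" where
  "generic_fibre_card K k \<longleftrightarrow>
     (\<exists>G. gdelta_in (top_of_set circle) G \<and> circle \<subseteq> closure G \<and>
        (\<forall>\<theta>\<in>G. finite (K \<inter> ({\<theta>} \<times> circle)) \<and> card (K \<inter> ({\<theta>} \<times> circle)) = k))"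

definition continuous_invariant_graph ::
    "(complex \<times> complex \<Rightarrow> complex \<times> complex) \<Rightarrow> nat \<Rightarrow> nat \<Rightarrow> (complex \<times> complex) set \<Rightarrow> bool"
  where
  "continuous_invariant_graph f p q K \<longleftrightarrow>
     minimal_set f K \<and>
     covering_space K fst circle \<and>
     (\<forall>\<theta>\<in>circle. finite (K \<inter> ({\<theta>} \<times> circle)) \<and> card (K \<inter> ({\<theta>} \<times> circle)) = p * q) \<and>
     finite (components K) \<and> card (components K) = p"

text \<open>
  A lift \<open>F\<close> of \<open>f\<close> covers the same rotation as \<open>f\<close>, so the fibre map of the iterate satisfies
  \<open>F\<^sup>n\<^sub>\<theta> x = snd ((F ^^ n) (\<theta>, x))\<close>.
\<close>

definition is_lift ::
    "(complex \<times> complex \<Rightarrow> complex \<times> complex) \<Rightarrow> (complex \<times> real \<Rightarrow> complex \<times> real) \<Rightarrow> bool" where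
  "is_lift f F \<longleftrightarrow>
     continuous_on (circle \<times> UNIV) F \<and>
     (\<forall>\<theta>\<in>circle. \<forall>x. f (\<theta>, circ x) = (fst (F (\<theta>, x)), circ (snd (F (\<theta>, x)))))"

definition fibred_rotation_number :: "(complex \<times> real \<Rightarrow> complex \<times> real) \<Rightarrow> real" where
  "fibred_rotation_number F =
     (THE \<rho>. \<forall>\<theta>\<in>circle. \<forall>x. (\<lambda>n. (snd ((F ^^ n) (\<theta>, x)) - x) / real n) \<longlonglongrightarrow> \<rho>)"

text \<open>
  Two lifts of a quasiperiodically forced circle homeomorphism differ by an integer translation,
  so all lifts satisfy the bound below as soon as one does.
\<close>

definition rho_bounded :: "(complex \<times> complex \<Rightarrow> complex \<times> complex) \<Rightarrow> bool" where
  "rho_bounded f \<longleftrightarrow>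
     (\<forall>F. is_lift f F \<longrightarrow>
        bdd_above {\<bar>snd ((F ^^ n) (\<theta>, x)) - x - real n * fibred_rotation_number F\<bar>
                   | n \<theta> x. \<theta> \<in> circle})"

end

theory Submission
  imports Defs
begin

text \<open>
  Write \<open>f\<^sup>n\<^sub>\<theta>\<close> for the fibre maps of the iterates. They are Moebius transformations of the circle, and a
  Moebius transformation of large norm sends the complement of a neighbourhood of one point \<open>r\<close>, its
  repeller, into a neighbourhood of one point \<open>a\<close>, its attractor. The proof therefore splits according
  to whether all \<open>f\<^sup>n\<^sub>\<theta>\<close> stay in a bounded part of the group.

  Let \<open>K\<close> be a minimal set other than the torus whose generic fibre has more than one point. Then all
  fibres of \<open>K\<close> have diameter at least some \<open>\<delta> > 0\<close> (\<open>generic_one_or_spread\<close>). Over a generic base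
  point, called good, the fibre of \<open>K\<close> moreover depends continuously on the base point and is nowhere
  dense (\<open>good_generic\<close>).

  In the bounded case the \<open>f\<^sup>n\<^sub>\<theta>\<close> are bi-Lipschitz with a common constant. A gap of a good fibre is
  carried along an orbit that is dense in \<open>K\<close> to gaps of comparable length, so that every point of the
  good fibre has a gap of definite length to its right (\<open>bounded_right_gap\<close>). Hence the points of each
  fibre are uniformly separated, \<open>K\<close> is a finite covering of the circle (\<open>bounded_covering\<close>), and
  minimality makes the iterates act transitively on its components (\<open>bounded_graph\<close>).

  In the unbounded case every good fibre has exactly two points (\<open>unbounded_two_points\<close>). At a good
  base point \<open>t0\<close> there are return times \<open>n\<close> for which \<open>f\<^sup>n\<close> is almost a constant \<open>a\<close> off its repeller
  \<open>r\<close>, and \<open>r\<close> lies in \<open>K\<close>. If the fibre had three points, minimality would give a nearby base point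
  \<open>t1\<close> over which the repeller lies on the other side of two gaps. On the way from \<open>t0\<close> to \<open>t1\<close> the map
  \<open>f\<^sup>n\<close> has to take one of these gaps to a gap, which bounds its norm there. The images of three gaps
  can then never leave the complementary intervals of the fibre over \<open>t0\<close>, and this keeps the norm
  bounded all the way back to \<open>t0\<close> (\<open>bounded_along_arc\<close>), a contradiction.

  For the statement on \<open>\<rho>\<close>-boundedness consider a short curve \<open>\<theta> \<mapsto> (\<theta>, x)\<close> off \<open>K\<close>. Its images cannot
  turn round the fibres if no point of them is ever caught between two points of \<open>K\<close> in a fixed
  window (\<open>barrier\<close>); the displacement then oscillates boundedly with \<open>\<theta>\<close>, which is \<open>\<rho>\<close>-boundedness.
  In the bounded case a small window contains at most one point of \<open>K\<close> in each fibre. In the unbounded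
  case all points of \<open>K\<close> come in pairs that stay \<open>\<delta>\<close> apart for ever, and two disjoint pairs in one fibre
  would bound the cocycle (\<open>paired_star\<close>). Thus two points of a window have a common partner, and the
  cyclic order on the fibre does not allow the image of \<open>x\<close> to lie between them
  (\<open>unbounded_rho_bounded\<close>).
\<close>

section \<open>The circle and its universal covering\<close>

lemma circ_add: "circ (s + t) = circ s * circ t"
  by (simp add: circ_def cis_mult algebra_simps)

lemma circ_of_int [simp]: "circ (of_int j) = 1"
  by (metis Ints_of_int circ_def circ_eq_iff cis_zero diff_zero mult_zero_right)

lemma circ_add_int [simp]: "circ (x + of_int j) = circ x"
  by (simp add: circ_add)

lemma circ_diff_int [simp]: "circ (x - of_int j) = circ x"
  using circ_add_int[of x "-j"] by simp

lemma circ_add_one [simp]: "circ (x + 1) = circ x"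
  using circ_add_int[of x 1] by simp

lemma circ_diff_one [simp]: "circ (x - 1) = circ x"
  using circ_add_int[of x "-1"] by simp

lemma norm_circ [simp]: "cmod (circ t) = 1"
  by (simp add: circ_def)

lemma continuous_on_circ [continuous_intros]:
  "continuous_on S h \<Longrightarrow> continuous_on S (\<lambda>x. circ (h x))"
  unfolding circ_def by (intro continuous_intros)

lemma dist_circ_add [simp]: "dist (circ (x + c)) (circ (y + c)) = dist (circ x) (circ y)"
  by (simp add: circ_add dist_norm flip: left_diff_distrib) (simp add: norm_mult)

lemma dist_circ_le: "dist (circ x) (circ y) \<le> 2 * pi * \<bar>x - y\<bar>"
proof -
  have "dist (circ x) (circ y) = dist (circ (x - y)) (circ 0)"
    using dist_circ_add[of "x - y" y 0] by simp
  also have "\<dots> = cmod (exp (\<i> * (2 * pi * (x - y))) - 1)"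
    by (simp add: circ_def cis_conv_exp dist_norm)
  also have "\<dots> = 2 * \<bar>sin (2 * pi * (x - y) / 2)\<bar>"
    using dist_exp_i_1[of "2 * pi * (x - y)"] by simp
  also have "\<dots> \<le> 2 * \<bar>2 * pi * (x - y) / 2\<bar>"
    by (intro mult_left_mono abs_sin_x_le_abs_x) simp
  finally show ?thesis by (simp add: abs_mult)
qed

text \<open>
  The chord length is bounded below on the compact set of angles away from the integers, so short
  chords come from points that are close modulo an integer.
\<close>
lemma circ_close_imp_close:
  assumes "e > 0"
  obtains \<nu> where "\<nu> > 0" "\<And>x y. dist (circ x) (circ y) < \<nu> \<Longrightarrow> \<exists>j::int. \<bar>x - y - of_int j\<bar> < e"
proof -
  define e' where "e' = min e (1/2)"
  have e': "0 < e'" "e' \<le> 1/2" "e' \<le> e" using assms by (auto simp: e'_def)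
  let ?I = "{e'..1 - e'}"
  have ne: "?I \<noteq> {}" using e' by auto
  have "continuous_on ?I (\<lambda>x. dist (circ x) 1)" by (intro continuous_intros)
  then obtain x0 where x0: "x0 \<in> ?I" "\<And>x. x \<in> ?I \<Longrightarrow> dist (circ x0) 1 \<le> dist (circ x) 1"
    using continuous_attains_inf[OF compact_Icc ne] by metis
  have "circ x0 \<noteq> 1"
  proof
    assume "circ x0 = 1"
    then have "x0 \<in> \<int>" using circ_eq_iff[of x0 0] by (simp add: circ_def)
    then obtain i where "x0 = of_int i" by (auto simp: Ints_def)
    moreover have "0 < x0" "x0 < 1" using x0 e' by auto
    ultimately show False by simp
  qed
  then have pos: "dist (circ x0) 1 > 0" by simp
  show ?thesis
  proof (rule that[OF pos])
    fix x y assume xy: "dist (circ x) (circ y) < dist (circ x0) 1"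
    define d where "d = frac (x - y)"
    have "circ d = circ (x - y)" unfolding d_def frac_def by simp
    then have "dist (circ d) 1 = dist (circ x) (circ y)"
      using dist_circ_add[of "x - y" y 0] by (simp add: circ_def)
    then have "d \<notin> ?I" using x0(2)[of d] xy by linarith
    moreover have "0 \<le> d" "d < 1" by (auto simp: d_def frac_lt_1)
    ultimately consider "\<bar>d\<bar> < e" | "\<bar>d - 1\<bar> < e" using e' by fastforce
    then show "\<exists>j::int. \<bar>x - y - of_int j\<bar> < e"
    proof cases
      case 1 then show ?thesis by (intro exI[of _ "\<lfloor>x - y\<rfloor>"]) (simp add: d_def frac_def)
    next
      case 2
      then show ?thesis by (intro exI[of _ "\<lfloor>x - y\<rfloor> + 1"]) (auto simp: d_def frac_def algebra_simps)
    qed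
  qed
qed

section \<open>Moebius transformations of the circle\<close>

text \<open>
  In the coordinate \<open>z = u\<^sup>2\<close> on the projective line, the real linear map \<open>u \<mapsto> \<alpha> u + \<beta> cnj u\<close> of the
  plane acts by the following formula; it has determinant \<open>\<bar>\<alpha>\<bar>\<^sup>2 - \<bar>\<beta>\<bar>\<^sup>2\<close>.
\<close>
definition mobius :: "complex \<Rightarrow> complex \<Rightarrow> complex \<Rightarrow> complex" where
  "mobius \<alpha> \<beta> z = (\<alpha> * z + \<beta>) / (cnj \<beta> * z + cnj \<alpha>)"

definition circle_mobius :: "(complex \<Rightarrow> complex) \<Rightarrow> bool" where
  "circle_mobius g \<longleftrightarrow>
     (\<exists>\<alpha> \<beta>. (cmod \<alpha>)\<^sup>2 - (cmod \<beta>)\<^sup>2 = 1 \<and> (\<forall>z\<in>circle. g z = mobius \<alpha> \<beta> z))"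

definition co_lipschitz :: "real \<Rightarrow> (complex \<Rightarrow> complex) \<Rightarrow> bool" where
  "co_lipschitz \<kappa> g \<longleftrightarrow> (\<forall>z\<in>circle. \<forall>w\<in>circle. \<kappa> * dist z w \<le> dist (g z) (g w))"

lemma det_complex: "(cmod \<alpha>)\<^sup>2 - (cmod \<beta>)\<^sup>2 = 1 \<Longrightarrow> \<alpha> * cnj \<alpha> - \<beta> * cnj \<beta> = 1"
  by (metis complex_norm_square of_real_1 of_real_diff)

lemma norm_gt: "(cmod \<alpha>)\<^sup>2 - (cmod \<beta>)\<^sup>2 = 1 \<Longrightarrow> cmod \<beta> < cmod \<alpha>"
  by (rule power2_less_imp_less) auto

lemma mobius_denom_nz:
  assumes "(cmod \<alpha>)\<^sup>2 - (cmod \<beta>)\<^sup>2 = 1" "z \<in> circle"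
  shows "cnj \<beta> * z + cnj \<alpha> \<noteq> 0"
proof
  assume "cnj \<beta> * z + cnj \<alpha> = 0"
  then have "cmod (cnj \<alpha>) = cmod (cnj \<beta> * z)" by (metis add_eq_0_iff norm_minus_cancel)
  then show False using norm_gt[OF assms(1)] assms(2) by (simp add: norm_mult)
qed

lemma mobius_num_denom:
  assumes "z \<in> circle"
  shows "\<alpha> * z + \<beta> = z * cnj (cnj \<beta> * z + cnj \<alpha>)"
proof -
  have "z * cnj z = 1" using assms by (simp flip: complex_norm_square)
  then show ?thesis by (simp add: algebra_simps)
qed

lemma mobius_in_circle:
  assumes "(cmod \<alpha>)\<^sup>2 - (cmod \<beta>)\<^sup>2 = 1" "z \<in> circle"
  shows "mobius \<alpha> \<beta> z \<in> circle"
proof -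
  have "cmod (\<alpha> * z + \<beta>) = cmod (cnj \<beta> * z + cnj \<alpha>)"
    using mobius_num_denom[OF assms(2), of \<alpha> \<beta>] assms(2) 
    by (metis complex_mod_cnj mem_sphere_0 mult_1 norm_mult)
  then show ?thesis using mobius_denom_nz[OF assms] by (simp add: mobius_def norm_divide)
qed

lemma mobius_dist:
  assumes "(cmod \<alpha>)\<^sup>2 - (cmod \<beta>)\<^sup>2 = 1" "z \<in> circle" "w \<in> circle"
  shows "dist (mobius \<alpha> \<beta> z) (mobius \<alpha> \<beta> w)
       = dist z w / (cmod (cnj \<beta> * z + cnj \<alpha>) * cmod (cnj \<beta> * w + cnj \<alpha>))"
proof -
  note nz = mobius_denom_nz[OF assms(1,2)] mobius_denom_nz[OF assms(1,3)]
  have "(\<alpha> * z + \<beta>) * (cnj \<beta> * w + cnj \<alpha>) - (\<alpha> * w + \<beta>) * (cnj \<beta> * z + cnj \<alpha>)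
      = (\<alpha> * cnj \<alpha> - \<beta> * cnj \<beta>) * (z - w)" by (simp add: algebra_simps)
  then have "mobius \<alpha> \<beta> z - mobius \<alpha> \<beta> w 
      = (z - w) / ((cnj \<beta> * z + cnj \<alpha>) * (cnj \<beta> * w + cnj \<alpha>))"
    using nz det_complex[OF assms(1)] by (simp add: mobius_def diff_frac_eq mult_ac)
  then show ?thesis by (simp add: dist_norm norm_divide norm_mult)
qed

text \<open>
  The quantitative form of the collapse: \<open>- cnj \<alpha> / cnj \<beta>\<close> plays the role of the repeller and
  \<open>\<alpha> / cnj \<beta>\<close> that of the attractor. Both lie close to the circle when \<open>\<beta>\<close> is large.
\<close>
lemma mobius_polar:
  assumes "(cmod \<alpha>)\<^sup>2 - (cmod \<beta>)\<^sup>2 = 1" "z \<in> circle" "\<beta> \<noteq> 0"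
  shows "dist z (- cnj \<alpha> / cnj \<beta>) * dist (mobius \<alpha> \<beta> z) (\<alpha> / cnj \<beta>) = 1 / (cmod \<beta>)\<^sup>2"
proof -
  note nz = mobius_denom_nz[OF assms(1,2)]
  have 1: "z - - cnj \<alpha> / cnj \<beta> = (cnj \<beta> * z + cnj \<alpha>) / cnj \<beta>"
    using assms(3) by (simp add: field_simps)
  have "(\<alpha> * z + \<beta>) * cnj \<beta> - \<alpha> * (cnj \<beta> * z + cnj \<alpha>) = -(\<alpha> * cnj \<alpha> - \<beta> * cnj \<beta>)"
    by (simp add: algebra_simps)
  then have 2: "mobius \<alpha> \<beta> z - \<alpha> / cnj \<beta> = - 1 / ((cnj \<beta> * z + cnj \<alpha>) * cnj \<beta>)"
    using nz assms(3) det_complex[OF assms(1)] by (simp add: mobius_def diff_frac_eq)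
  show ?thesis unfolding dist_norm 1 2 using nz assms(3)
    by (simp add: norm_divide norm_mult power2_eq_square)
qed

lemma circle_mobius_id: "circle_mobius (\<lambda>z. z)"
  unfolding circle_mobius_def by (rule exI[of _ 1], rule exI[of _ 0]) (simp add: mobius_def)

lemma circle_mobius_compose:
  assumes "circle_mobius g" "circle_mobius h"
  shows "circle_mobius (\<lambda>z. g (h z))"
proof -
  obtain a b where ab: "(cmod a)\<^sup>2 - (cmod b)\<^sup>2 = 1" "\<And>z. z \<in> circle \<Longrightarrow> g z = mobius a b z"
    using assms(1) unfolding circle_mobius_def by blast
  obtain c d where cd: "(cmod c)\<^sup>2 - (cmod d)\<^sup>2 = 1" "\<And>z. z \<in> circle \<Longrightarrow> h z = mobius c d z"
    using assms(2) unfolding circle_mobius_def by blast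
  define \<alpha> \<beta> where "\<alpha> = a * c + b * cnj d" and "\<beta> = a * d + b * cnj c"
  have "\<alpha> * cnj \<alpha> - \<beta> * cnj \<beta> = (a * cnj a - b * cnj b) * (c * cnj c - d * cnj d)"
    by (simp add: \<alpha>_def \<beta>_def algebra_simps)
  also have "\<dots> = 1" using det_complex[OF ab(1)] det_complex[OF cd(1)] by simp
  finally have "complex_of_real ((cmod \<alpha>)\<^sup>2 - (cmod \<beta>)\<^sup>2) = 1"
    by (metis complex_norm_square of_real_diff)
  then have 1: "(cmod \<alpha>)\<^sup>2 - (cmod \<beta>)\<^sup>2 = 1" using of_real_eq_1_iff by blast
  have "g (h z) = mobius \<alpha> \<beta> z" if z: "z \<in> circle" for z
  proof -
    have hz: "h z = mobius c d z" "h z \<in> circle" using cd z mobius_in_circle by auto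
    let ?D = "cnj d * z + cnj c"
    have nz: "?D \<noteq> 0" "cnj b * h z + cnj a \<noteq> 0"
      using mobius_denom_nz cd(1) ab(1) z hz(2) by blast+
    have "g (h z) = (a * h z + b) / (cnj b * h z + cnj a)" using ab(2) hz by (simp add: mobius_def)
    also have "\<dots> = ((a * h z + b) * ?D) / ((cnj b * h z + cnj a) * ?D)" using nz by simp
    also have "(a * h z + b) * ?D = \<alpha> * z + \<beta>"
      using nz(1) by (simp add: hz(1) mobius_def \<alpha>_def \<beta>_def field_simps)
    also have "(cnj b * h z + cnj a) * ?D = cnj \<beta> * z + cnj \<alpha>"
      using nz(1) by (simp add: hz(1) mobius_def \<alpha>_def \<beta>_def field_simps)
    finally show ?thesis by (simp add: mobius_def)
  qed
  with 1 show ?thesis unfolding circle_mobius_def by blast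
qed

text \<open>
  If \<open>\<beta>\<close> is bounded, the denominators in \<open>mobius_dist\<close> are bounded; otherwise \<open>mobius_polar\<close> applies.
  The later estimates for Moebius maps all rest on this alternative and on
  \<open>circle_mobius_lipschitz\<close>.
\<close>
lemma circle_mobius_dichotomy:
  assumes "\<epsilon> > 0"
  obtains \<kappa> where "\<kappa> > 0"
    "\<And>g. circle_mobius g \<Longrightarrow> \<not> co_lipschitz \<kappa> g \<Longrightarrow>
        \<exists>r a. cmod r \<le> 2 \<and> cmod a \<le> 2 \<and> (\<forall>z\<in>circle. dist z r * dist (g z) a \<le> \<epsilon>)"
proof -
  define C where "C = max 1 (1 / sqrt \<epsilon>)"
  have C: "C \<ge> 1" "1 / C\<^sup>2 \<le> \<epsilon>"
  proof -
    show "C \<ge> 1" by (simp add: C_def)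
    have "1 / \<epsilon> = (1 / sqrt \<epsilon>)\<^sup>2" using assms by (simp add: power_divide)
    also have "\<dots> \<le> C\<^sup>2" using assms by (intro power_mono) (auto simp: C_def)
    finally show "1 / C\<^sup>2 \<le> \<epsilon>" using assms \<open>C \<ge> 1\<close> by (simp add: field_simps)
  qed
  show ?thesis
  proof (rule that[of "1 / (2 * C + 1)\<^sup>2"])
    show "1 / (2 * C + 1)\<^sup>2 > 0" using C(1) by simp
    fix g assume g: "circle_mobius g" and nc: "\<not> co_lipschitz (1 / (2 * C + 1)\<^sup>2) g"
    obtain \<alpha> \<beta> where ab: "(cmod \<alpha>)\<^sup>2 - (cmod \<beta>)\<^sup>2 = 1" "\<And>z. z \<in> circle \<Longrightarrow> g z = mobius \<alpha> \<beta> z"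
      using g unfolding circle_mobius_def by blast
    have a1: "cmod \<alpha> \<le> cmod \<beta> + 1"
      by (rule power2_le_imp_le) (use ab(1) norm_ge_zero[of \<beta>] in \<open>auto simp: power2_sum simp del: norm_ge_zero\<close>)
    have "C \<le> cmod \<beta>"
    proof (rule ccontr)
      assume "\<not> C \<le> cmod \<beta>"
      have den: "cmod (cnj \<beta> * z + cnj \<alpha>) \<le> 2 * C + 1" if "z \<in> circle" for z
      proof -
        have "cmod (cnj \<beta> * z + cnj \<alpha>) \<le> cmod (cnj \<beta> * z) + cmod (cnj \<alpha>)" by (rule norm_triangle_ineq)
        also have "\<dots> \<le> cmod \<beta> + cmod \<alpha>" using that by (simp add: norm_mult)
        finally show ?thesis using a1 \<open>\<not> C \<le> cmod \<beta>\<close> by linarith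
      qed
      have "1 / (2 * C + 1)\<^sup>2 * dist z w \<le> dist (g z) (g w)" if zw: "z \<in> circle" "w \<in> circle" for z w
      proof -
        have "0 < cmod (cnj \<beta> * z + cnj \<alpha>) * cmod (cnj \<beta> * w + cnj \<alpha>)"
          using mobius_denom_nz[OF ab(1)] zw by simp
        moreover have "cmod (cnj \<beta> * z + cnj \<alpha>) * cmod (cnj \<beta> * w + cnj \<alpha>) \<le> (2 * C + 1)\<^sup>2"
          unfolding power2_eq_square using den zw C(1) by (intro mult_mono) auto
        ultimately have "dist z w / (2 * C + 1)\<^sup>2
            \<le> dist z w / (cmod (cnj \<beta> * z + cnj \<alpha>) * cmod (cnj \<beta> * w + cnj \<alpha>))"
          using C(1) by (intro divide_left_mono mult_pos_pos) auto
        then show ?thesis using mobius_dist[OF ab(1)] zw ab(2) by simp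
      qed
      then show False using nc unfolding co_lipschitz_def by blast
    qed
    then have b: "cmod \<beta> \<ge> 1" "\<beta> \<noteq> 0" using C(1) by auto
    have "1 / (cmod \<beta>)\<^sup>2 \<le> 1 / C\<^sup>2" using \<open>C \<le> cmod \<beta>\<close> C(1) b(2)
      by (intro divide_left_mono power_mono mult_pos_pos) auto
    then have "1 / (cmod \<beta>)\<^sup>2 \<le> \<epsilon>" using C by linarith
    moreover have "cmod \<alpha> / cmod \<beta> \<le> 2" using a1 b by (simp add: field_simps)
    ultimately show "\<exists>r a. cmod r \<le> 2 \<and> cmod a \<le> 2 \<and> (\<forall>z\<in>circle. dist z r * dist (g z) a \<le> \<epsilon>)"
      using mobius_polar[OF ab(1) _ b(2)] ab(2)
      by (intro exI[of _ "- cnj \<alpha> / cnj \<beta>"] exI[of _ "\<alpha> / cnj \<beta>"]) (auto simp: norm_divide)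
  qed
qed

text \<open>
  The largest and the smallest expansion factor of a Moebius map of determinant one are inverse to each
  other, so a lower bound for the contraction is also a Lipschitz bound.
\<close>
lemma circle_mobius_lipschitz:
  assumes g: "circle_mobius g" and "co_lipschitz \<kappa> g" "\<kappa> > 0" "z \<in> circle" "w \<in> circle"
  shows "dist (g z) (g w) \<le> 2 / \<kappa> * dist z w"
proof -
  obtain \<alpha> \<beta> where ab: "(cmod \<alpha>)\<^sup>2 - (cmod \<beta>)\<^sup>2 = 1" "\<And>z. z \<in> circle \<Longrightarrow> g z = mobius \<alpha> \<beta> z"
    using g unfolding circle_mobius_def by blast
  define A B where "A = cmod \<alpha>" and "B = cmod \<beta>"
  have AB: "A\<^sup>2 - B\<^sup>2 = 1" "B < A" "0 \<le> B" using ab(1) norm_gt by (auto simp: A_def B_def)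
  \<comment> \<open>The denominator is largest at \<open>x\<close> and still of comparable size at \<open>\<i> * x\<close>.\<close>
  obtain x where x: "x \<in> circle" "cnj \<beta> * x = B / A * cnj \<alpha>"
  proof (cases "\<beta> = 0")
    case True then show ?thesis using that[of 1] by (simp add: B_def)
  next
    case False
    have "\<alpha> \<noteq> 0" using AB by (auto simp: A_def)
    show ?thesis by (rule that[of "B / A * cnj \<alpha> / cnj \<beta>"])
       (use False \<open>\<alpha> \<noteq> 0\<close> in \<open>auto simp: A_def B_def norm_mult norm_divide\<close>)
  qed
  have ix: "\<i> * x \<in> circle" using x(1) by (simp add: norm_mult)
  have "cnj \<beta> * x + cnj \<alpha> = cnj \<alpha> * of_real ((A + B) / A)"
    unfolding x(2) using AB by (simp add: field_simps)
  then have d1: "cmod (cnj \<beta> * x + cnj \<alpha>) = A + B"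
    using AB by (simp only: norm_mult norm_of_real complex_mod_cnj) (simp add: A_def[symmetric])
  have "cnj \<beta> * (\<i> * x) + cnj \<alpha> = \<i> * (cnj \<beta> * x) + cnj \<alpha>" by (simp add: mult.left_commute)
  also have "\<dots> = cnj \<alpha> * (1 + \<i> * of_real (B / A))" unfolding x(2) by (simp add: distrib_left)
  finally have "cnj \<beta> * (\<i> * x) + cnj \<alpha> = cnj \<alpha> * (1 + \<i> * of_real (B / A))" .
  then have "cmod (cnj \<beta> * (\<i> * x) + cnj \<alpha>) = A * cmod (1 + \<i> * of_real (B / A))"
    by (simp only: norm_mult complex_mod_cnj) (simp add: A_def[symmetric])
  also have "\<dots> = A * sqrt (1 + (B / A)\<^sup>2)" by (simp add: cmod_def)
  also have "\<dots> = sqrt (A\<^sup>2 * (1 + (B / A)\<^sup>2))" using AB by (simp add: real_sqrt_mult)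
  also have "A\<^sup>2 * (1 + (B / A)\<^sup>2) = A\<^sup>2 + B\<^sup>2"
    using AB(2,3) by (simp add: power_divide distrib_left)
  finally have d2: "cmod (cnj \<beta> * (\<i> * x) + cnj \<alpha>) = sqrt (A\<^sup>2 + B\<^sup>2)" .
  have dx: "dist x (\<i> * x) = sqrt 2"
  proof -
    have "x - \<i> * x = (1 - \<i>) * x" by (simp add: algebra_simps)
    then show ?thesis using x(1) by (simp add: dist_norm norm_mult) (simp add: cmod_def)
  qed
  have pos: "(A + B) * sqrt (A\<^sup>2 + B\<^sup>2) > 0" using AB by (simp add: add_pos_nonneg)
  have "\<kappa> * sqrt 2 \<le> sqrt 2 / ((A + B) * sqrt (A\<^sup>2 + B\<^sup>2))"
    using assms(2) x(1) ix mobius_dist[OF ab(1) x(1) ix] ab(2) dx d1 d2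
    unfolding co_lipschitz_def by metis
  then have "sqrt 2 * \<kappa> \<le> sqrt 2 * (1 / ((A + B) * sqrt (A\<^sup>2 + B\<^sup>2)))" by (simp add: mult.commute)
  then have "\<kappa> \<le> 1 / ((A + B) * sqrt (A\<^sup>2 + B\<^sup>2))"
    using mult_left_le_imp_le[of "sqrt 2"] by (metis real_sqrt_gt_0_iff zero_less_numeral)
  then have small: "\<kappa> * ((A + B) * sqrt (A\<^sup>2 + B\<^sup>2)) \<le> 1" using pos pos_le_divide_eq by blast
  have sq: "(A + B) * (A + B) \<le> (A + B) * (2 * sqrt (A\<^sup>2 + B\<^sup>2))"
  proof (intro mult_left_mono)
    have "A \<le> sqrt (A\<^sup>2 + B\<^sup>2)" "B \<le> sqrt (A\<^sup>2 + B\<^sup>2)" 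
      using AB by (auto intro!: real_le_rsqrt)
    then show "A + B \<le> 2 * sqrt (A\<^sup>2 + B\<^sup>2)" by linarith
  qed (use AB in auto)
  have "\<kappa> * (A + B)\<^sup>2 \<le> \<kappa> * ((A + B) * (2 * sqrt (A\<^sup>2 + B\<^sup>2)))"
    unfolding power2_eq_square[of "A + B"] using sq assms(3) by (rule mult_left_mono[OF _ less_imp_le])
  also have "\<dots> = 2 * (\<kappa> * ((A + B) * sqrt (A\<^sup>2 + B\<^sup>2)))" by (simp only: mult_ac)
  also have "\<dots> \<le> 2" using small by linarith
  finally have "\<kappa> * (A + B)\<^sup>2 \<le> 2" .
  then have up: "(A + B)\<^sup>2 \<le> 2 / \<kappa>" using assms(3) by (simp add: field_simps)
  have den: "cmod (cnj \<beta> * z + cnj \<alpha>) \<ge> 1 / (A + B)" if "z \<in> circle" for z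
  proof -
    have "A - B = cmod (cnj \<alpha>) - cmod (cnj \<beta> * z)" using that by (simp add: A_def B_def norm_mult)
    also have "\<dots> \<le> cmod (cnj \<beta> * z + cnj \<alpha>)" by (metis add.commute norm_diff_ineq)
    finally have "A - B \<le> cmod (cnj \<beta> * z + cnj \<alpha>)" .
    moreover have "A - B = 1 / (A + B)" using AB by (simp add: field_simps power2_eq_square)
    ultimately show ?thesis by simp
  qed
  have "(1 / (A + B)) * (1 / (A + B)) \<le> cmod (cnj \<beta> * z + cnj \<alpha>) * cmod (cnj \<beta> * w + cnj \<alpha>)"
    using den assms(4,5) AB by (intro mult_mono) auto
  then have "dist z w / (cmod (cnj \<beta> * z + cnj \<alpha>) * cmod (cnj \<beta> * w + cnj \<alpha>)) \<le> dist z w / ((1 / (A + B)) * (1 / (A + B)))"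
    using AB mobius_denom_nz[OF ab(1)] assms(4,5) by (intro divide_left_mono) (auto intro!: mult_pos_pos)
  also have "\<dots> = (A + B)\<^sup>2 * dist z w" by (simp add: power2_eq_square)
  also have "\<dots> \<le> 2 / \<kappa> * dist z w" using up by (intro mult_right_mono) auto
  finally show ?thesis using mobius_dist[OF ab(1) assms(4,5)] ab(2) assms(4,5) by simp
qed

text \<open>
  A matrix with entries \<open>a, b, c, d\<close> is \<open>u \<mapsto> \<alpha> u + \<beta> cnj u\<close> for the \<open>\<alpha>\<close>, \<open>\<beta>\<close> below, and the point
  of the circle that corresponds to the line through \<open>w\<close> is \<open>w / cnj w\<close>.
\<close>
lemma circle_mobius_projective:
  fixes A :: "real^2^2"
  assumes det: "det A = 1" and g: "\<And>z. z \<in> circle \<Longrightarrow> g z \<in> circle"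
    and act: "\<And>z. z \<in> circle \<Longrightarrow> proj_line (g z) = (\<lambda>v. A *v v) ` proj_line z"
  shows "circle_mobius g"
proof -
  define a b c d where "a = A$1$1" and "b = A$1$2" and "c = A$2$1" and "d = A$2$2"
  have d1: "a * d - b * c = 1" using det by (simp add: det_2 a_def b_def c_def d_def)
  define \<alpha> \<beta> where "\<alpha> = Complex ((a + d) / 2) ((c - b) / 2)" and "\<beta> = Complex ((a - d) / 2) ((c + b) / 2)"
  have n: "(cmod \<alpha>)\<^sup>2 - (cmod \<beta>)\<^sup>2 = 1"
    unfolding cmod_power2 \<alpha>_def \<beta>_def using d1 by (simp add: power2_eq_square field_simps)
  have "g z = mobius \<alpha> \<beta> z" if z: "z \<in> circle" for z
  proof -
    obtain t where t: "z = circ t" using circ_surj z by blast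
    obtain s where s: "g z = circ s" using circ_surj g z by blast
    define u where "u = cis (pi * t)"
    have u2: "u * u = z" by (simp add: u_def t circ_def cis_mult mult.assoc)
    have uu: "u * cnj u = 1" by (simp add: u_def flip: complex_norm_square)
    let ?v = "vector [cos (pi * t), sin (pi * t)] :: real^2"
    have "?v \<in> proj_line z" unfolding t proj_line_circ by (simp add: span_base)
    then have "A *v ?v \<in> proj_line (circ s)" using act[OF z] s by auto
    then obtain r where r: "A *v ?v = r *\<^sub>R vector [cos (pi * s), sin (pi * s)]"
      unfolding proj_line_circ by (auto simp: span_singleton)
    have r1: "a * cos (pi * t) + b * sin (pi * t) = r * cos (pi * s)"
      using arg_cong[OF r, of "\<lambda>v. v $ 1"] by (simp add: matrix_vector_mult_def sum_2 a_def b_def)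
    have r2: "c * cos (pi * t) + d * sin (pi * t) = r * sin (pi * s)"
      using arg_cong[OF r, of "\<lambda>v. v $ 2"] by (simp add: matrix_vector_mult_def sum_2 c_def d_def)
    have w: "\<alpha> * u + \<beta> * cnj u = of_real r * cis (pi * s)"
      using r1 r2 by (simp add: complex_eq_iff \<alpha>_def \<beta>_def u_def field_simps)
    have nz: "cnj \<beta> * z + cnj \<alpha> \<noteq> 0" by (rule mobius_denom_nz[OF n z])
    have "\<alpha> * z + \<beta> = u * (\<alpha> * u + \<beta> * cnj u)" using uu by (simp add: u2[symmetric] algebra_simps)
    then have num: "\<alpha> * z + \<beta> = of_real r * u * cis (pi * s)" using w by simp
    have "cnj \<beta> * z + cnj \<alpha> = u * cnj (\<alpha> * u + \<beta> * cnj u)" using uu by (simp add: u2[symmetric] algebra_simps)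
    then have dn: "cnj \<beta> * z + cnj \<alpha> = of_real r * u * cnj (cis (pi * s))" using w by simp
    have "r \<noteq> 0" "u \<noteq> 0" using nz dn by auto
    then have "mobius \<alpha> \<beta> z = cis (pi * s) / cnj (cis (pi * s))" unfolding mobius_def num dn by simp
    also have "\<dots> = circ s" by (simp add: circ_def cis_cnj cis_divide mult.assoc)
    finally show ?thesis using s by simp
  qed
  with n show ?thesis unfolding circle_mobius_def by blast
qed

text \<open>
  Since \<open>\<bar>\<beta>\<bar> < \<bar>\<alpha>\<bar>\<close>, the number \<open>1 + (\<beta> / \<alpha>) cnj z\<close> stays in the right half plane, where its argument
  is continuous. This gives an explicit lift of degree one.
\<close>
lemma circle_mobius_lift:
  assumes "circle_mobius g"
  obtains h where "continuous_on UNIV h" "\<And>x. h (x + 1) = h x + 1" "\<And>x. circ (h x) = g (circ x)"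
proof -
  obtain \<alpha> \<beta> where ab: "(cmod \<alpha>)\<^sup>2 - (cmod \<beta>)\<^sup>2 = 1" "\<And>z. z \<in> circle \<Longrightarrow> g z = mobius \<alpha> \<beta> z"
    using assms unfolding circle_mobius_def by blast
  have nz: "\<alpha> \<noteq> 0" using norm_gt[OF ab(1)] by auto
  define \<gamma> where "\<gamma> = \<beta> / \<alpha>"
  have \<gamma>: "cmod \<gamma> < 1" using norm_gt[OF ab(1)] nz by (simp add: \<gamma>_def norm_divide divide_less_eq)
  define W where "W t = 1 + \<gamma> * cnj (circ t)" for t
  have Wpos: "Re (W t) > 0" for t
  proof -
    have "\<bar>Re (\<gamma> * cnj (circ t))\<bar> \<le> cmod (\<gamma> * cnj (circ t))" by (rule abs_Re_le_cmod)
    also have "\<dots> < 1" using \<gamma> by (simp add: norm_mult)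
    finally show ?thesis by (simp add: W_def)
  qed
  have W: "W t \<notin> \<real>\<^sub>\<le>\<^sub>0" "W t \<noteq> 0" for t
    using Wpos[of t] by (force simp: complex_nonpos_Reals_iff)+
  define h where "h t = t + Arg \<alpha> / pi + Arg (W t) / pi" for t
  have contW: "continuous_on UNIV W" unfolding W_def by (intro continuous_intros)
  have "continuous_on (- \<real>\<^sub>\<le>\<^sub>0) Arg"
    by (rule continuous_on_Arg)
  from continuous_on_compose2[OF this contW] have "continuous_on UNIV (\<lambda>t. Arg (W t))"
    using W(1) by auto
  then have 1: "continuous_on UNIV h" unfolding h_def by (intro continuous_intros contW) (use W(1) in auto)
  have 2: "h (x + 1) = h x + 1" for x by (simp add: h_def W_def)
  have c: "circ (Arg z / pi) * cnj z = z" if "z \<noteq> 0" for z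
  proof -
    have "circ (Arg z / pi) = cis (Arg z) * cis (Arg z)" by (simp add: circ_def cis_mult)
    moreover have z: "z = of_real (cmod z) * cis (Arg z)"
      using rcis_cmod_Arg[of z] by (simp add: rcis_def)
    then have "cnj z = of_real (cmod z) * cnj (cis (Arg z))"
      by (metis complex_cnj_complex_of_real complex_cnj_mult)
    moreover have "cis (Arg z) * cnj (cis (Arg z)) = 1" by (simp flip: complex_norm_square)
    ultimately have "circ (Arg z / pi) * cnj z = of_real (cmod z) * cis (Arg z) * (cis (Arg z) * cnj (cis (Arg z)))"
      by (simp only: mult_ac)
    also have "\<dots> = z" using z \<open>cis (Arg z) * cnj (cis (Arg z)) = 1\<close> by simp
    finally show ?thesis .
  qed
  have 3: "circ (h x) = g (circ x)" for x
  proof -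
    have u: "circ x * cnj (circ x) = 1" by (simp flip: complex_norm_square)
    have "\<alpha> * circ x + \<beta> = circ x * \<alpha> * W x"
      using nz u by (simp add: W_def \<gamma>_def field_simps)
    moreover have "cnj \<beta> * circ x + cnj \<alpha> = cnj \<alpha> * cnj (W x)"
      using nz by (simp add: W_def \<gamma>_def field_simps)
    moreover have "circ (h x) = circ x * circ (Arg \<alpha> / pi) * circ (Arg (W x) / pi)"
      by (simp add: h_def circ_add)
    moreover have "circ (Arg \<alpha> / pi) = \<alpha> / cnj \<alpha>" using c[OF nz] nz by (simp add: field_simps)
    moreover have "circ (Arg (W x) / pi) = W x / cnj (W x)" using c[OF W(2)] W(2) by (simp add: field_simps)
    ultimately show ?thesis using ab(2) by (simp add: mobius_def)
  qed
  show ?thesis using that 1 2 3 by blast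
qed

lemma co_lipschitz_mono: "co_lipschitz \<kappa> g \<Longrightarrow> \<kappa>' \<le> \<kappa> \<Longrightarrow> co_lipschitz \<kappa>' g"
  unfolding co_lipschitz_def by (meson mult_right_mono order_trans zero_le_dist)

lemma dist_large_prod_small:
  assumes "dist z r * dist y a \<le> \<epsilon>" "dist z r \<ge> \<eta>" "\<eta> > 0" 
  shows "dist y a \<le> \<epsilon> / \<eta>"
proof -
  have "\<eta> * dist y a \<le> dist z r * dist y a" using assms by (intro mult_right_mono) auto
  then show ?thesis using assms by (simp add: field_simps)
qed

text \<open>
  An almost collapsed map whose image of \<open>X\<close> is not small must have its repeller near \<open>X\<close>. Points away
  from \<open>X\<close> are then away from the repeller, and they are sent close together.
\<close>
lemma collapse_off_set:
  assumes "\<eta> > 0" "\<delta> > 0" "\<nu> > 0"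
  obtains \<kappa> where "\<kappa> > 0"
    "\<And>g X x y p p'. \<lbrakk>circle_mobius g; \<not> co_lipschitz \<kappa> g; X \<subseteq> circle; x \<in> X; y \<in> X; dist (g x) (g y) \<ge> \<delta>;
        p \<in> circle; p' \<in> circle; \<And>x. x \<in> X \<Longrightarrow> dist p x \<ge> \<eta>; \<And>x. x \<in> X \<Longrightarrow> dist p' x \<ge> \<eta>\<rbrakk>
       \<Longrightarrow> dist (g p) (g p') < \<nu>"
proof -
  define \<epsilon> where "\<epsilon> = \<eta> * min \<delta> \<nu> / 8"
  have e: "\<epsilon> > 0" using assms by (simp add: \<epsilon>_def)
  define e1 where "e1 = \<epsilon> / (\<eta>/2)"
  have e2: "e1 < \<delta> / 2" "e1 < \<nu> / 2" using assms by (auto simp: e1_def \<epsilon>_def min_def)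
  obtain \<kappa> where k: "\<kappa> > 0" "\<And>g. circle_mobius g \<Longrightarrow> \<not> co_lipschitz \<kappa> g \<Longrightarrow>
        \<exists>r a. cmod r \<le> 2 \<and> cmod a \<le> 2 \<and> (\<forall>z\<in>circle. dist z r * dist (g z) a \<le> \<epsilon>)"
    using circle_mobius_dichotomy[OF e] by blast
  show ?thesis
  proof (rule that[OF k(1)])
    fix g X x y p p' 
    assume *: "circle_mobius g" "\<not> co_lipschitz \<kappa> g" "X \<subseteq> circle" "x \<in> X" "y \<in> X" "dist (g x) (g y) \<ge> \<delta>"
        "p \<in> circle" "p' \<in> circle" "\<And>x. x \<in> X \<Longrightarrow> dist p x \<ge> \<eta>" "\<And>x. x \<in> X \<Longrightarrow> dist p' x \<ge> \<eta>"
    obtain r a where ra: "\<And>z. z \<in> circle \<Longrightarrow> dist z r * dist (g z) a \<le> \<epsilon>" using k(2)[OF *(1,2)] by blast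
    have far: "dist (g z) a \<le> e1" if "z \<in> circle" "dist z r \<ge> \<eta>/2" for z
      using dist_large_prod_small[OF ra[OF that(1)] that(2)] assms unfolding e1_def by simp
    have "\<exists>v\<in>X. dist v r < \<eta>/2"
    proof (rule ccontr)
      assume "\<not> ?thesis"
      then have "dist v r \<ge> \<eta>/2" if "v \<in> X" for v using that by force
      then have "dist (g x) a \<le> e1" "dist (g y) a \<le> e1" using far *(3-5) by blast+
      then show False using *(6) e2 by metric
    qed
    then obtain v where v: "v \<in> X" "dist v r < \<eta>/2" by blast
    have "dist p r \<ge> \<eta>/2" using *(9)[OF v(1)] v(2) by metric
    moreover have "dist p' r \<ge> \<eta>/2" using *(10)[OF v(1)] v(2) by metric
    ultimately have "dist (g p) a \<le> e1" "dist (g p') a \<le> e1" using *(7,8) far by blast+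
    then show "dist (g p) (g p') < \<nu>" using e2 by metric
  qed
qed

text \<open>
  A map that sends a point \<open>p\<close> in a gap of \<open>X\<close> into a gap of the image of \<open>X\<close> cannot be almost
  collapsed: the repeller would be near \<open>X\<close>, so the image of \<open>p\<close> would be near the attractor and the
  image of \<open>X\<close> away from it, which forces \<open>X\<close> into a small neighbourhood of the repeller.
\<close>
lemma co_lipschitz_if_matches_gaps:
  assumes "\<eta> > 0" "\<delta> > 0"
  obtains \<kappa> where "\<kappa> > 0"
    "\<And>g X x y x' y' p. \<lbrakk>circle_mobius g; X \<subseteq> circle; x \<in> X; y \<in> X; dist x y \<ge> \<delta>;
        x' \<in> X; y' \<in> X; dist (g x') (g y') \<ge> \<delta>;
        p \<in> circle; \<And>x. x \<in> X \<Longrightarrow> dist p x \<ge> \<eta>; \<And>x. x \<in> X \<Longrightarrow> dist (g p) (g x) \<ge> \<eta>\<rbrakk>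
       \<Longrightarrow> co_lipschitz \<kappa> g"
proof -
  define \<epsilon> where "\<epsilon> = \<eta> * min \<delta> \<eta> / 8"
  have e: "\<epsilon> > 0" using assms by (simp add: \<epsilon>_def)
  define e1 where "e1 = \<epsilon> / (\<eta>/2)"
  have e2: "e1 < \<delta> / 2" "e1 \<le> \<eta> / 2" using assms by (auto simp: e1_def \<epsilon>_def min_def)
  obtain \<kappa> where k: "\<kappa> > 0" "\<And>g. circle_mobius g \<Longrightarrow> \<not> co_lipschitz \<kappa> g \<Longrightarrow>
        \<exists>r a. cmod r \<le> 2 \<and> cmod a \<le> 2 \<and> (\<forall>z\<in>circle. dist z r * dist (g z) a \<le> \<epsilon>)"
    using circle_mobius_dichotomy[OF e] by blast
  show ?thesis
  proof (rule that[OF k(1)])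
    fix g X x y x' y' p
    assume *: "circle_mobius g" "X \<subseteq> circle" "x \<in> X" "y \<in> X" "dist x y \<ge> \<delta>"
        "x' \<in> X" "y' \<in> X" "dist (g x') (g y') \<ge> \<delta>" "p \<in> circle"
        "\<And>x. x \<in> X \<Longrightarrow> dist p x \<ge> \<eta>" "\<And>x. x \<in> X \<Longrightarrow> dist (g p) (g x) \<ge> \<eta>"
    show "co_lipschitz \<kappa> g"
    proof (rule ccontr)
      assume "\<not> co_lipschitz \<kappa> g"
      then obtain r a where ra: "\<And>z. z \<in> circle \<Longrightarrow> dist z r * dist (g z) a \<le> \<epsilon>" using k(2)[OF *(1)] by blast
      have far: "dist (g z) a \<le> e1" if "z \<in> circle" "dist z r \<ge> \<eta>/2" for z
        using dist_large_prod_small[OF ra[OF that(1)] that(2)] assms unfolding e1_def by simp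
      have far': "dist z r \<le> e1" if "z \<in> circle" "dist (g z) a \<ge> \<eta>/2" for z
        using dist_large_prod_small[of "g z" a z r \<epsilon> "\<eta>/2"] ra[OF that(1)] that(2) assms unfolding e1_def by (simp add: mult.commute)
      have "\<exists>v\<in>X. dist v r < \<eta>/2"
      proof (rule ccontr)
        assume "\<not> ?thesis"
        then have "dist v r \<ge> \<eta>/2" if "v \<in> X" for v using that by force
        then have "dist (g x') a \<le> e1" "dist (g y') a \<le> e1" using far *(2,6,7) by blast+
        then show False using *(8) e2 by metric
      qed
      then obtain v where v: "v \<in> X" "dist v r < \<eta>/2" by blast
      have "dist p r \<ge> \<eta>/2" using *(10)[OF v(1)] v(2) by metric
      then have pa: "dist (g p) a \<le> \<eta>/2" using far[OF *(9)] e2 by simp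
      have "dist z r \<le> e1" if "z \<in> X" for z
      proof (rule far')
        show "dist (g z) a \<ge> \<eta>/2" using *(11)[OF that] pa by metric
      qed (use that *(2) in blast)
      then have "dist x r \<le> e1" "dist y r \<le> e1" using * by auto
      then show False using *(5) e2 by metric
    qed
  qed
qed

text \<open>One of two disjoint pairs avoids the repeller and would be sent close together by a collapse.\<close>
lemma co_lipschitz_if_two_pairs:
  assumes "d > 0" "\<delta> > 0"
  obtains \<kappa> where "\<kappa> > 0"
    "\<And>g x y x' y'. \<lbrakk>circle_mobius g; x \<in> circle; y \<in> circle; x' \<in> circle; y' \<in> circle;
        dist x x' \<ge> d; dist x y' \<ge> d; dist y x' \<ge> d; dist y y' \<ge> d; 
        dist (g x) (g y) \<ge> \<delta>; dist (g x') (g y') \<ge> \<delta>\<rbrakk> \<Longrightarrow> co_lipschitz \<kappa> g"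
proof -
  define \<epsilon> where "\<epsilon> = d * \<delta> / 8"
  have e: "\<epsilon> > 0" using assms by (simp add: \<epsilon>_def)
  define e1 where "e1 = \<epsilon> / (d/2)"
  have e2: "e1 < \<delta> / 2" using assms by (auto simp: e1_def \<epsilon>_def)
  obtain \<kappa> where k: "\<kappa> > 0" "\<And>g. circle_mobius g \<Longrightarrow> \<not> co_lipschitz \<kappa> g \<Longrightarrow>
        \<exists>r a. cmod r \<le> 2 \<and> cmod a \<le> 2 \<and> (\<forall>z\<in>circle. dist z r * dist (g z) a \<le> \<epsilon>)"
    using circle_mobius_dichotomy[OF e] by blast
  show ?thesis
  proof (rule that[OF k(1)])
    fix g x y x' y'
    assume *: "circle_mobius g" "x \<in> circle" "y \<in> circle" "x' \<in> circle" "y' \<in> circle"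
        "dist x x' \<ge> d" "dist x y' \<ge> d" "dist y x' \<ge> d" "dist y y' \<ge> d" 
        "dist (g x) (g y) \<ge> \<delta>" "dist (g x') (g y') \<ge> \<delta>"
    show "co_lipschitz \<kappa> g"
    proof (rule ccontr)
      assume "\<not> co_lipschitz \<kappa> g"
      then obtain r a where ra: "\<And>z. z \<in> circle \<Longrightarrow> dist z r * dist (g z) a \<le> \<epsilon>" using k(2)[OF *(1)] by blast
      have far: "dist (g z) a \<le> e1" if "z \<in> circle" "dist z r \<ge> d/2" for z
        using dist_large_prod_small[OF ra[OF that(1)] that(2)] assms unfolding e1_def by simp
      have "(dist x r \<ge> d/2 \<and> dist y r \<ge> d/2) \<or> (dist x' r \<ge> d/2 \<and> dist y' r \<ge> d/2)"
      proof (rule ccontr)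
        assume "\<not> ?thesis"
        then consider "dist x r < d/2" "dist x' r < d/2" | "dist x r < d/2" "dist y' r < d/2"
          | "dist y r < d/2" "dist x' r < d/2" | "dist y r < d/2" "dist y' r < d/2" by fastforce
        then show False by cases (use *(6-9) in metric)+
      qed
      then show False
      proof
        assume "dist x r \<ge> d/2 \<and> dist y r \<ge> d/2"
        then have "dist (g x) a \<le> e1" "dist (g y) a \<le> e1" using far * by auto
        then show False using *(10) e2 by metric
      next
        assume "dist x' r \<ge> d/2 \<and> dist y' r \<ge> d/2"
        then have "dist (g x') a \<le> e1" "dist (g y') a \<le> e1" using far * by auto
        then show False using *(11) e2 by metric
      qed
    qed
  qed
qed

text \<open>Two of the points \<open>1\<close>, \<open>-1\<close>, \<open>\<i>\<close> avoid the repeller.\<close>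
lemma co_lipschitz_if_spread:
  assumes "\<eta> > 0"
  obtains \<kappa> where "\<kappa> > 0"
    "\<And>g. \<lbrakk>circle_mobius g; \<And>x y. x \<in> circle \<Longrightarrow> y \<in> circle \<Longrightarrow> dist x y \<ge> 1 \<Longrightarrow> dist (g x) (g y) \<ge> \<eta>\<rbrakk> 
       \<Longrightarrow> co_lipschitz \<kappa> g"
proof -
  define \<epsilon> where "\<epsilon> = \<eta> / 8"
  have e: "\<epsilon> > 0" using assms by (simp add: \<epsilon>_def)
  obtain \<kappa> where k: "\<kappa> > 0" "\<And>g. circle_mobius g \<Longrightarrow> \<not> co_lipschitz \<kappa> g \<Longrightarrow>
        \<exists>r a. cmod r \<le> 2 \<and> cmod a \<le> 2 \<and> (\<forall>z\<in>circle. dist z r * dist (g z) a \<le> \<epsilon>)"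
    using circle_mobius_dichotomy[OF e] by blast
  show ?thesis
  proof (rule that[OF k(1)])
    fix g assume g: "circle_mobius g" 
      and *: "\<And>x y. x \<in> circle \<Longrightarrow> y \<in> circle \<Longrightarrow> dist x y \<ge> 1 \<Longrightarrow> dist (g x) (g y) \<ge> \<eta>"
    show "co_lipschitz \<kappa> g"
    proof (rule ccontr)
      assume "\<not> co_lipschitz \<kappa> g"
      then obtain r a where ra: "\<And>z. z \<in> circle \<Longrightarrow> dist z r * dist (g z) a \<le> \<epsilon>" using k(2)[OF g] by blast
      have far: "dist (g z) a \<le> \<epsilon> / (1/2)" if "z \<in> circle" "dist z r \<ge> 1/2" for z
        using dist_large_prod_small[OF ra[OF that(1)] that(2)] by simp
      have no: "\<not> (dist x r \<ge> 1/2 \<and> dist y r \<ge> 1/2)" if "x \<in> circle" "y \<in> circle" "dist x y \<ge> 1" for x y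
      proof
        assume "dist x r \<ge> 1/2 \<and> dist y r \<ge> 1/2"
        then have "dist (g x) a \<le> \<epsilon> / (1/2)" "dist (g y) a \<le> \<epsilon> / (1/2)" using far that by auto
        then have "dist (g x) (g y) \<le> \<eta> / 2" unfolding \<epsilon>_def by metric
        then show False using *[OF that] assms by linarith
      qed
      have s2: "sqrt 2 \<ge> 1" by simp
      have d: "dist (1::complex) (-1) \<ge> 1" "dist (1::complex) \<i> \<ge> 1" "dist (-1::complex) \<i> \<ge> 1"
        using s2 by (auto simp: dist_norm cmod_def)
      then show False using no[of 1 "-1"] no[of 1 \<i>] no[of "-1" \<i>] by simp metric
    qed
  qed
qed

section \<open>Projective cocycles over an irrational rotation\<close>

locale mobius_cocycle =
  fixes \<omega> :: real and f :: "complex \<times> complex \<Rightarrow> complex \<times> complex"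
  assumes irrational: "\<omega> \<notin> \<rat>"
    and homeo: "\<exists>g. homeomorphism torus torus f g"
    and base: "\<theta> \<in> circle \<Longrightarrow> z \<in> circle \<Longrightarrow> fst (f (\<theta>, z)) = \<theta> * circ \<omega>"
    and mobius_fibre: "\<theta> \<in> circle \<Longrightarrow> circle_mobius (\<lambda>z. snd (f (\<theta>, z)))"
begin

definition fb :: "nat \<Rightarrow> real \<Rightarrow> complex \<Rightarrow> complex" where
  "fb n t z = snd ((f ^^ n) (circ t, z))"

lemma f_bij: "bij_betw f torus torus"
  using homeo unfolding homeomorphism_def bij_betw_def by (metis inj_on_def)

lemma f_cont: "continuous_on torus f"
  using homeo unfolding homeomorphism_def by blast

lemma iter_bij: "bij_betw (f ^^ n) torus torus"
proof (induction n)
  case (Suc n) then show ?case using bij_betw_trans[OF Suc f_bij] by (simp add: comp_def)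
qed (simp add: bij_betw_def)

lemma iter_torus: "p \<in> torus \<Longrightarrow> (f ^^ n) p \<in> torus"
  using iter_bij bij_betwE by blast

lemma iter_cont: "continuous_on torus (f ^^ n)"
proof (induction n)
  case (Suc n)
  have "continuous_on torus (f \<circ> (f ^^ n))"
    by (intro continuous_on_compose Suc continuous_on_subset[OF f_cont]) (use iter_torus in blast)
  then show ?case by (simp add: comp_def)
qed (auto intro: continuous_on_id)

lemma iter_eq: 
  assumes "z \<in> circle" 
  shows "(f ^^ n) (circ t, z) = (circ (t + n * \<omega>), fb n t z)"
proof -
  have "fst ((f ^^ n) (circ t, z)) = circ (t + n * \<omega>)"
  proof (induction n)
    case (Suc n)
    have T: "(f ^^ n) (circ t, z) \<in> torus" using assms iter_torus by auto
    have "fst (f ((f ^^ n) (circ t, z))) = fst ((f ^^ n) (circ t, z)) * circ \<omega>"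
      using base[of "fst ((f ^^ n) (circ t, z))" "snd ((f ^^ n) (circ t, z))"] T by (simp add: mem_Times_iff)
    then show ?case using Suc by (simp add: circ_add[symmetric] algebra_simps)
  qed simp
  then show ?thesis by (simp add: fb_def prod_eq_iff)
qed

lemma fb_circle: "z \<in> circle \<Longrightarrow> fb n t z \<in> circle"
  using iter_torus[of "(circ t, z)" n] iter_eq[of z n t] by simp

lemma fb_0 [simp]: "fb 0 t z = z" by (simp add: fb_def)

lemma fb_cong: "circ s = circ t \<Longrightarrow> fb n s = fb n t" by (auto simp: fb_def)

lemma fb_add: 
  assumes "z \<in> circle" 
  shows "fb (n + m) t z = fb n (t + m * \<omega>) (fb m t z)"
  unfolding fb_def[of "n + m"] by (simp add: funpow_add iter_eq[OF assms] iter_eq[OF fb_circle[OF assms]])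

lemma fb_mobius: "circle_mobius (fb n t)"
proof (induction n)
  case 0 then show ?case using circle_mobius_id by (simp add: fb_def[abs_def])
next
  case (Suc n)
  have "circle_mobius (\<lambda>z. snd (f (circ (t + n * \<omega>), z)))" by (intro mobius_fibre) simp
  from circle_mobius_compose[OF this Suc] 
  obtain \<alpha> \<beta> where ab: "(cmod \<alpha>)\<^sup>2 - (cmod \<beta>)\<^sup>2 = 1" 
    "\<And>z. z \<in> circle \<Longrightarrow> snd (f (circ (t + n * \<omega>), fb n t z)) = mobius \<alpha> \<beta> z"
    unfolding circle_mobius_def by blast
  have "fb (Suc n) t z = mobius \<alpha> \<beta> z" if "z \<in> circle" for z
  proof -
    have "fb (Suc n) t z = snd (f ((f ^^ n) (circ t, z)))" by (simp add: fb_def)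
    then show ?thesis using ab(2)[OF that] by (simp only: iter_eq[OF that])
  qed
  with ab(1) show ?case unfolding circle_mobius_def by blast
qed

lemma fb_inj: "z \<in> circle \<Longrightarrow> w \<in> circle \<Longrightarrow> fb n t z = fb n t w \<Longrightarrow> z = w"
  using bij_betw_imp_inj_on[OF iter_bij[of n]] iter_eq[of z n t] iter_eq[of w n t]
  by (auto dest!: inj_onD[where x = "(circ t, z)" and y = "(circ t, w)"])

lemma fb_surj: 
  assumes "w \<in> circle" 
  obtains z where "z \<in> circle" "fb n t z = w"
proof -
  have "(circ (t + n * \<omega>), w) \<in> (f ^^ n) ` torus"
    using assms bij_betw_imp_surj_on[OF iter_bij[of n]] by simp
  then obtain \<theta> z where p: "\<theta> \<in> circle" "z \<in> circle" "(f ^^ n) (\<theta>, z) = (circ (t + n * \<omega>), w)" by force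
  obtain s where s: "\<theta> = circ s" using circ_surj p by blast
  have "circ (s + n * \<omega>) = circ (t + n * \<omega>)" "fb n s z = w" using p(3) iter_eq[OF p(2), of n s] s by auto
  then have "circ s = circ t" by (simp add: circ_eq_iff)
  then show ?thesis using that[OF p(2)] fb_cong \<open>fb n s z = w\<close> by metis
qed

lemma fb_uniform:
  assumes "e > 0"
  shows "\<exists>d>0. \<forall>s t. \<forall>z\<in>circle. \<forall>w\<in>circle. dist (circ s) (circ t) < d \<longrightarrow> dist z w < d
     \<longrightarrow> dist (fb n s z) (fb n t w) < e"
proof -
  have "uniformly_continuous_on torus (f ^^ n)"
    by (intro compact_uniformly_continuous iter_cont compact_Times compact_sphere)
  then obtain d where d: "d > 0" "\<And>p q. p \<in> torus \<Longrightarrow> q \<in> torus \<Longrightarrow> dist q p < d \<Longrightarrow> dist ((f ^^ n) q) ((f ^^ n) p) < e"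
    using assms unfolding uniformly_continuous_on_def by meson
  show ?thesis
  proof (intro exI[of _ "d/2"] conjI allI ballI impI)
    fix s t z w assume *: "z \<in> (circle::complex set)" "w \<in> (circle::complex set)" 
      "dist (circ s) (circ t) < d/2" "dist z w < d/2"
    have "dist (circ s, z) (circ t, w) \<le> dist (circ s) (circ t) + dist z w"
      unfolding dist_Pair_Pair by (rule sqrt_sum_squares_le_sum) auto
    then have "dist (circ s, z) (circ t, w) < d" using * by linarith
    then have "dist ((f ^^ n) (circ s, z)) ((f ^^ n) (circ t, w)) < e" using d(2) * by auto
    then show "dist (fb n s z) (fb n t w) < e"
      using dist_snd_le[of "(f ^^ n) (circ s, z)" "(f ^^ n) (circ t, w)"] by (simp add: fb_def)
  qed (use d in simp)
qed

text \<open>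
  The bound on the waiting time is uniform: it suffices to reach each of finitely many points of a fine
  grid from \<open>0\<close>.
\<close>
lemma rotation_dense:
  assumes "e > 0"
  shows "\<exists>M. \<forall>t s. \<exists>m\<le>M. \<exists>j::int. \<bar>t + real m * \<omega> - s - of_int j\<bar> < e"
proof -
  obtain N where N: "N > 0" "1 / real N < e / 2"
    using assms by (metis half_gt_zero nat_approx_posE of_nat_Suc zero_less_Suc)
  have "\<exists>m::nat. \<exists>j::int. \<bar>real m * \<omega> - real i / real N - of_int j\<bar> < e / 2" for i :: nat
  proof -
    obtain h k :: int where "k > 0" "\<bar>of_int k * \<omega> - of_int h - real i / real N\<bar> < e / 2"
      using sequence_of_fractional_parts_is_dense[OF irrational, of "e/2"] assms by (metis half_gt_zero)
    then show ?thesis by (intro exI[of _ "nat k"] exI[of _ h]) (simp add: algebra_simps)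
  qed
  then obtain m where m: "\<And>i. \<exists>j::int. \<bar>real (m i) * \<omega> - real i / real N - of_int j\<bar> < e / 2" by metis
  show ?thesis
  proof (rule exI[of _ "Max (m ` {..N})"], intro allI)
    fix t s :: real
    define u where "u = frac (s - t)"
    define i where "i = nat \<lfloor>u * real N\<rfloor>"
    have u: "0 \<le> u" "u < 1" by (auto simp: u_def frac_lt_1)
    then have "u * real N < real N" "0 \<le> u * real N" using N by auto
    then have "i \<le> N" "\<bar>u * real N - real i\<bar> \<le> 1" unfolding i_def by linarith+
    have "u * real N - real i = (u - real i / real N) * real N" using N(1) by (simp add: left_diff_distrib)
    then have "\<bar>u - real i / real N\<bar> * real N \<le> 1"
      using \<open>\<bar>u * real N - real i\<bar> \<le> 1\<close> by (simp add: abs_mult)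
    then have "\<bar>u - real i / real N\<bar> \<le> 1 / real N" using N(1) by (simp add: pos_le_divide_eq)
    moreover obtain j :: int where "\<bar>real (m i) * \<omega> - real i / real N - of_int j\<bar> < e / 2" using m by blast
    ultimately have "\<bar>real (m i) * \<omega> - u - of_int j\<bar> < e" using N by linarith
    then have "\<bar>t + real (m i) * \<omega> - s - of_int (j - \<lfloor>s - t\<rfloor>)\<bar> < e"
      by (simp add: u_def frac_def algebra_simps)
    moreover have "m i \<le> Max (m ` {..N})" using \<open>i \<le> N\<close> by (intro Max_ge) auto
    ultimately show "\<exists>m'\<le>Max (m ` {..N}). \<exists>j::int. \<bar>t + real m' * \<omega> - s - of_int j\<bar> < e" by blast
  qed
qed

lemma rotation_dense_circ:
  assumes "e > 0"
  shows "\<exists>M. \<forall>t s. \<exists>m\<le>M. dist (circ (t + real m * \<omega>)) (circ s) < e"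
proof -
  have "e / 10 > 0" using assms by simp
  from rotation_dense[OF this] obtain M where M: "\<And>t s. \<exists>m\<le>M. \<exists>j::int. \<bar>t + real m * \<omega> - s - of_int j\<bar> < e / 10" by blast
  show ?thesis
  proof (rule exI[of _ M], intro allI)
    fix t s
    obtain m and j :: int where m: "m \<le> M" "\<bar>t + real m * \<omega> - s - of_int j\<bar> < e / 10" using M by blast
    have "dist (circ (t + real m * \<omega>)) (circ (s + of_int j)) \<le> 2 * pi * \<bar>t + real m * \<omega> - (s + of_int j)\<bar>" by (rule dist_circ_le)
    also have "\<dots> \<le> 10 * \<bar>t + real m * \<omega> - (s + of_int j)\<bar>" using pi_less_4 by (intro mult_right_mono) auto
    also have "\<dots> < e" using m by (simp add: algebra_simps)
    finally show "\<exists>m\<le>M. dist (circ (t + real m * \<omega>)) (circ s) < e" using m by auto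
  qed
qed

text \<open>
  For a single iterate, compactness of the torus bounds from below the distances of images of points
  that are at distance at least one; by \<open>co_lipschitz_if_spread\<close> this controls all distances.
\<close>
lemma fb_co_lipschitz_upto:
  "\<exists>\<kappa>>0. \<forall>m t. m \<le> M \<longrightarrow> co_lipschitz \<kappa> (fb m t)"
proof -
  have "\<exists>\<kappa>>0. \<forall>t. co_lipschitz \<kappa> (fb m t)" for m
  proof -
    let ?S = "circle \<times> {p \<in> circle \<times> circle. dist (fst p) (snd p) \<ge> 1}"
    let ?h = "\<lambda>q. dist ((f ^^ m) (fst q, fst (snd q))) ((f ^^ m) (fst q, snd (snd q)))"
    have "compact ?S"
    proof -
      have "closed {p::complex\<times>complex. 1 \<le> dist (fst p) (snd p)}" by (intro closed_Collect_le continuous_intros)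
      then have "compact ((circle \<times> circle) \<inter> {p::complex\<times>complex. 1 \<le> dist (fst p) (snd p)})"
        by (intro compact_Int_closed compact_Times compact_sphere)
      then have "compact {p \<in> (circle::complex set) \<times> (circle::complex set). dist (fst p) (snd p) \<ge> 1}" by (simp add: Int_def)
      then show ?thesis by (intro compact_Times compact_sphere)
    qed
    moreover have "?S \<noteq> {}"
    proof -
      have "(1, (1, -1)) \<in> ?S" by (simp add: dist_norm)
      then show ?thesis by blast
    qed
    moreover have "continuous_on ?S ?h"
      by (intro continuous_intros continuous_on_compose2[OF iter_cont]) auto
    ultimately obtain q where q: "q \<in> ?S" "\<And>q'. q' \<in> ?S \<Longrightarrow> ?h q \<le> ?h q'"
      using continuous_attains_inf by (metis (no_types, lifting))
    obtain \<theta> x y where qq: "q = (\<theta>, (x, y))" by (metis prod.collapse)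
    have xy: "\<theta> \<in> circle" "x \<in> circle" "y \<in> circle" "x \<noteq> y" using q(1) qq by auto
    have "(f ^^ m) (\<theta>, x) \<noteq> (f ^^ m) (\<theta>, y)"
      using xy bij_betw_imp_inj_on[OF iter_bij[of m]] by (auto dest!: inj_onD[where x = "(\<theta>, x)" and y = "(\<theta>, y)"])
    then have pos: "?h q > 0" by (simp add: qq)
    obtain \<kappa> where k: "\<kappa> > 0" "\<And>g. \<lbrakk>circle_mobius g; \<And>x y. x \<in> circle \<Longrightarrow> y \<in> circle \<Longrightarrow> dist x y \<ge> 1 \<Longrightarrow> dist (g x) (g y) \<ge> ?h q\<rbrakk> 
       \<Longrightarrow> co_lipschitz \<kappa> g" using co_lipschitz_if_spread[OF pos] by blast
    have "co_lipschitz \<kappa> (fb m t)" for t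
    proof (rule k(2)[OF fb_mobius])
      fix x y assume "x \<in> circle" "y \<in> circle" "dist x y \<ge> (1::real)"
      then show "dist (fb m t x) (fb m t y) \<ge> ?h q"
        using q(2)[of "(circ t, (x, y))"] by (simp add: iter_eq dist_Pair_Pair)
    qed
    with k(1) show ?thesis by blast
  qed
  then obtain \<kappa> where k: "\<And>m. \<kappa> m > 0" "\<And>m t. co_lipschitz (\<kappa> m) (fb m t)" by metis
  show ?thesis
  proof (intro exI[of _ "Min (\<kappa> ` {..M})"] conjI allI impI)
    show "Min (\<kappa> ` {..M}) > 0" using k(1) by simp
    fix m t assume "m \<le> M"
    then have "Min (\<kappa> ` {..M}) \<le> \<kappa> m" by (intro Min_le) auto
    then show "co_lipschitz (Min (\<kappa> ` {..M})) (fb m t)" by (rule co_lipschitz_mono[OF k(2)])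
  qed
qed

definition bounded_cocycle :: bool where
  "bounded_cocycle \<longleftrightarrow> (\<exists>\<kappa>>0. \<forall>n t. co_lipschitz \<kappa> (fb n t))"

text \<open>
  Over a point of the forward orbit of \<open>t0\<close> an iterate is a quotient of two iterates over \<open>t0\<close>, hence
  bounded; the orbit is dense.
\<close>
lemma bounded_cocycle_if_at:
  assumes "\<kappa> > 0" "\<And>n. co_lipschitz \<kappa> (fb n t0)"
  shows bounded_cocycle
proof -
  have orb: "\<kappa> * (\<kappa> / 2) * dist x y \<le> dist (fb n (t0 + m * \<omega>) x) (fb n (t0 + m * \<omega>) y)"
    if xy: "x \<in> circle" "y \<in> circle" for n m :: nat and x y
  proof -
    obtain x' where x': "x' \<in> circle" "fb m t0 x' = x" using fb_surj xy by blast
    obtain y' where y': "y' \<in> circle" "fb m t0 y' = y" using fb_surj xy by blast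
    have "dist x y \<le> 2 / \<kappa> * dist x' y'"
      using circle_mobius_lipschitz[OF fb_mobius assms(2) assms(1) x'(1) y'(1), of m] x' y' by simp
    then have "\<kappa> / 2 * dist x y \<le> dist x' y'" using assms(1) by (simp add: field_simps)
    then have "\<kappa> * (\<kappa> / 2 * dist x y) \<le> \<kappa> * dist x' y'" using assms(1) by (intro mult_left_mono) auto
    also have "\<dots> \<le> dist (fb (n + m) t0 x') (fb (n + m) t0 y')"
      using assms(2) x' y' unfolding co_lipschitz_def by blast
    finally have "\<kappa> * (\<kappa> / 2 * dist x y) \<le> dist (fb (n + m) t0 x') (fb (n + m) t0 y')" .
    moreover have "fb (n + m) t0 x' = fb n (t0 + m * \<omega>) x" using fb_add[OF x'(1), of n m t0] x'(2) by simp
    moreover have "fb (n + m) t0 y' = fb n (t0 + m * \<omega>) y" using fb_add[OF y'(1), of n m t0] y'(2) by simp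
    ultimately show ?thesis by (simp only: mult.assoc)
  qed
  have "co_lipschitz (\<kappa> * (\<kappa> / 2)) (fb n t)" for n t
    unfolding co_lipschitz_def
  proof (intro ballI, rule field_le_epsilon)
    fix x y e assume xy: "x \<in> (circle::complex set)" "y \<in> (circle::complex set)" and e: "(e::real) > 0"
    have e2: "e / 2 > 0" using e by simp
    obtain d where d: "d > 0" "\<forall>s t. \<forall>z\<in>circle. \<forall>w\<in>circle. dist (circ s) (circ t) < d \<longrightarrow> dist z w < d
     \<longrightarrow> dist (fb n s z) (fb n t w) < e / 2" using fb_uniform[OF e2, of n] by blast
    obtain m where m: "dist (circ (t0 + real m * \<omega>)) (circ t) < d" using rotation_dense_circ[OF d(1)] by blast
    have "dist (fb n (t0 + m * \<omega>) x) (fb n t x) < e / 2" "dist (fb n (t0 + m * \<omega>) y) (fb n t y) < e / 2"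
      using d m xy by simp_all
    then show "\<kappa> * (\<kappa> / 2) * dist x y \<le> dist (fb n t x) (fb n t y) + e" using orb[OF xy, of n m] by metric
  qed
  then show ?thesis unfolding bounded_cocycle_def using assms(1) by (metis half_gt_zero mult_pos_pos)
qed

text \<open>
  Boundedly many further steps bring the base point back to \<open>t0\<close> and change the contraction by a
  bounded factor only.
\<close>
lemma unbounded_returns:
  assumes "\<not> bounded_cocycle" "\<epsilon> > 0" "\<kappa> > 0"
  shows "\<exists>n. dist (circ (t0 + real n * \<omega>)) (circ t0) < \<epsilon> \<and> \<not> co_lipschitz \<kappa> (fb n t0)"
proof -
  obtain M where M: "\<And>t s. \<exists>m\<le>M. dist (circ (t + real m * \<omega>)) (circ s) < \<epsilon>" 
    using rotation_dense_circ[OF assms(2)] by blast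
  obtain \<kappa>' where k: "\<kappa>' > 0" "\<And>m t. m \<le> M \<Longrightarrow> co_lipschitz \<kappa>' (fb m t)" using fb_co_lipschitz_upto by blast
  define mu where "mu = \<kappa> / (2 / \<kappa>')"
  have l: "mu > 0" using k assms by (simp add: mu_def)
  obtain n where n: "\<not> co_lipschitz mu (fb n t0)" using bounded_cocycle_if_at[OF l] assms(1) by blast
  obtain m where m: "m \<le> M" "dist (circ (t0 + real n * \<omega> + real m * \<omega>)) (circ t0) < \<epsilon>" using M by blast
  obtain x y where xy: "x \<in> circle" "y \<in> circle" "dist (fb n t0 x) (fb n t0 y) < mu * dist x y"
    using n unfolding co_lipschitz_def by force
  have "dist (fb (m + n) t0 x) (fb (m + n) t0 y) \<le> 2 / \<kappa>' * dist (fb n t0 x) (fb n t0 y)"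
    using circle_mobius_lipschitz[OF fb_mobius k(2)[OF m(1)] k(1)] xy fb_circle by (simp add: fb_add)
  also have "\<dots> < 2 / \<kappa>' * (mu * dist x y)" using xy k(1) by (intro mult_strict_left_mono) auto
  also have "\<dots> = \<kappa> * dist x y" using k(1) by (simp add: mu_def)
  finally have "\<not> co_lipschitz \<kappa> (fb (m + n) t0)" using xy unfolding co_lipschitz_def by force
  moreover have "dist (circ (t0 + real (m + n) * \<omega>)) (circ t0) < \<epsilon>" using m by (simp add: algebra_simps)
  ultimately show ?thesis by blast
qed

text \<open>
  The repellers and attractors of a sequence of returns with unbounded norm have a common limit along
  a subsequence.
\<close>
lemma unbounded_collapse:
  assumes "\<not> bounded_cocycle"
  shows "\<exists>r a. \<forall>\<epsilon> \<kappa>. \<epsilon> > 0 \<longrightarrow> \<kappa> > 0 \<longrightarrow> (\<exists>n. dist (circ (t0 + real n * \<omega>)) (circ t0) < \<epsilon> \<and>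
       \<not> co_lipschitz \<kappa> (fb n t0) \<and> (\<forall>z\<in>circle. dist z r * dist (fb n t0 z) a \<le> \<epsilon>))"
proof -
  let ?\<epsilon> = "\<lambda>k::nat. 1 / real (Suc k)"
  have "\<exists>n r a. dist (circ (t0 + real n * \<omega>)) (circ t0) < ?\<epsilon> k \<and> \<not> co_lipschitz (?\<epsilon> k) (fb n t0) \<and>
      cmod r \<le> 2 \<and> cmod a \<le> 2 \<and> (\<forall>z\<in>circle. dist z r * dist (fb n t0 z) a \<le> ?\<epsilon> k)" for k
  proof -
    have e: "?\<epsilon> k > 0" by simp
    obtain \<kappa> where k: "\<kappa> > 0" "\<And>g. circle_mobius g \<Longrightarrow> \<not> co_lipschitz \<kappa> g \<Longrightarrow>
        \<exists>r a. cmod r \<le> 2 \<and> cmod a \<le> 2 \<and> (\<forall>z\<in>circle. dist z r * dist (g z) a \<le> ?\<epsilon> k)"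
      using circle_mobius_dichotomy[OF e] by blast
    have "min \<kappa> (?\<epsilon> k) > 0" using k e by simp
    then obtain n where n: "dist (circ (t0 + real n * \<omega>)) (circ t0) < ?\<epsilon> k" "\<not> co_lipschitz (min \<kappa> (?\<epsilon> k)) (fb n t0)"
      using unbounded_returns[OF assms e] by blast
    have "\<not> co_lipschitz \<kappa> (fb n t0)" "\<not> co_lipschitz (?\<epsilon> k) (fb n t0)"
      using n(2) co_lipschitz_mono by (metis min.cobounded1, metis min.cobounded2)
    then show ?thesis using k(2)[OF fb_mobius] n(1) by metis
  qed
  then obtain n r a where nra: "\<And>k. dist (circ (t0 + real (n k) * \<omega>)) (circ t0) < ?\<epsilon> k" 
      "\<And>k. \<not> co_lipschitz (?\<epsilon> k) (fb (n k) t0)" "\<And>k. cmod (r k) \<le> 2" "\<And>k. cmod (a k) \<le> 2" 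
      "\<And>k z. z \<in> circle \<Longrightarrow> dist z (r k) * dist (fb (n k) t0 z) (a k) \<le> ?\<epsilon> k"
    by metis
  have "compact (cball (0::complex) 2 \<times> cball (0::complex) 2)" by (intro compact_Times compact_cball)
  moreover have "\<forall>k. (r k, a k) \<in> cball 0 2 \<times> cball 0 2" using nra by simp
  ultimately obtain l \<sigma> where l: "l \<in> cball 0 2 \<times> cball 0 2" "strict_mono \<sigma>" "((\<lambda>k. (r k, a k)) \<circ> \<sigma>) \<longlonglongrightarrow> l"
    unfolding compact_eq_seq_compact_metric seq_compact_def by meson
  obtain r0 a0 where ra0: "l = (r0, a0)" by (metis prod.collapse)
  have lim: "(\<lambda>k. r (\<sigma> k)) \<longlonglongrightarrow> r0" "(\<lambda>k. a (\<sigma> k)) \<longlonglongrightarrow> a0" 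
    using tendsto_fst[OF l(3)] tendsto_snd[OF l(3)] by (auto simp: ra0 o_def)
  show ?thesis
  proof (rule exI[of _ r0], rule exI[of _ a0], intro allI impI)
    fix \<epsilon> \<kappa> :: real assume pos: "\<epsilon> > 0" "\<kappa> > 0"
    define e where "e = min (\<epsilon> / 10) \<kappa>"
    have e: "e > 0" "e \<le> \<epsilon> / 10" "e \<le> \<kappa>" using pos by (auto simp: e_def)
    have "\<forall>\<^sub>F k in sequentially. dist (r (\<sigma> k)) r0 < e" "\<forall>\<^sub>F k in sequentially. dist (a (\<sigma> k)) a0 < e"
      using lim e by (auto dest: tendstoD)
    moreover have "\<forall>\<^sub>F k in sequentially. ?\<epsilon> k < e" using e(1) by (rule order_tendstoD(2)[OF LIMSEQ_Suc[OF lim_1_over_n]])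
    ultimately have "\<forall>\<^sub>F k in sequentially. dist (r (\<sigma> k)) r0 < e \<and> dist (a (\<sigma> k)) a0 < e \<and> ?\<epsilon> k < e"
      by eventually_elim auto
    then obtain k where k: "dist (r (\<sigma> k)) r0 < e" "dist (a (\<sigma> k)) a0 < e" "?\<epsilon> k < e"
      by (metis (no_types, lifting) eventually_sequentially order_refl)
    have "?\<epsilon> (\<sigma> k) \<le> ?\<epsilon> k" using seq_suble[OF l(2), of k] by (simp add: frac_le)
    then have ek: "?\<epsilon> (\<sigma> k) < e" using k by linarith
    let ?n = "n (\<sigma> k)"
    have "dist z r0 * dist (fb ?n t0 z) a0 \<le> \<epsilon>" if z: "z \<in> circle" for z
    proof -
      define y where "y = fb ?n t0 z"
      have y: "cmod y = 1" "cmod z = 1" using fb_circle z by (auto simp: y_def)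
      have b1: "dist z r0 \<le> 3" using l(1) y norm_triangle_ineq4[of z r0] by (simp add: ra0 dist_norm)
      have b2: "dist y (a (\<sigma> k)) \<le> 3" using nra(4)[of "\<sigma> k"] y norm_triangle_ineq4[of y "a (\<sigma> k)"] by (simp add: dist_norm)
      have "dist z r0 * dist y a0 \<le> dist z r0 * (dist y (a (\<sigma> k)) + e)"
        using k(2) by (intro mult_left_mono) (metric, simp)
      also have "\<dots> \<le> dist z r0 * dist y (a (\<sigma> k)) + 3 * e" using b1 e by (simp add: distrib_left)
      also have "dist z r0 * dist y (a (\<sigma> k)) \<le> (dist z (r (\<sigma> k)) + e) * dist y (a (\<sigma> k))"
        using k(1) by (intro mult_right_mono) (metric, simp)
      also have "\<dots> \<le> dist z (r (\<sigma> k)) * dist y (a (\<sigma> k)) + e * 3" using b2 e by (simp add: distrib_right)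
      also have "dist z (r (\<sigma> k)) * dist y (a (\<sigma> k)) \<le> e" using nra(5)[OF z, of "\<sigma> k"] ek unfolding y_def by linarith
      finally show ?thesis using e unfolding y_def by linarith
    qed
    moreover have "\<not> co_lipschitz \<kappa> (fb ?n t0)" using nra(2)[of "\<sigma> k"] ek e co_lipschitz_mono
      by (meson less_le_trans less_imp_le)
    moreover have "dist (circ (t0 + real ?n * \<omega>)) (circ t0) < \<epsilon>" using nra(1)[of "\<sigma> k"] ek e pos by linarith
    ultimately show "\<exists>n. dist (circ (t0 + real n * \<omega>)) (circ t0) < \<epsilon> \<and>
       \<not> co_lipschitz \<kappa> (fb n t0) \<and> (\<forall>z\<in>circle. dist z r0 * dist (fb n t0 z) a0 \<le> \<epsilon>)" by blast
  qed
qed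

end

section \<open>Minimal sets\<close>

lemma baire_circle:
  fixes \<G> :: "complex set set"
  assumes "countable \<G>" "\<G> \<noteq> {}" "\<And>T. T \<in> \<G> \<Longrightarrow> openin (top_of_set circle) T \<and> circle \<subseteq> closure T"
  shows "gdelta_in (top_of_set circle) (\<Inter>\<G>)" "circle \<subseteq> closure (\<Inter>\<G>)"
proof -
  show "gdelta_in (top_of_set circle) (\<Inter>\<G>)"
    using assms by (intro gdelta_in_Inter) (auto intro: open_imp_gdelta_in)
  show "circle \<subseteq> closure (\<Inter>\<G>)"
    using assms by (intro Baire closed_sphere) auto
qed

lemma connected_torus: "connected torus"
proof -
  have "circle = range circ" using circ_surj circ_in_circle by blast
  moreover have "connected (range circ)"
    by (intro connected_continuous_image connected_UNIV continuous_on_circ continuous_on_id)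
  ultimately show ?thesis by (simp add: connected_Times)
qed

text \<open>
  The points of \<open>L\<close> that are at distance at least \<open>e\<close> from the fibre over \<open>circ t\<close> form a compact set,
  and its projection misses \<open>circ t\<close>.
\<close>
lemma fibre_upper_semicontinuous:
  assumes "compact L" "e > 0"
  shows "\<exists>d>0. \<forall>s. dist (circ s) (circ t) < d \<longrightarrow> (\<forall>z. (circ s, z) \<in> L \<longrightarrow> (\<exists>w. (circ t, w) \<in> L \<and> dist z w < (e::real)))"
proof -
  define C where "C = L \<inter> (\<Inter>w\<in>{w. (circ t, w) \<in> L}. {p. e \<le> dist (snd p) w})"
  have "closed {p. e \<le> dist (snd p) w}" for w
    by (intro closed_Collect_le continuous_intros)
  then have "compact C" unfolding C_def by (intro compact_Int_closed assms closed_INT) auto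
  then have "closed (fst ` C)" by (intro compact_imp_closed compact_continuous_image continuous_intros)
  moreover have "circ t \<notin> fst ` C"
  proof
    assume "circ t \<in> fst ` C"
    then obtain w where "(circ t, w) \<in> C" by force
    then have "(circ t, w) \<in> L" "e \<le> dist w w" by (auto simp: C_def)
    then show False using assms by simp
  qed
  ultimately obtain d where d: "d > 0" "ball (circ t) d \<inter> fst ` C = {}"
    by (metis open_Compl openE Compl_iff disjoint_eq_subset_Compl)
  have "\<exists>w. (circ t, w) \<in> L \<and> dist z w < e" if "dist (circ s) (circ t) < d" "(circ s, z) \<in> L" for s z
  proof (rule ccontr)
    assume "\<not> ?thesis"
    then have "(circ s, z) \<in> C" using that(2) by (auto simp: C_def not_less)
    then have "circ s \<in> fst ` C" by force
    moreover have "circ s \<in> ball (circ t) d" using that(1) by (simp add: dist_commute)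
    ultimately show False using d(2) by blast
  qed
  then show ?thesis using d(1) by blast
qed

locale minimal_cocycle = mobius_cocycle +
  fixes K :: "(complex \<times> complex) set"
  assumes minimal: "minimal_set f K" and not_torus: "K \<noteq> torus"
begin

definition Kc :: "real \<Rightarrow> complex set" where "Kc t = {z. (circ t, z) \<in> K}"

lemma K_props: "K \<noteq> {}" "K \<subseteq> torus" "compact K" "closed K" "f ` K = K"
  using minimal unfolding minimal_set_def compact_invariant_def by (auto intro: compact_imp_closed)

lemma Kc_circle: "z \<in> Kc t \<Longrightarrow> z \<in> circle"
  using K_props(2) by (auto simp: Kc_def)

lemma Kc_subset: "Kc t \<subseteq> circle" using Kc_circle by blast

lemma fibre_eq: "K \<inter> ({circ t} \<times> circle) = Pair (circ t) ` Kc t"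
  using Kc_circle unfolding Kc_def by blast

lemma Kc_cong: "circ s = circ t \<Longrightarrow> Kc s = Kc t" by (simp add: Kc_def)

lemma iter_K: "p \<in> torus \<Longrightarrow> (f ^^ n) p \<in> K \<longleftrightarrow> p \<in> K"
proof (induction n)
  case (Suc n)
  let ?q = "(f ^^ n) p"
  have q: "?q \<in> torus" using iter_torus Suc.prems .
  have "f ?q \<in> K \<longleftrightarrow> ?q \<in> K"
  proof
    assume "f ?q \<in> K"
    then obtain r where r: "r \<in> K" "f r = f ?q" using K_props(5) by (metis imageE)
    then have "r = ?q" using bij_betw_imp_inj_on[OF f_bij] q K_props(2) by (meson inj_onD subsetD)
    then show "?q \<in> K" using r by simp
  next
    assume "?q \<in> K" then show "f ?q \<in> K" using K_props(5) by blast
  qed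
  then show ?case using Suc by simp
qed simp

lemma fb_Kc: "z \<in> circle \<Longrightarrow> fb n t z \<in> Kc (t + n * \<omega>) \<longleftrightarrow> z \<in> Kc t"
  using iter_K[of "(circ t, z)" n] iter_eq[of z n t] by (simp add: Kc_def)

lemma fb_Kc_surj:
  assumes "w \<in> Kc (t + n * \<omega>)"
  shows "\<exists>z\<in>Kc t. fb n t z = w"
proof -
  obtain z where "z \<in> circle" "fb n t z = w" using fb_surj[OF Kc_circle[OF assms]] by metis
  then show ?thesis using fb_Kc[of z n t] assms by auto
qed

lemma compact_Kc: "compact (Kc t)"
proof -
  have "Kc t = circle \<inter> (Pair (circ t)) -` K" using Kc_circle by (auto simp: Kc_def)
  moreover have "closed (Pair (circ t) -` K)"
    by (intro closed_vimage K_props continuous_intros)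
  ultimately show ?thesis by (simp add: compact_Int_closed)
qed

text \<open>
  Otherwise the points of \<open>K\<close> whose forward orbit misses the given box would form a non-empty compact
  set \<open>L0\<close> with \<open>f ` L0 \<subseteq> L0\<close>, and the intersection of its images would be a smaller compact invariant
  set.
\<close>
lemma visits:
  assumes "z \<in> Kc t" "w \<in> Kc s" "e > 0"
  shows "\<exists>n. dist (circ (t + real n * \<omega>)) (circ s) < e \<and> dist (fb n t z) w < e"
proof (rule ccontr)
  assume no: "\<not> ?thesis"
  define U where "U = ball (circ s) e \<times> ball w e"
  define L0 where "L0 = (\<Inter>n. K \<inter> (f ^^ n) -` (- U))"
  have "open U" by (simp add: U_def open_Times)
  have contK: "continuous_on K (f ^^ n)" for n using iter_cont continuous_on_subset K_props(2) by blast
  have "closed (K \<inter> (f ^^ n) -` (- U))" for n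
    by (intro continuous_closed_preimage contK K_props closed_Compl) (use \<open>open U\<close> in \<open>simp add: closed_open\<close>)
  then have "closed L0" unfolding L0_def by (intro closed_INT) blast
  then have cL0: "compact L0" using compact_Int_closed[OF K_props(3), of L0] by (auto simp: L0_def Int_absorb1)
  have "(circ t, z) \<in> L0"
  proof -
    have "(f ^^ n) (circ t, z) \<notin> U" for n
      using no iter_eq[OF Kc_circle[OF assms(1)], of n t] by (auto simp: U_def dist_commute)
    then show ?thesis using assms(1) by (auto simp: L0_def Kc_def)
  qed
  have fL0: "f ` L0 \<subseteq> L0"
  proof
    fix q assume "q \<in> f ` L0"
    then obtain p where p: "p \<in> L0" "q = f p" by blast
    have "p \<in> K" using p by (auto simp: L0_def)
    then have "q \<in> K" using p K_props(5) by blast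
    moreover have "(f ^^ n) q \<notin> U" for n
    proof -
      have "(f ^^ Suc n) p \<notin> U" using p(1) unfolding L0_def by blast
      then show ?thesis by (simp add: p(2) funpow_swap1)
    qed
    ultimately show "q \<in> L0" by (auto simp: L0_def)
  qed
  have L0K: "L0 \<subseteq> K" by (auto simp: L0_def)
  define F where "F n = (f ^^ n) ` L0" for n
  have FSuc: "F (Suc n) = f ` F n" for n by (simp add: F_def image_image)
  have dec: "F (Suc n) \<subseteq> F n" for n
  proof (induction n)
    case 0 then show ?case using fL0 by (simp add: F_def)
  next
    case (Suc n) then show ?case using FSuc by blast
  qed
  have cF: "compact (F n)" for n unfolding F_def
    using cL0 L0K contK continuous_on_subset by (intro compact_continuous_image) blast+
  have neF: "F n \<noteq> {}" for n using \<open>(circ t, z) \<in> L0\<close> by (auto simp: F_def)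
  have antiF: "F n \<subseteq> F m" if "m \<le> n" for m n using lift_Suc_antimono_le[of F, OF dec that] .
  \<comment> \<open>\<open>f ` L = L\<close> and not only an inclusion, because the \<open>F n\<close> decrease and \<open>f\<close> is injective.\<close>
  define L where "L = (\<Inter>n. F n)"
  have "L \<noteq> {}" unfolding L_def using compact_nest[of F] cF neF antiF by auto
  have LF: "L \<subseteq> F 0" by (auto simp: L_def)
  then have LL0: "L \<subseteq> L0" by (simp add: F_def)
  have "closed L" unfolding L_def using cF by (intro closed_INT) (auto intro: compact_imp_closed)
  then have "compact L" using compact_Int_closed[OF cL0, of L] LL0 by (simp add: Int_absorb1)
  moreover have "f ` L = L"
  proof -
    have "F n \<subseteq> torus" for n using antiF[of 0 n] L0K K_props(2) by (auto simp: F_def)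
    then have "f ` (\<Inter>n. F n) = (\<Inter>n. f ` F n)"
      using image_INT[of f torus UNIV F 0] bij_betw_imp_inj_on[OF f_bij] by auto
    also have "\<dots> = (\<Inter>n. F (Suc n))" by (simp add: FSuc)
    also have "\<dots> = (\<Inter>n. F n)" using dec by blast
    finally show ?thesis by (simp add: L_def)
  qed
  ultimately have "compact_invariant f L" 
    using \<open>L \<noteq> {}\<close> LL0 L0K K_props(2) unfolding compact_invariant_def by blast
  then have "L = K" using minimal LL0 L0K unfolding minimal_set_def by blast
  then have "(circ s, w) \<in> L0" using assms(2) LL0 by (auto simp: Kc_def)
  then have "(f ^^ 0) (circ s, w) \<notin> U" unfolding L0_def by blast
  then show False using assms(3) by (simp add: U_def)
qed

lemma Kc_nonempty: "Kc t \<noteq> {}"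
proof -
  obtain \<theta> z where z: "(\<theta>, z) \<in> K" using K_props(1) by auto
  then obtain t0 where t0: "\<theta> = circ t0" using circ_surj K_props(2) by blast
  then have zK: "z \<in> Kc t0" using z by (simp add: Kc_def)
  have "closed (fst ` K)" by (intro compact_imp_closed compact_continuous_image continuous_intros K_props)
  moreover have "circ t \<in> closure (fst ` K)"
    unfolding closure_approachable
  proof (intro allI impI)
    fix e :: real assume "e > 0"
    then obtain m where m: "dist (circ (t0 + real m * \<omega>)) (circ t) < e" using rotation_dense_circ by blast
    have "fb m t0 z \<in> Kc (t0 + real m * \<omega>)" using fb_Kc zK Kc_circle by blast
    then have "circ (t0 + real m * \<omega>) \<in> fst ` K" by (force simp: Kc_def)
    then show "\<exists>y\<in>fst ` K. dist y (circ t) < e" using m by blast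
  qed
  ultimately have "circ t \<in> fst ` K" by simp
  then show ?thesis by (force simp: Kc_def)
qed

lemma K_upper_semicontinuous:
  assumes "e > 0"
  shows "\<exists>d>0. \<forall>s. dist (circ s) (circ t) < d \<longrightarrow> (\<forall>z\<in>Kc s. \<exists>w\<in>Kc t. dist z w < e)"
proof -
  obtain d where "d > 0" "\<forall>s. dist (circ s) (circ t) < d \<longrightarrow>
      (\<forall>z. (circ s, z) \<in> K \<longrightarrow> (\<exists>w. (circ t, w) \<in> K \<and> dist z w < e))"
    using fibre_upper_semicontinuous[OF K_props(3) assms, of t] by blast
  then show ?thesis unfolding Kc_def by blast
qed

lemma Kc_limit:
  assumes "z \<in> circle" "\<And>e. e > 0 \<Longrightarrow> \<exists>s w. w \<in> Kc s \<and> dist (circ s) (circ t) < e \<and> dist w z < e"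
  shows "z \<in> Kc t"
proof -
  have "(circ t, z) \<in> closure K"
    unfolding closure_approachable
  proof (intro allI impI)
    fix e :: real assume "e > 0"
    then obtain s w where sw: "w \<in> Kc s" "dist (circ s) (circ t) < e/2" "dist w z < e/2"
      using assms(2)[of "e/2"] by auto
    have "dist (circ s, w) (circ t, z) \<le> dist (circ s) (circ t) + dist w z"
      unfolding dist_Pair_Pair by (rule sqrt_sum_squares_le_sum) auto
    then have "dist (circ s, w) (circ t, z) < e" using sw by linarith
    then show "\<exists>y\<in>K. dist y (circ t, z) < e" using sw(1) by (auto simp: Kc_def)
  qed
  then show ?thesis using K_props(4) by (simp add: Kc_def)
qed

definition spread :: "real \<Rightarrow> bool" where
  "spread \<delta> \<longleftrightarrow> \<delta> > 0 \<and> (\<forall>t. \<exists>x\<in>Kc t. \<exists>y\<in>Kc t. dist x y \<ge> \<delta>)"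

text \<open>
  The base points whose fibre has diameter less than \<open>e\<close> form an open set. If all these sets are dense,
  Baire's theorem gives one-point fibres. If one of them misses an arc, boundedly many iterates of this
  arc cover the circle and carry pairs of points at distance \<open>e\<close> to all fibres.
\<close>
lemma generic_one_or_spread: "generic_fibre_card K 1 \<or> (\<exists>\<delta>. spread \<delta>)"
proof -
  define C where "C e = (circle \<times> circle \<times> circle) \<inter> ({q. (fst q, fst (snd q)) \<in> K} \<inter> {q. (fst q, snd (snd q)) \<in> K} 
      \<inter> {q. e \<le> dist (fst (snd q)) (snd (snd q))})" for e :: real
  define U where "U e = circle - fst ` C e" for e
  have "closed {q::complex\<times>complex\<times>complex. (fst q, fst (snd q)) \<in> K}" "closed {q::complex\<times>complex\<times>complex. (fst q, snd (snd q)) \<in> K}"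
  proof -
    have "closed ((\<lambda>q::complex\<times>complex\<times>complex. (fst q, fst (snd q))) -` K)" 
         "closed ((\<lambda>q::complex\<times>complex\<times>complex. (fst q, snd (snd q))) -` K)"
      by (intro closed_vimage K_props continuous_intros)+
    then show "closed {q::complex\<times>complex\<times>complex. (fst q, fst (snd q)) \<in> K}" 
        "closed {q::complex\<times>complex\<times>complex. (fst q, snd (snd q)) \<in> K}" by (simp_all add: vimage_def)
  qed
  moreover have "closed {q::complex\<times>complex\<times>complex. e \<le> dist (fst (snd q)) (snd (snd q))}" for e
    by (intro closed_Collect_le continuous_intros)
  ultimately have "compact (C e)" for e unfolding C_def
    by (intro compact_Int_closed compact_Times compact_sphere closed_Int)
  then have "closed (fst ` C e)" for e by (intro compact_imp_closed compact_continuous_image continuous_intros)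
  then have "openin (top_of_set circle) (circle \<inter> - fst ` C e)" for e by (intro openin_open_Int) auto
  then have U_open: "openin (top_of_set circle) (U e)" for e unfolding U_def by (simp add: Diff_eq)
  have U_iff: "circ t \<in> U e \<longleftrightarrow> (\<forall>x\<in>Kc t. \<forall>y\<in>Kc t. dist x y < e)" for t e
  proof -
    have "circ t \<in> fst ` C e \<longleftrightarrow> (\<exists>x y. (circ t, x, y) \<in> C e)" by force
    also have "\<dots> \<longleftrightarrow> (\<exists>x\<in>Kc t. \<exists>y\<in>Kc t. e \<le> dist x y)" 
      using Kc_circle by (auto simp: C_def Kc_def)
    finally show ?thesis by (auto simp: U_def not_le)
  qed
  show ?thesis
  proof (cases "\<forall>e>0. circle \<subseteq> closure (U e)")
    case True
    define \<G> where "\<G> = range (\<lambda>k::nat. U (1 / Suc k))"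
    have \<G>: "countable \<G>" "\<G> \<noteq> {}" unfolding \<G>_def by auto
    have \<G>3: "openin (top_of_set circle) T \<and> circle \<subseteq> closure T" if T: "T \<in> \<G>" for T
    proof -
      from T obtain k :: nat where k: "T = U (1 / Suc k)" unfolding \<G>_def by (elim rangeE)
      have "1 / real (Suc k) > 0" by simp
      then show ?thesis unfolding k using True U_open by blast
    qed
    have "finite (K \<inter> ({\<theta>} \<times> circle)) \<and> card (K \<inter> ({\<theta>} \<times> circle)) = 1" if "\<theta> \<in> \<Inter>\<G>" for \<theta>
    proof -
      have "U (1 / Suc 0) \<in> \<G>" unfolding \<G>_def by (rule rangeI)
      then have "\<theta> \<in> U (1 / Suc 0)" using that by blast
      then obtain t where t: "\<theta> = circ t" using circ_surj by (auto simp: U_def)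
      obtain x where x: "x \<in> Kc t" using Kc_nonempty by blast
      have "y = x" if y: "y \<in> Kc t" for y
      proof (rule ccontr)
        assume "y \<noteq> x"
        then obtain k where "1 / real (Suc k) < dist y x" using nat_approx_posE by (metis zero_less_dist_iff)
        moreover have "circ t \<in> U (1 / Suc k)" using \<open>\<theta> \<in> \<Inter>\<G>\<close> t unfolding \<G>_def by blast
        then have "dist y x < 1 / Suc k" using U_iff[THEN iffD1] x y by blast
        ultimately show False by simp
      qed
      then have "Kc t = {x}" using x by blast
      then have "K \<inter> ({\<theta>} \<times> circle) = {(circ t, x)}" unfolding t fibre_eq by simp
      then show ?thesis by simp
    qed
    then have "generic_fibre_card K 1" unfolding generic_fibre_card_def using baire_circle[OF \<G> \<G>3] by blast
    then show ?thesis by blast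
  next
    case False
    then obtain e \<theta> where e: "e > 0" "\<theta> \<in> circle" "\<theta> \<notin> closure (U e)" by blast
    then obtain t1 where t1: "\<theta> = circ t1" using circ_surj by blast
    obtain d where d: "d > 0" "\<And>y. y \<in> U e \<Longrightarrow> dist y \<theta> \<ge> d"
      using e(3) by (force simp: closure_approachable not_less)
    obtain M where M: "\<forall>t s. \<exists>m\<le>M. dist (circ (t + real m * \<omega>)) (circ s) < d" using rotation_dense_circ[OF d(1)] by blast
    obtain \<kappa> where k: "\<kappa> > 0" "\<And>m t. m \<le> M \<Longrightarrow> co_lipschitz \<kappa> (fb m t)" using fb_co_lipschitz_upto by blast
    have "\<exists>x\<in>Kc t. \<exists>y\<in>Kc t. dist x y \<ge> \<kappa> * e" for t
    proof -
      obtain m where m: "m \<le> M" "dist (circ (t1 + real m * \<omega>)) (circ t) < d" using M by blast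
      define s where "s = t - real m * \<omega>"
      have "dist (circ s) \<theta> < d" using m(2) dist_circ_add[of t1 "real m * \<omega>" s] 
        by (simp add: s_def t1 dist_commute)
      then have "circ s \<notin> U e" using d(2) by force
      then obtain x y where xy: "x \<in> Kc s" "y \<in> Kc s" "dist x y \<ge> e" using U_iff by (force simp: not_less)
      have "\<kappa> * e \<le> \<kappa> * dist x y" using k(1) xy by simp
      also have "\<dots> \<le> dist (fb m s x) (fb m s y)" 
        using k(2)[OF m(1)] xy Kc_circle unfolding co_lipschitz_def by blast
      finally have "\<kappa> * e \<le> dist (fb m s x) (fb m s y)" .
      moreover have "fb m s x \<in> Kc t" "fb m s y \<in> Kc t"
        using fb_Kc[of x m s] fb_Kc[of y m s] xy Kc_circle by (auto simp: s_def)
      ultimately show ?thesis by blast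
    qed
    then have "spread (\<kappa> * e)" using k(1) e(1) by (simp add: spread_def)
    then show ?thesis by blast
  qed
qed

text \<open>
  A box in \<open>K\<close> would be visited by all orbits in \<open>K\<close>, so \<open>K\<close> would be open in the torus and by
  connectedness all of it.
\<close>
lemma no_box:
  assumes "e > 0" "a < b"
  shows "\<exists>s. dist (circ s) (circ t) < e \<and> (\<exists>x\<in>{a..b}. circ x \<notin> Kc s)"
proof (rule ccontr)
  assume no: "\<not> ?thesis"
  define x0 where "x0 = (a + b) / 2"
  have "(b - a) / 2 > 0" using assms by simp
  then obtain \<nu> where nu: "\<nu> > 0" "\<And>x y. dist (circ x) (circ y) < \<nu> \<Longrightarrow> \<exists>j::int. \<bar>x - y - of_int j\<bar> < (b - a) / 2"
    using circ_close_imp_close by blast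
  define B where "B = ball (circ t) e \<times> ball (circ x0) \<nu>"
  have BK: "p \<in> K" if p: "p \<in> torus" "p \<in> B" for p
  proof -
    obtain s x where sx: "p = (circ s, circ x)" using p(1) circ_surj by (metis SigmaE)
    then have d: "dist (circ s) (circ t) < e" "dist (circ x) (circ x0) < \<nu>" using p(2) by (auto simp: B_def dist_commute)
    obtain j :: int where j: "\<bar>x - x0 - of_int j\<bar> < (b - a) / 2" using nu(2)[OF d(2)] by blast
    have "x - of_int j \<in> {a..b}" using j by (auto simp: x0_def abs_if field_simps split: if_splits)
    then have "circ (x - of_int j) \<in> Kc s" using no d(1) by blast
    then show ?thesis by (simp add: sx Kc_def)
  qed
  have t0: "circ x0 \<in> Kc t" using BK[of "(circ t, circ x0)"] assms(1) nu(1) by (simp add: B_def Kc_def)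
  have "openin (top_of_set torus) K"
  proof (subst openin_subopen, intro ballI)
    fix p assume p: "p \<in> K"
    then have pT: "p \<in> torus" using K_props(2) by blast
    obtain s z where sz: "p = (circ s, z)" "z \<in> circle" using pT circ_surj by (metis SigmaE)
    have zK: "z \<in> Kc s" using p sz by (simp add: Kc_def)
    have "min e \<nu> > 0" using assms nu by simp
    then obtain n where n: "dist (circ (s + real n * \<omega>)) (circ t) < min e \<nu>" "dist (fb n s z) (circ x0) < min e \<nu>"
      using visits[OF zK t0] by blast
    have "(f ^^ n) p \<in> B" using n iter_eq[OF sz(2), of n s] by (simp add: B_def sz(1) dist_commute)
    moreover have "openin (top_of_set torus) (torus \<inter> (f ^^ n) -` B)"
      by (intro continuous_openin_preimage_gen iter_cont) (simp add: B_def open_Times)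
    moreover have "torus \<inter> (f ^^ n) -` B \<subseteq> K"
      using BK iter_K iter_torus by blast
    ultimately show "\<exists>T. openin (top_of_set torus) T \<and> p \<in> T \<and> T \<subseteq> K" using pT by blast
  qed
  moreover have "closedin (top_of_set torus) K" using K_props by (simp add: closed_subset)
  ultimately have "K = {} \<or> K = torus" using connected_torus by (simp add: connected_clopen)
  then show False using K_props(1) not_torus by blast
qed

text \<open>
  The first condition is lower semicontinuity of the fibre of \<open>K\<close>, tested on open arcs; the second says
  that the fibre is nowhere dense.
\<close>
definition good :: "real \<Rightarrow> bool" where
  "good t \<longleftrightarrow> 
     (\<forall>a b. a < b \<longrightarrow> (\<exists>x. a < x \<and> x < b \<and> circ x \<in> Kc t) \<longrightarrow>
        (\<exists>d>0. \<forall>s. dist (circ s) (circ t) < d \<longrightarrow> (\<exists>x. a < x \<and> x < b \<and> circ x \<in> Kc s))) \<and>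
     (\<forall>a b. a < b \<longrightarrow> (\<exists>x. a < x \<and> x < b \<and> circ x \<notin> Kc t))"

text \<open>
  Both conditions need to be tested on rational arcs only. For such an arc the base points over which
  \<open>K\<close> meets it form a closed set, and lower semicontinuity can fail only on its frontier; the base
  points over which \<open>K\<close> contains it form a closed set without interior by \<open>no_box\<close>.
\<close>
lemma good_generic:
  "\<exists>G. gdelta_in (top_of_set circle) G \<and> circle \<subseteq> closure G \<and> (\<forall>t. circ t \<in> G \<longrightarrow> good t)"
proof -
  define E where "E p = fst ` (K \<inter> (UNIV \<times> circ ` {fst p..snd p}))" for p :: "real \<times> real"
  define I where "I p = \<Union>{S. openin (top_of_set circle) S \<and> S \<subseteq> E p}" for p
  define T1 where "T1 p = I p \<union> (circle - E p)" for p
  define D where "D p = circle \<inter> (\<Inter>x\<in>{fst p..snd p}. (\<lambda>\<theta>. (\<theta>, circ x)) -` K)" for p :: "real \<times> real"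
  define T2 where "T2 p = circle - D p" for p
  have EK: "circ t \<in> E p \<longleftrightarrow> (\<exists>x\<in>{fst p..snd p}. circ x \<in> Kc t)" for t p
    by (force simp: E_def Kc_def)
  have cl: "circle \<subseteq> closure T" if "\<And>\<theta> e. \<theta> \<in> circle \<Longrightarrow> e > 0 \<Longrightarrow> \<exists>y\<in>T. dist y \<theta> < e" for T :: "complex set"
    using that by (auto simp: closure_approachable)
  have T1: "openin (top_of_set circle) (T1 p) \<and> circle \<subseteq> closure (T1 p)" for p
  proof
    have "compact (circ ` {fst p..snd p})" by (intro compact_continuous_image continuous_intros) auto
    then have "closed (E p)" unfolding E_def
      by (intro compact_imp_closed compact_continuous_image continuous_intros compact_Int_closed K_props closed_Times)
         (auto intro: compact_imp_closed)
    then have "openin (top_of_set circle) (circle \<inter> - E p)" by (intro openin_open_Int) auto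
    moreover have "openin (top_of_set circle) (I p)" unfolding I_def by (intro openin_Union) auto
    ultimately show "openin (top_of_set circle) (T1 p)" unfolding T1_def Diff_eq by (rule openin_Un[rotated])
    show "circle \<subseteq> closure (T1 p)"
    proof (rule cl)
      fix \<theta> and e :: real assume te: "\<theta> \<in> (circle::complex set)" "e > 0"
      show "\<exists>y\<in>T1 p. dist y \<theta> < e"
      proof (cases "circle \<inter> ball \<theta> e \<subseteq> E p")
        case True
        have "openin (top_of_set circle) (circle \<inter> ball \<theta> e)" by (intro openin_open_Int) simp
        then have "\<theta> \<in> I p" using True te unfolding I_def by (auto intro!: exI[of _ "circle \<inter> ball \<theta> e"])
        then have "\<theta> \<in> T1 p" by (simp add: T1_def)
        then show ?thesis using te(2) by (intro bexI[of _ \<theta>]) simp_all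
      next
        case False
        then obtain y where y: "y \<in> circle \<inter> ball \<theta> e" "y \<notin> E p" by blast
        then have "dist y \<theta> < e" "y \<in> T1 p" by (auto simp: T1_def dist_commute)
        then show ?thesis by blast
      qed
    qed
  qed
  have T2: "openin (top_of_set circle) (T2 p) \<and> circle \<subseteq> closure (T2 p)" if p: "fst p < snd p" for p
  proof
    have "closed ((\<lambda>\<theta>. (\<theta>, circ x)) -` K)" for x by (intro closed_vimage K_props continuous_intros)
    then have "closed (D p)" unfolding D_def by (intro closed_Int closed_INT closed_sphere) auto
    then have "openin (top_of_set circle) (circle \<inter> - D p)" by (intro openin_open_Int) auto
    then show "openin (top_of_set circle) (T2 p)" by (simp add: T2_def Diff_eq)
    show "circle \<subseteq> closure (T2 p)"
    proof (rule cl)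
      fix \<theta> and e :: real assume te: "\<theta> \<in> (circle::complex set)" "e > 0"
      obtain t where t: "\<theta> = circ t" using te circ_surj by blast
      obtain s x where "dist (circ s) (circ t) < e" "x \<in> {fst p..snd p}" "circ x \<notin> Kc s" using no_box[OF te(2) p, of t] by blast
      then show "\<exists>y\<in>T2 p. dist y \<theta> < e" by (intro bexI[of _ "circ s"]) (auto simp: t T2_def D_def Kc_def)
    qed
  qed
  define Q :: "(real \<times> real) set" where "Q = {p. p \<in> \<rat> \<times> \<rat> \<and> fst p < snd p}"
  have cQ: "countable Q" unfolding Q_def by (rule countable_subset[of _ "\<rat> \<times> \<rat>"]) (auto intro: countable_rat)
  define \<G> where "\<G> = T1 ` Q \<union> T2 ` Q"
  have "(0, 1) \<in> Q" by (simp add: Q_def)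
  then have "\<G> \<noteq> {}" by (auto simp: \<G>_def)
  have "countable \<G>" using cQ by (auto simp: \<G>_def)
  have \<G>3: "openin (top_of_set circle) T \<and> circle \<subseteq> closure T" if "T \<in> \<G>" for T
    using that T1 T2 unfolding \<G>_def Q_def by blast
  have "good t" if t: "circ t \<in> \<Inter>\<G>" for t
    unfolding good_def
  proof (intro conjI allI impI)
    fix a b :: real assume ab: "a < b" "\<exists>x. a < x \<and> x < b \<and> circ x \<in> Kc t"
    then obtain x where x: "a < x" "x < b" "circ x \<in> Kc t" by blast
    obtain a' b' where ab': "a' \<in> \<rat>" "a < a'" "a' < x" "b' \<in> \<rat>" "x < b'" "b' < b" 
      using Rats_dense_in_real[OF x(1)] Rats_dense_in_real[OF x(2)] by blast
    have "(a', b') \<in> Q" using ab' by (simp add: Q_def)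
    then have "circ t \<in> T1 (a', b')" using t by (auto simp: \<G>_def)
    moreover have "circ t \<in> E (a', b')" using x ab' by (auto simp: EK)
    ultimately obtain S where S: "openin (top_of_set circle) S" "S \<subseteq> E (a', b')" "circ t \<in> S"
      by (auto simp: T1_def I_def)
    then obtain d where d: "d > 0" "ball (circ t) d \<inter> circle \<subseteq> S" by (metis openin_contains_ball)
    have "\<exists>x. a < x \<and> x < b \<and> circ x \<in> Kc s" if "dist (circ s) (circ t) < d" for s
    proof -
      have "circ s \<in> E (a', b')" using d S(2) that by (auto simp: dist_commute)
      then obtain y where "y \<in> {a'..b'}" "circ y \<in> Kc s" using EK[of s "(a', b')"] by auto
      then show ?thesis using ab' by (intro exI[of _ y]) auto
    qed
    then show "\<exists>d>0. \<forall>s. dist (circ s) (circ t) < d \<longrightarrow> (\<exists>x. a < x \<and> x < b \<and> circ x \<in> Kc s)" using d(1) by blast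
  next
    fix a b :: real assume ab: "a < b"
    obtain a' b' where ab': "a' \<in> \<rat>" "a < a'" "a' < b'" "b' \<in> \<rat>" "b' < b" 
      using Rats_dense_in_real[OF ab] Rats_dense_in_real by metis
    then have "(a', b') \<in> Q" by (simp add: Q_def)
    then have "circ t \<in> T2 (a', b')" using t by (auto simp: \<G>_def)
    then obtain y where "y \<in> {a'..b'}" "circ y \<notin> Kc t" by (auto simp: T2_def D_def Kc_def)
    then show "\<exists>x. a < x \<and> x < b \<and> circ x \<notin> Kc t" using ab' by (intro exI[of _ y]) auto
  qed
  then show ?thesis using baire_circle[OF \<open>countable \<G>\<close> \<open>\<G> \<noteq> {}\<close> \<G>3] by blast
qed

lemma ex_good: "\<exists>t. good t"
proof -
  obtain G where G: "circle \<subseteq> closure G" "G \<subseteq> circle" "\<forall>t. circ t \<in> G \<longrightarrow> good t"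
    using good_generic gdelta_in_subset by (metis topspace_euclidean_subtopology)
  have "G \<noteq> {}" using G(1) circ_in_circle[of 0] by auto
  then obtain \<theta> where "\<theta> \<in> G" by blast
  then show ?thesis using G circ_surj by blast
qed

text \<open>
  If the repeller were off \<open>K\<close>, the collapse would shrink a whole fibre of \<open>K\<close>. The attractor is a limit
  of images of any point of \<open>K\<close> other than the repeller.
\<close>
lemma collapse_in_K:
  assumes "\<not> bounded_cocycle" "spread \<delta>"
  shows "\<exists>r\<in>Kc t0. \<exists>a\<in>Kc t0. \<forall>\<epsilon> \<kappa>. \<epsilon> > 0 \<longrightarrow> \<kappa> > 0 \<longrightarrow> (\<exists>n. dist (circ (t0 + real n * \<omega>)) (circ t0) < \<epsilon> \<and>
       \<not> co_lipschitz \<kappa> (fb n t0) \<and> (\<forall>z\<in>circle. dist z r * dist (fb n t0 z) a \<le> \<epsilon>))"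
proof -
  obtain r a where ra: "\<forall>\<epsilon> \<kappa>. \<epsilon> > 0 \<longrightarrow> \<kappa> > 0 \<longrightarrow> (\<exists>n. dist (circ (t0 + real n * \<omega>)) (circ t0) < \<epsilon> \<and>
       \<not> co_lipschitz \<kappa> (fb n t0) \<and> (\<forall>z\<in>circle. dist z r * dist (fb n t0 z) a \<le> \<epsilon>))"
    using unbounded_collapse[OF assms(1)] by blast
  have d0: "\<delta> > 0" using assms(2) by (simp add: spread_def)
  have "r \<in> Kc t0"
  proof (rule ccontr)
    assume "r \<notin> Kc t0"
    then obtain \<eta> where eta: "\<eta> > 0" "\<forall>z\<in>Kc t0. dist r z \<ge> \<eta>"
      using separate_point_closed[OF compact_imp_closed[OF compact_Kc]] by blast
    define \<epsilon> where "\<epsilon> = \<eta> * \<delta> / 4"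
    have "\<epsilon> > 0" using eta d0 by (simp add: \<epsilon>_def)
    then obtain n where n: "\<forall>z\<in>circle. dist z r * dist (fb n t0 z) a \<le> \<epsilon>" using ra[rule_format, of \<epsilon> 1] by auto
    obtain x y where xy: "x \<in> Kc (t0 + n * \<omega>)" "y \<in> Kc (t0 + n * \<omega>)" "dist x y \<ge> \<delta>" using assms(2) unfolding spread_def by blast
    have "dist w a \<le> \<delta> / 4" if "w \<in> Kc (t0 + n * \<omega>)" for w
    proof -
      obtain z where z: "z \<in> Kc t0" "fb n t0 z = w" using fb_Kc_surj \<open>w \<in> Kc (t0 + n * \<omega>)\<close> by blast
      have "dist w a \<le> \<epsilon> / \<eta>"
      proof (rule dist_large_prod_small[OF _ _ eta(1)])
        show "dist z r * dist w a \<le> \<epsilon>" using n z Kc_circle by blast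
        show "\<eta> \<le> dist z r" using eta(2) z(1) by (metis dist_commute)
      qed
      then show ?thesis using eta by (simp add: \<epsilon>_def)
    qed
    from this[OF xy(1)] this[OF xy(2)] show False using xy(3) d0 by metric
  qed
  moreover have "a \<in> Kc t0"
  proof -
    obtain x y where xy: "x \<in> Kc t0" "y \<in> Kc t0" "dist x y \<ge> \<delta>" using assms(2) unfolding spread_def by blast
    then obtain x where x: "x \<in> Kc t0" "x \<noteq> r" using d0 by (metis dist_self not_less)
    have close: "\<exists>s w. w \<in> Kc s \<and> dist (circ s) (circ t0) < e \<and> dist w a < e" if e: "e > 0" for e
    proof -
      define \<epsilon> where "\<epsilon> = min e (e * dist x r / 2)"
      have eps: "\<epsilon> > 0" "\<epsilon> \<le> e" "\<epsilon> \<le> e * dist x r / 2" using e x by (auto simp: \<epsilon>_def)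
      obtain n where n: "dist (circ (t0 + real n * \<omega>)) (circ t0) < \<epsilon>" "\<forall>z\<in>circle. dist z r * dist (fb n t0 z) a \<le> \<epsilon>"
        using ra[rule_format, of \<epsilon> 1] eps by auto
      have "dist (fb n t0 x) a \<le> \<epsilon> / dist x r"
        using dist_large_prod_small[of x r "fb n t0 x" a \<epsilon> "dist x r"] n(2) x Kc_circle by auto
      also have "\<dots> \<le> e / 2" using eps(3) x by (simp add: field_simps)
      finally have "dist (fb n t0 x) a < e" using e by linarith
      moreover have "fb n t0 x \<in> Kc (t0 + real n * \<omega>)" using fb_Kc x Kc_circle by blast
      ultimately show ?thesis using n(1) eps by (intro exI[of _ "t0 + real n * \<omega>"] exI[of _ "fb n t0 x"]) auto
    qed
    have "a \<in> closure circle"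
      unfolding closure_approachable using close Kc_circle by meson
    then have "a \<in> circle" by (simp add: closure_closed)
    then show ?thesis by (rule Kc_limit) (rule close)
  qed
  ultimately show ?thesis using ra by blast
qed

end

section \<open>Lifts to the universal covering of the fibres\<close>

text \<open>Two continuous lifts of the same map differ by a constant, so the explicit lift decides the degree.\<close>
lemma circle_mobius_lift_monotone:
  assumes g: "circle_mobius g" and inj: "inj_on g circle"
    and cont: "continuous_on UNIV \<phi>" and lift: "\<And>x. circ (\<phi> x) = g (circ x)"
  shows "\<phi> (x + 1) = \<phi> x + 1" "strict_mono \<phi>"
proof -
  obtain h where h: "continuous_on UNIV h" "\<And>x. h (x + 1) = h x + 1" "\<And>x. circ (h x) = g (circ x)"
    using circle_mobius_lift[OF g] by blast
  have int: "\<phi> x - h x \<in> \<int>" for x using h(3) lift by (metis circ_eq_iff)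
  have "(\<lambda>x. \<phi> x - h x) constant_on UNIV"
  proof (rule continuous_discrete_range_constant)
    show "continuous_on UNIV (\<lambda>x. \<phi> x - h x)" by (intro continuous_intros cont h)
    fix x
    have "1 \<le> norm ((\<phi> y - h y) - (\<phi> x - h x))" if "\<phi> y - h y \<noteq> \<phi> x - h x" for y
    proof -
      obtain i k :: int where "\<phi> y - h y = of_int i" "\<phi> x - h x = of_int k" using int by (meson Ints_cases)
      moreover from this that have "i \<noteq> k" by simp
      then have "1 \<le> \<bar>i - k\<bar>" by linarith
      then have "1 \<le> \<bar>real_of_int i - real_of_int k\<bar>" by linarith
      ultimately show ?thesis by simp
    qed
    then show "\<exists>e>0. \<forall>y. y \<in> UNIV \<and> \<phi> y - h y \<noteq> \<phi> x - h x \<longrightarrow> e \<le> norm (\<phi> y - h y - (\<phi> x - h x))"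
      by (intro exI[of _ 1]) auto
  qed auto
  then obtain c where "\<And>x. \<phi> x - h x = c" unfolding constant_on_def by blast
  then have c: "\<phi> x = h x + c" for x by (metis diff_add_cancel add.commute)
  show per: "\<phi> (x + 1) = \<phi> x + 1" for x using c h(2) by simp
  have perN: "\<phi> (x + real n) = \<phi> x + real n" for x n
  proof (induction n)
    case (Suc n) then show ?case using per[of "x + real n"] by (simp add: algebra_simps)
  qed simp
  have inj\<phi>: "inj \<phi>"
  proof (rule injI)
    fix x y assume e: "\<phi> x = \<phi> y"
    then have "g (circ x) = g (circ y)" using lift by metis
    then have "circ x = circ y" using inj by (meson circ_in_circle inj_onD)
    then obtain i :: int where i: "x - y = of_int i" by (auto simp: circ_eq_iff elim: Ints_cases)
    consider "i \<ge> 0" | "i \<le> 0" by linarith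
    then show "x = y"
    proof cases
      case 1
      then have "x = y + real (nat i)" using i by simp
      then show ?thesis using perN[of y "nat i"] e by simp
    next
      case 2
      then have "y = x + real (nat (-i))" using i by simp
      then show ?thesis using perN[of x "nat (-i)"] e by simp
    qed
  qed
  show "strict_mono \<phi>"
  proof (rule strict_monoI)
    fix x y :: real assume xy: "x < y"
    obtain n where n: "y - x < real n" using reals_Archimedean2 by blast
    have "(\<phi> x < \<phi> y \<and> \<phi> y < \<phi> (x + real n)) \<or> (\<phi> (x + real n) < \<phi> y \<and> \<phi> y < \<phi> x)"
      by (rule continuous_inj_imp_mono) (use xy n cont inj\<phi> in \<open>auto intro: continuous_on_subset inj_on_subset\<close>)
    moreover have "\<phi> x \<le> \<phi> (x + real n)" using perN by simp
    ultimately show "\<phi> x < \<phi> y" by linarith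
  qed
qed

text \<open>The isotopy from the identity lifts to the universal covering of the fibres.\<close>
lemma lift_exists:
  assumes "homotopic_with_canon P torus torus id f"
    and ftorus: "\<And>\<theta> z. \<theta> \<in> circle \<Longrightarrow> z \<in> circle \<Longrightarrow> f (\<theta>, z) \<in> torus"
    and base: "\<And>\<theta> z. \<theta> \<in> circle \<Longrightarrow> z \<in> circle \<Longrightarrow> fst (f (\<theta>, z)) = \<theta> * circ \<omega>"
  shows "\<exists>F. is_lift f F"
proof -
  let ?U = "circle \<times> (UNIV :: real set)"
  define j where "j = (\<lambda>p. (fst p, circ (snd p)) :: complex \<times> complex)"
  have "homotopic_with_canon (\<lambda>_. True) torus torus id f"
    using assms(1) by (rule homotopic_with_mono) simp
  then have "homotopic_with_canon (\<lambda>_. True) ?U torus (id \<circ> j) (f \<circ> j)"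
    by (rule homotopic_with_compose_continuous_right) (auto simp: j_def intro!: continuous_intros)
  moreover have "snd \<in> torus \<rightarrow> - {0::complex}" by auto
  ultimately have hom: "homotopic_with_canon (\<lambda>_. True) ?U (- {0}) (snd \<circ> (id \<circ> j)) (snd \<circ> (f \<circ> j))"
    by (intro homotopic_with_compose_continuous_left continuous_on_snd continuous_on_id)
  define g where "g = (\<lambda>p::complex \<times> real. \<i> * of_real (2 * pi * snd p))"
  have g: "continuous_on ?U g" unfolding g_def by (intro continuous_intros)
  have gim: "g \<in> ?U \<rightarrow> UNIV" by simp
  have eg: "exp (g p) = (snd \<circ> (id \<circ> j)) p" for p by (simp add: g_def j_def circ_def cis_conv_exp)
  show ?thesis
  proof (rule covering_space_lift_homotopic_function[OF covering_space_exp_punctured_plane g gim eg hom])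
    fix k assume k: "continuous_on ?U k" "\<And>p. p \<in> ?U \<Longrightarrow> exp (k p) = (snd \<circ> (f \<circ> j)) p"
    define F where "F = (\<lambda>p. (fst p * circ \<omega>, Im (k p) / (2 * pi)))"
    have "f (\<theta>, circ x) = (fst (F (\<theta>, x)), circ (snd (F (\<theta>, x))))" if th: "\<theta> \<in> circle" for \<theta> x
    proof -
      have e: "exp (k (\<theta>, x)) = snd (f (\<theta>, circ x))" using k(2)[of "(\<theta>, x)"] th by (simp add: j_def)
      have "f (\<theta>, circ x) \<in> torus" using ftorus[OF th circ_in_circle] .
      then have "cmod (exp (k (\<theta>, x))) = 1" unfolding e by (auto simp: mem_Times_iff)
      then have "Re (k (\<theta>, x)) = 0" by simp
      then have "exp (k (\<theta>, x)) = cis (Im (k (\<theta>, x)))" by (simp add: exp_eq_polar)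
      then show ?thesis using e base[OF th circ_in_circle] by (simp add: F_def circ_def prod_eq_iff)
    qed
    moreover have "continuous_on ?U F" unfolding F_def by (intro continuous_intros k) auto
    ultimately show ?thesis unfolding is_lift_def by blast
  qed
qed

locale lifted_cocycle = mobius_cocycle +
  fixes F :: "complex \<times> real \<Rightarrow> complex \<times> real"
  assumes lift: "is_lift f F"
begin

definition \<Phi> :: "nat \<Rightarrow> real \<Rightarrow> real \<Rightarrow> real" where
  "\<Phi> n t x = snd ((F ^^ n) (circ t, x))"

lemma F_step: "\<theta> \<in> circle \<Longrightarrow> F (\<theta>, x) = (\<theta> * circ \<omega>, snd (F (\<theta>, x)))"
  "\<theta> \<in> circle \<Longrightarrow> circ (snd (F (\<theta>, x))) = snd (f (\<theta>, circ x))"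
proof -
  assume th: "\<theta> \<in> circle"
  have "f (\<theta>, circ x) = (fst (F (\<theta>, x)), circ (snd (F (\<theta>, x))))"
    using lift th unfolding is_lift_def by blast
  moreover have "fst (f (\<theta>, circ x)) = \<theta> * circ \<omega>" using base[OF th circ_in_circle] .
  ultimately show "F (\<theta>, x) = (\<theta> * circ \<omega>, snd (F (\<theta>, x)))" "circ (snd (F (\<theta>, x))) = snd (f (\<theta>, circ x))"
    by (auto simp: prod_eq_iff)
qed

lemma F_iter: "(F ^^ n) (circ t, x) = (circ (t + n * \<omega>), \<Phi> n t x)"
proof -
  have "fst ((F ^^ n) (circ t, x)) = circ (t + n * \<omega>)"
  proof (induction n)
    case (Suc n)
    obtain y where y: "(F ^^ n) (circ t, x) = (circ (t + n * \<omega>), y)" using Suc by (metis prod.collapse)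
    have "fst ((F ^^ Suc n) (circ t, x)) = circ (t + n * \<omega>) * circ \<omega>"
      using F_step(1)[of "circ (t + n * \<omega>)" y] by (simp add: y) (metis fst_conv)
    then show ?case by (simp add: circ_add[symmetric] algebra_simps)
  qed simp
  then show ?thesis by (simp add: \<Phi>_def prod_eq_iff)
qed

lemma \<Phi>_0 [simp]: "\<Phi> 0 t x = x" by (simp add: \<Phi>_def)

lemma \<Phi>_cong: "circ s = circ t \<Longrightarrow> \<Phi> n s = \<Phi> n t" by (auto simp: \<Phi>_def)

lemma \<Phi>_add: "\<Phi> (n + m) t x = \<Phi> n (t + m * \<omega>) (\<Phi> m t x)"
  unfolding \<Phi>_def[of "n + m"] by (simp add: funpow_add F_iter)

lemma circ_\<Phi>: "circ (\<Phi> n t x) = fb n t (circ x)"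
proof (induction n)
  case (Suc n)
  have "\<Phi> (Suc n) t x = snd (F (circ (t + n * \<omega>), \<Phi> n t x))"
    unfolding \<Phi>_def[of "Suc n"] by (simp add: F_iter)
  then have "circ (\<Phi> (Suc n) t x) = snd (f (circ (t + n * \<omega>), fb n t (circ x)))"
    using F_step(2)[of "circ (t + n * \<omega>)" "\<Phi> n t x"] Suc by simp
  also have "\<dots> = snd (f ((f ^^ n) (circ t, circ x)))" by (simp only: iter_eq[OF circ_in_circle])
  also have "\<dots> = fb (Suc n) t (circ x)" by (simp add: fb_def)
  finally show ?case .
qed simp

lemma \<Phi>_continuous: "continuous_on UNIV (\<lambda>p. \<Phi> n (fst p) (snd p))"
proof -
  have "continuous_on (circle \<times> UNIV) (F ^^ n)"
  proof (induction n)
    case (Suc n)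
    have im: "(F ^^ n) p \<in> circle \<times> UNIV" if p: "p \<in> circle \<times> UNIV" for p
    proof -
      obtain t x where "p = (circ t, x)" using p circ_surj by (metis SigmaE)
      then show ?thesis using F_iter by simp
    qed
    have "continuous_on (circle \<times> UNIV) F" using lift by (simp add: is_lift_def)
    from continuous_on_compose2[OF this Suc] im have "continuous_on (circle \<times> UNIV) (\<lambda>p. F ((F ^^ n) p))"
      by blast
    then show ?case by (simp add: comp_def)
  qed (auto intro: continuous_on_id)
  moreover have "continuous_on UNIV (\<lambda>p. (circ (fst p), snd p :: real))" by (intro continuous_intros)
  ultimately have "continuous_on UNIV (\<lambda>p. (F ^^ n) (circ (fst p), snd p))"
    by (rule continuous_on_compose2) auto
  then show ?thesis unfolding \<Phi>_def by (rule continuous_on_snd)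
qed

lemma \<Phi>_continuous_compose [continuous_intros]:
  "continuous_on S u \<Longrightarrow> continuous_on S v \<Longrightarrow> continuous_on S (\<lambda>x. \<Phi> n (u x) (v x))"
  using continuous_on_compose2[OF \<Phi>_continuous continuous_on_Pair, of S u v n] by simp

lemma shows \<Phi>_add_one: "\<Phi> n t (x + 1) = \<Phi> n t x + 1" and strict_mono_\<Phi>: "strict_mono (\<Phi> n t)"
proof -
  have i: "inj_on (fb n t) circle" using fb_inj by (meson inj_onI)
  have c: "continuous_on UNIV (\<Phi> n t)" by (intro continuous_intros)
  show "\<Phi> n t (x + 1) = \<Phi> n t x + 1" "strict_mono (\<Phi> n t)"
    using circle_mobius_lift_monotone[OF fb_mobius i c circ_\<Phi>] by blast+
qed

lemma \<Phi>_less_iff [simp]: "\<Phi> n t x < \<Phi> n t y \<longleftrightarrow> x < y"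
  using strict_mono_\<Phi> strict_mono_less by blast

lemma \<Phi>_le_iff [simp]: "\<Phi> n t x \<le> \<Phi> n t y \<longleftrightarrow> x \<le> y"
  using strict_mono_\<Phi> strict_mono_less_eq by blast

lemma \<Phi>_int: "\<Phi> n t (x + of_int j) = \<Phi> n t x + of_int j"
proof -
  have N: "\<Phi> n t (x + real k) = \<Phi> n t x + real k" for x k
  proof (induction k)
    case (Suc k) then show ?case using \<Phi>_add_one[of n t "x + real k"] by (simp add: algebra_simps)
  qed simp
  show ?thesis
  proof (cases "j \<ge> 0")
    case True then show ?thesis using N[of x "nat j"] by simp
  next
    case False then show ?thesis using N[of "x + of_int j" "nat (-j)"] by simp
  qed
qed

lemma \<Phi>_surj: "\<exists>x. \<Phi> n t x = y"
proof -
  obtain z where z: "z \<in> circle" "fb n t z = circ y" using fb_surj[OF circ_in_circle] by metis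
  then obtain x where "z = circ x" using circ_surj by blast
  then have "circ (\<Phi> n t x) = circ y" using z circ_\<Phi> by simp
  then obtain j :: int where "\<Phi> n t x - y = of_int j" by (auto simp: circ_eq_iff elim: Ints_cases)
  then have "\<Phi> n t (x + of_int (-j)) = y" unfolding \<Phi>_int by simp
  then show ?thesis by blast
qed

lemma displacement_bounded: "\<exists>D\<ge>0. \<forall>n t x. \<bar>\<Phi> n t x - x\<bar> \<le> real n * D"
proof -
  let ?S = "{0..1} \<times> {0..1} :: (real \<times> real) set"
  have "compact ((\<lambda>p. \<Phi> 1 (fst p) (snd p) - snd p) ` ?S)"
    by (intro compact_continuous_image continuous_intros compact_Times compact_Icc)
  then obtain D where D: "\<And>p. p \<in> ?S \<Longrightarrow> \<bar>\<Phi> 1 (fst p) (snd p) - snd p\<bar> \<le> D"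
    using compact_imp_bounded bounded_iff by (metis (no_types, lifting) image_eqI real_norm_def)
  have D1: "\<bar>\<Phi> 1 t x - x\<bar> \<le> D" for t x
  proof -
    have "\<Phi> 1 t x = \<Phi> 1 (frac t) x" by (simp add: \<Phi>_cong[of t "frac t"] frac_def)
    also have "\<dots> - x = \<Phi> 1 (frac t) (frac x) - frac x" 
      using \<Phi>_int[of 1 "frac t" "frac x" "\<lfloor>x\<rfloor>"] by (simp add: frac_def)
    finally have e: "\<Phi> 1 t x - x = \<Phi> 1 (frac t) (frac x) - frac x" .
    have "(frac t, frac x) \<in> ?S" by (simp add: less_imp_le frac_lt_1)
    from D[OF this] e show ?thesis by simp
  qed
  have "\<bar>\<Phi> n t x - x\<bar> \<le> real n * D" for n t x
  proof (induction n)
    case (Suc n)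
    have "\<Phi> (Suc n) t x = \<Phi> 1 (t + n * \<omega>) (\<Phi> n t x)" using \<Phi>_add[of 1 n t x] by simp
    then show ?case using D1[of "t + n * \<omega>" "\<Phi> n t x"] Suc by (simp add: algebra_simps)
  qed simp
  moreover have "D \<ge> 0" using D1[of 0 0] by linarith
  ultimately show ?thesis by blast
qed

lemma displacement_fibre: "\<bar>(\<Phi> n t x - x) - (\<Phi> n t y - y)\<bar> \<le> 1"
proof -
  define j where "j = \<lfloor>x - y\<rfloor>"
  define y' where "y' = y + of_int j"
  have y': "y' \<le> x" "x < y' + 1" unfolding y'_def j_def by linarith+
  have "\<Phi> n t y' - y' = \<Phi> n t y - y" by (simp add: y'_def \<Phi>_int)
  moreover have "\<Phi> n t y' \<le> \<Phi> n t x" "\<Phi> n t x \<le> \<Phi> n t y' + 1"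
    using y' \<Phi>_le_iff[of n t x "y' + 1"] by (simp_all add: \<Phi>_add_one)
  ultimately show ?thesis using y' by linarith
qed

text \<open>
  The displacements of a fixed point form a quasi-additive sequence \<open>A\<close>, for which
  \<open>(A m - C) / m \<le> (A n + C) / n\<close> for all \<open>m\<close> and \<open>n\<close>. Hence the infimum of the right-hand sides
  differs from \<open>A n / n\<close> by at most \<open>C / n\<close>.
\<close>
lemma rotation_number_bound:
  assumes osc: "\<And>n t x t' x'. \<bar>(\<Phi> n t x - x) - (\<Phi> n t' x' - x')\<bar> \<le> C"
  shows "bdd_above {\<bar>snd ((F ^^ n) (\<theta>, x)) - x - real n * fibred_rotation_number F\<bar>
                   | n \<theta> x. \<theta> \<in> circle}"
proof -
  define A where "A n = \<Phi> n 0 0" for n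
  have C0: "C \<ge> 0" using osc[of 0 0 0 0 0] by simp
  have quasi: "\<bar>A (n + m) - A n - A m\<bar> \<le> C" for n m
    using osc[of n "m * \<omega>" "\<Phi> m 0 0" 0 0] by (simp add: A_def \<Phi>_add)
  have mult: "\<bar>A (k * n) - real k * A n\<bar> \<le> real k * C" for k n
  proof (induction k)
    case 0 then show ?case by (simp add: A_def)
  next
    case (Suc k) then show ?case using quasi[of n "k * n"] by (simp add: algebra_simps abs_le_iff)
  qed
  have sep: "(A m - C) / real m \<le> (A n + C) / real n" if "m > 0" "n > 0" for m n
  proof -
    have "real n * (A m - C) \<le> real m * (A n + C)"
      using mult[of n m] mult[of m n] by (simp add: algebra_simps abs_le_iff mult.commute[of n m])
    then show ?thesis using that by (simp add: field_simps)
  qed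
  define \<rho> where "\<rho> = Inf ((\<lambda>n. (A n + C) / real n) ` {0<..})"
  have A: "\<bar>A n - real n * \<rho>\<bar> \<le> C" if "n > 0" for n
  proof -
    have "bdd_below ((\<lambda>n. (A n + C) / real n) ` {0<..})" using sep[of 1] by (intro bdd_belowI[of _ "A 1 - C"]) auto
    then have "\<rho> \<le> (A n + C) / real n" unfolding \<rho>_def using that by (intro cInf_lower) auto
    moreover have "(A n - C) / real n \<le> \<rho>" unfolding \<rho>_def using that sep by (intro cInf_greatest) auto
    ultimately show ?thesis using that by (simp add: field_simps abs_le_iff)
  qed
  have all: "\<bar>\<Phi> n t x - x - real n * \<rho>\<bar> \<le> 2 * C" for n t x
  proof (cases "n = 0")
    case False
    then show ?thesis using A[of n] osc[of n t x 0 0] by (simp add: A_def abs_le_iff)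
  qed (use C0 in simp)
  have lim: "(\<lambda>n. (snd ((F ^^ n) (\<theta>, x)) - x) / real n) \<longlonglongrightarrow> \<rho>" if th: "\<theta> \<in> circle" for \<theta> x
  proof -
    obtain t where t: "\<theta> = circ t" using th circ_surj by blast
    have "(\<lambda>n. 2 * C / real n) \<longlonglongrightarrow> 0" by (rule lim_const_over_n)
    moreover have "\<forall>\<^sub>F n in sequentially. norm ((snd ((F ^^ n) (\<theta>, x)) - x) / real n - \<rho>) \<le> 2 * C / real n"
    proof (rule eventually_sequentiallyI[of 1])
      fix n :: nat assume "1 \<le> n"
      then have "(snd ((F ^^ n) (\<theta>, x)) - x) / real n - \<rho> = (\<Phi> n t x - x - real n * \<rho>) / real n"
        by (simp add: t \<Phi>_def field_simps)
      then show "norm ((snd ((F ^^ n) (\<theta>, x)) - x) / real n - \<rho>) \<le> 2 * C / real n"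
        using all[of n t x] by (simp add: divide_right_mono)
    qed
    ultimately have "(\<lambda>n. (snd ((F ^^ n) (\<theta>, x)) - x) / real n - \<rho>) \<longlonglongrightarrow> 0"
      by (rule Lim_null_comparison[rotated])
    then show ?thesis by (simp add: LIM_zero_iff)
  qed
  have "fibred_rotation_number F = \<rho>"
    unfolding fibred_rotation_number_def
  proof (rule the_equality)
    show "\<forall>\<theta>\<in>circle. \<forall>x. (\<lambda>n. (snd ((F ^^ n) (\<theta>, x)) - x) / real n) \<longlonglongrightarrow> \<rho>" using lim by blast
    fix \<rho>' assume "\<forall>\<theta>\<in>circle. \<forall>x. (\<lambda>n. (snd ((F ^^ n) (\<theta>, x)) - x) / real n) \<longlonglongrightarrow> \<rho>'"
    then have "(\<lambda>n. (snd ((F ^^ n) (circ 0, 0)) - 0) / real n) \<longlonglongrightarrow> \<rho>'" using circ_in_circle by blast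
    then show "\<rho>' = \<rho>" using lim[OF circ_in_circle[of 0], of 0] LIMSEQ_unique by blast
  qed
  then show ?thesis
  proof (intro bdd_aboveI[of _ "2 * C"])
    fix v assume fr: "fibred_rotation_number F = \<rho>" and "v \<in> {\<bar>snd ((F ^^ n) (\<theta>, x)) - x - real n * fibred_rotation_number F\<bar> | n \<theta> x. \<theta> \<in> circle}"
    then obtain n \<theta> x where v: "\<theta> \<in> circle" "v = \<bar>snd ((F ^^ n) (\<theta>, x)) - x - real n * \<rho>\<bar>" by auto
    obtain t where t: "\<theta> = circ t" using v circ_surj by blast
    show "v \<le> 2 * C" using all[of n t x] by (simp add: v(2) t \<Phi>_def)
  qed
qed

end

locale lifted_minimal = minimal_cocycle \<omega> f K + lifted_cocycle \<omega> f F
  for \<omega> :: real and f :: "complex \<times> complex \<Rightarrow> complex \<times> complex" 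
    and K :: "(complex \<times> complex) set" and F :: "complex \<times> real \<Rightarrow> complex \<times> real"
begin

lemma \<Phi>_Kc: "circ (\<Phi> n t x) \<in> Kc (t + n * \<omega>) \<longleftrightarrow> circ x \<in> Kc t"
  by (simp add: circ_\<Phi> fb_Kc)

section \<open>Curves blocked by the minimal set\<close>

text \<open>
  Over an arc around \<open>t0\<close> the set \<open>K\<close> meets the window \<open>[a, b]\<close> in every fibre. If the height of
  the image of the curve at height \<open>a\<close> changed by more than three over such an arc, the image would pass
  from one side of some translate of the window to the other. By connectedness there would be a base point over which some points of
  \<open>K\<close> in this translate are below the curve and others above it.
\<close>
lemma barrier:
  assumes e: "e > 0" and ab: "b \<le> a + 1"
    and meets: "\<And>t. dist (circ t) (circ t0) < e \<Longrightarrow> \<exists>x. a \<le> x \<and> x \<le> b \<and> circ x \<in> Kc t"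
    and gap: "\<And>t. dist (circ t) (circ t0) < e \<Longrightarrow> circ a \<notin> Kc t"
    and no_cross: "\<And>t n j x x'. \<lbrakk>dist (circ t) (circ t0) < e; dist (circ (t + real n * \<omega>)) (circ t0) < e;
        a + of_int j \<le> x; x < \<Phi> n t a; \<Phi> n t a < x'; x' \<le> b + of_int j;
        circ x \<in> Kc (t + n * \<omega>); circ x' \<in> Kc (t + n * \<omega>)\<rbrakk> \<Longrightarrow> False"
  shows "bdd_above {\<bar>snd ((F ^^ n) (\<theta>, x)) - x - real n * fibred_rotation_number F\<bar>
                   | n \<theta> x. \<theta> \<in> circle}"
proof -
  have step: "\<bar>\<Phi> n u a - \<Phi> n v a\<bar> \<le> 3"
    if uv: "u \<le> v" and near: "\<And>t. u \<le> t \<Longrightarrow> t \<le> v \<Longrightarrow> dist (circ t) (circ t0) < e"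
       "\<And>t. u \<le> t \<Longrightarrow> t \<le> v \<Longrightarrow> dist (circ (t + real n * \<omega>)) (circ t0) < e" for n u v
  proof (rule ccontr)
    assume "\<not> ?thesis"
    then obtain p1 p2 where p: "p1 \<in> {u..v}" "p2 \<in> {u..v}" "\<Phi> n p1 a + 3 < \<Phi> n p2 a"
      using uv by (metis (no_types, opaque_lifting) abs_le_iff add.commute atLeastAtMost_iff diff_le_eq minus_diff_eq not_le order_refl)
    define j where "j = \<lceil>\<Phi> n p1 a - a\<rceil>"
    have j: "\<Phi> n p1 a \<le> a + of_int j" "b + of_int j \<le> \<Phi> n p2 a" using p(3) ab unfolding j_def by linarith+
    define S where "S = ({u..v} \<times> {a + of_int j..b + of_int j}) \<inter> {p. (circ (fst p + n * \<omega>), circ (snd p)) \<in> K}"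
    have "closed ((\<lambda>p. (circ (fst p + n * \<omega>), circ (snd p))) -` K)"
      by (intro closed_vimage K_props continuous_intros)
    then have S: "compact S" unfolding S_def by (intro compact_Int_closed compact_Times compact_Icc) (simp add: vimage_def)
    define E1 where "E1 = fst ` (S \<inter> {p. snd p \<le> \<Phi> n (fst p) a})"
    define E2 where "E2 = fst ` (S \<inter> {p. \<Phi> n (fst p) a \<le> snd p})"
    have "closed E1" "closed E2" unfolding E1_def E2_def
      by (intro compact_imp_closed compact_continuous_image continuous_intros compact_Int_closed S closed_Collect_le)+
    have mem: "\<exists>x. (t, x) \<in> S" if t: "t \<in> {u..v}" for t
    proof -
      have "dist (circ (t + real n * \<omega>)) (circ t0) < e" using near(2) t by simp
      then obtain x where "a \<le> x" "x \<le> b" "circ x \<in> Kc (t + n * \<omega>)" using meets by blast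
      then have "(t, x + of_int j) \<in> S" using t by (auto simp: S_def Kc_def)
      then show ?thesis by blast
    qed
    have "{u..v} \<subseteq> E1 \<union> E2"
    proof
      fix t assume "t \<in> {u..v}"
      then obtain x where "(t, x) \<in> S" using mem by blast
      then show "t \<in> E1 \<union> E2" unfolding E1_def E2_def by (cases "x \<le> \<Phi> n t a") force+
    qed
    moreover have "E1 \<inter> {u..v} \<noteq> {}"
    proof -
      obtain x where x: "(p2, x) \<in> S" using mem p by blast
      then have "x \<le> \<Phi> n p2 a" using j by (auto simp: S_def)
      then have "p2 \<in> E1" unfolding E1_def using x by force
      then show ?thesis using p by blast
    qed
    moreover have "E2 \<inter> {u..v} \<noteq> {}"
    proof -
      obtain x where x: "(p1, x) \<in> S" using mem p by blast
      then have "\<Phi> n p1 a \<le> x" using j by (auto simp: S_def)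
      then have "p1 \<in> E2" unfolding E2_def using x by force
      then show ?thesis using p by blast
    qed
    moreover have "connected {u..v}" by simp
    ultimately have "E1 \<inter> E2 \<inter> {u..v} \<noteq> {}"
      using \<open>closed E1\<close> \<open>closed E2\<close> unfolding connected_closed by blast
    then obtain t where tt: "t \<in> {u..v}" "t \<in> E1" "t \<in> E2" by blast
    have "\<exists>x. (t, x) \<in> S \<and> x \<le> \<Phi> n t a" using tt(2) unfolding E1_def by force
    moreover have "\<exists>x'. (t, x') \<in> S \<and> \<Phi> n t a \<le> x'" using tt(3) unfolding E2_def by force
    ultimately obtain x x' where t: "t \<in> {u..v}" "(t, x) \<in> S" "x \<le> \<Phi> n t a" "(t, x') \<in> S" "\<Phi> n t a \<le> x'"
      using tt(1) by blast
    have nt: "dist (circ t) (circ t0) < e" "dist (circ (t + real n * \<omega>)) (circ t0) < e" using near t(1) by auto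
    have q: "circ (\<Phi> n t a) \<notin> Kc (t + n * \<omega>)" using \<Phi>_Kc gap[OF nt(1)] by blast
    have xx: "a + of_int j \<le> x" "x' \<le> b + of_int j" "circ x \<in> Kc (t + n * \<omega>)" "circ x' \<in> Kc (t + n * \<omega>)"
      using t by (auto simp: S_def Kc_def)
    then have "x < \<Phi> n t a" "\<Phi> n t a < x'" using t q by (metis order_le_less)+
    then show False using no_cross[OF nt xx(1) _ _ xx(2-4)] by blast
  qed
  define \<eta> where "\<eta> = e / 30"
  have eta: "\<eta> > 0" using e by (simp add: \<eta>_def)
  have near: "dist (circ t) (circ t0) < e" if "\<bar>t - t0 - of_int j\<bar> \<le> 2 * \<eta>" for t and j :: int
  proof -
    have "dist (circ t) (circ (t0 + of_int j)) \<le> 2 * pi * \<bar>t - (t0 + of_int j)\<bar>" by (rule dist_circ_le)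
    also have "\<dots> \<le> 10 * (2 * \<eta>)" using that pi_less_4 by (intro mult_mono) (auto simp: algebra_simps)
    also have "\<dots> < e" using e by (simp add: \<eta>_def)
    finally show ?thesis by simp
  qed
  obtain M where M: "\<forall>t s. \<exists>m\<le>M. \<exists>j::int. \<bar>t + real m * \<omega> - s - of_int j\<bar> < \<eta>" using rotation_dense[OF eta] by blast
  obtain D where D: "D \<ge> 0" "\<And>n t x. \<bar>\<Phi> n t x - x\<bar> \<le> real n * D" using displacement_bounded by blast
  have DM: "\<bar>\<Phi> m t x - x\<bar> \<le> real M * D" if "m \<le> M" for m t x
    using D(2)[of m t x] mult_right_mono[of "real m" "real M" D] that D(1) by simp
  have local: "\<bar>\<Phi> n u a - \<Phi> n v a\<bar> \<le> 3 + 2 * (real M * D)" if uv: "\<bar>u - t0\<bar> \<le> \<eta>" "\<bar>v - t0\<bar> \<le> \<eta>" for n u v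
  proof -
    obtain m and j :: int where m: "m \<le> M" "\<bar>t0 + n * \<omega> + real m * \<omega> - t0 - of_int j\<bar> < \<eta>" using M by blast
    have *: "\<bar>\<Phi> (m + n) u a - \<Phi> (m + n) v a\<bar> \<le> 3" if "u \<le> v" "\<bar>u - t0\<bar> \<le> \<eta>" "\<bar>v - t0\<bar> \<le> \<eta>" for u v
    proof (rule step[OF that(1)])
      fix t assume t: "u \<le> t" "t \<le> v"
      then have tt: "\<bar>t - t0\<bar> \<le> \<eta>" using that by linarith
      show "dist (circ t) (circ t0) < e" using near[of t 0] tt eta by simp
      show "dist (circ (t + real (m + n) * \<omega>)) (circ t0) < e"
        using near[of "t + real (m + n) * \<omega>" j] tt m(2) by (simp add: algebra_simps)
    qed
    have "\<bar>\<Phi> (m + n) u a - \<Phi> (m + n) v a\<bar> \<le> 3" using *[of u v] *[of v u] uv by (cases "u \<le> v") auto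
    moreover have "\<bar>\<Phi> (m + n) u a - \<Phi> n u a\<bar> \<le> real M * D" "\<bar>\<Phi> (m + n) v a - \<Phi> n v a\<bar> \<le> real M * D"
      using DM[OF m(1)] by (simp_all add: \<Phi>_add)
    ultimately show ?thesis by linarith
  qed
  have moved: "\<exists>t'. \<bar>t' - t0\<bar> \<le> \<eta> \<and> \<bar>(\<Phi> n t x - x) - (\<Phi> n t' a - a)\<bar> \<le> 2 * (real M * D) + 1" for n t x
  proof -
    obtain m and j :: int where m: "m \<le> M" "\<bar>t0 + real m * \<omega> - t - of_int j\<bar> < \<eta>" using M by blast
    define t' where "t' = t - real m * \<omega> + of_int j"
    have t': "\<bar>t' - t0\<bar> \<le> \<eta>" using m(2) by (simp add: t'_def abs_if split: if_splits)
    have ct: "circ (t' + m * \<omega>) = circ t" by (simp add: t'_def)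
    obtain y where y: "\<Phi> m t' y = x" using \<Phi>_surj by blast
    have "\<Phi> n t x = \<Phi> n (t' + m * \<omega>) (\<Phi> m t' y)" using \<Phi>_cong[OF ct] y by simp
    also have "\<dots> = \<Phi> m (t' + n * \<omega>) (\<Phi> n t' y)" using \<Phi>_add[of n m t' y] \<Phi>_add[of m n t' y] by (simp add: add.commute)
    finally have "\<bar>\<Phi> n t x - \<Phi> n t' y\<bar> \<le> real M * D" using DM[OF m(1)] by simp
    moreover have "\<bar>x - y\<bar> \<le> real M * D" using DM[OF m(1), of t' y] y by simp
    moreover have "\<bar>(\<Phi> n t' y - y) - (\<Phi> n t' a - a)\<bar> \<le> 1" by (rule displacement_fibre)
    ultimately show ?thesis using t' by (intro exI[of _ t']) linarith
  qed
  show ?thesis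
  proof (rule rotation_number_bound)
    fix n t x t' x'
    obtain u where u: "\<bar>u - t0\<bar> \<le> \<eta>" "\<bar>(\<Phi> n t x - x) - (\<Phi> n u a - a)\<bar> \<le> 2 * (real M * D) + 1" using moved by blast
    obtain v where v: "\<bar>v - t0\<bar> \<le> \<eta>" "\<bar>(\<Phi> n t' x' - x') - (\<Phi> n v a - a)\<bar> \<le> 2 * (real M * D) + 1" using moved by blast
    show "\<bar>(\<Phi> n t x - x) - (\<Phi> n t' x' - x')\<bar> \<le> 2 * (2 * (real M * D) + 1) + (3 + 2 * (real M * D))"
    proof -
      have "\<bar>\<Phi> n u a - \<Phi> n v a\<bar> \<le> 3 + 2 * (real M * D)" by (rule local[OF u(1) v(1)])
      then have "\<Phi> n u a - \<Phi> n v a \<le> 3 + 2 * (real M * D)" "\<Phi> n v a - \<Phi> n u a \<le> 3 + 2 * (real M * D)"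
        by (auto simp: abs_le_iff)
      then show ?thesis using abs_le_D1[OF u(2)] abs_le_D2[OF u(2)] abs_le_D1[OF v(2)] abs_le_D2[OF v(2)]
        by (intro abs_leI) (simp_all add: algebra_simps)
    qed
  qed
qed

end

lemma dist_circ_le8: "dist (circ x) (circ y) \<le> 8 * \<bar>x - y\<bar>"
proof -
  have "2 * pi * \<bar>x - y\<bar> \<le> 8 * \<bar>x - y\<bar>" using pi_less_4 by (intro mult_right_mono) auto
  then show ?thesis using dist_circ_le[of x y] by linarith
qed

section \<open>Three gaps bound the cocycle along an arc\<close>
lemma floor_constant:
  fixes g :: "real \<Rightarrow> real"
  assumes "continuous_on (closed_segment u v) g" "\<And>s j. s \<in> closed_segment u v \<Longrightarrow> g s \<noteq> of_int j"
  shows "\<lfloor>g u\<rfloor> = \<lfloor>g v\<rfloor>"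
proof -
  have *: "\<not> \<lfloor>g u\<rfloor> < \<lfloor>g v\<rfloor>" if c: "continuous_on (closed_segment u v) g" 
    and n: "\<And>s j. s \<in> closed_segment u v \<Longrightarrow> g s \<noteq> of_int j" for u v
  proof
    assume l: "\<lfloor>g u\<rfloor> < \<lfloor>g v\<rfloor>"
    have "connected (g ` closed_segment u v)" by (intro connected_continuous_image c connected_segment)
    moreover have "g u \<in> g ` closed_segment u v" "g v \<in> g ` closed_segment u v" by auto
    moreover have "g u \<le> of_int \<lfloor>g v\<rfloor>" "of_int \<lfloor>g v\<rfloor> \<le> g v" using l by linarith+
    ultimately have "of_int \<lfloor>g v\<rfloor> \<in> g ` closed_segment u v" 
      unfolding connected_iff_interval by blast
    then obtain s where "s \<in> closed_segment u v" "g s = of_int \<lfloor>g v\<rfloor>" by (metis imageE)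
    then show False using n by blast
  qed
  have "continuous_on (closed_segment v u) g" "\<And>s j. s \<in> closed_segment v u \<Longrightarrow> g s \<noteq> of_int j"
    using assms by (auto simp: closed_segment_commute)
  then show ?thesis using *[OF assms] *[of v u] by force
qed

lemma circ_close_lift:
  assumes "e > 0"
  shows "\<exists>\<nu>>0. \<forall>z x. z \<in> circle \<longrightarrow> dist z (circ x) < \<nu> \<longrightarrow> (\<exists>y. z = circ y \<and> \<bar>y - x\<bar> < e)"
proof -
  obtain \<nu> where nu: "\<nu> > 0" "\<And>x y. dist (circ x) (circ y) < \<nu> \<Longrightarrow> \<exists>j::int. \<bar>x - y - of_int j\<bar> < e"
    using circ_close_imp_close[OF assms] by blast
  have "\<exists>y. z = circ y \<and> \<bar>y - x\<bar> < e" if z: "z \<in> circle" "dist z (circ x) < \<nu>" for z x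
  proof -
    obtain y0 where y0: "z = circ y0" using circ_surj z(1) by blast
    then obtain j :: int where "\<bar>y0 - x - of_int j\<bar> < e" using nu(2) z(2) by blast
    then show ?thesis using y0 by (intro exI[of _ "y0 - of_int j"]) (simp add: algebra_simps)
  qed
  then show ?thesis using nu(1) by blast
qed

context minimal_cocycle
begin

text \<open>Lower semicontinuity at a good base point is uniform on the compact fibre.\<close>
lemma K_lower_uniform:
  assumes "good t0" "e > 0"
  shows "\<exists>d>0. \<forall>t. dist (circ t) (circ t0) < d \<longrightarrow> (\<forall>w\<in>Kc t0. \<exists>y\<in>Kc t. dist w y < e)"
proof -
  have "\<exists>d>0. \<forall>t. dist (circ t) (circ t0) < d \<longrightarrow> (\<exists>y\<in>Kc t. dist w y < e / 2)" if w: "w \<in> Kc t0" for w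
  proof -
    obtain x where x: "w = circ x" using Kc_circle[OF w] circ_surj by blast
    have "x - e / 32 < x + e / 32" "\<exists>y. x - e / 32 < y \<and> y < x + e / 32 \<and> circ y \<in> Kc t0"
      using assms(2) w x by (auto intro!: exI[of _ x])
    then obtain d where d: "d > 0" "\<And>s. dist (circ s) (circ t0) < d \<Longrightarrow> \<exists>y. x - e / 32 < y \<and> y < x + e / 32 \<and> circ y \<in> Kc s"
      using assms(1) unfolding good_def by blast
    have "\<exists>y\<in>Kc t. dist w y < e / 2" if t: "dist (circ t) (circ t0) < d" for t
    proof -
      obtain y where y: "x - e / 32 < y" "y < x + e / 32" "circ y \<in> Kc t" using d(2)[OF t] by blast
      have "dist w (circ y) \<le> 8 * \<bar>x - y\<bar>" unfolding x by (rule dist_circ_le8)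
      moreover have "\<bar>x - y\<bar> < e / 32" unfolding abs_less_iff using y by auto
      ultimately have "dist w (circ y) < e / 2" using assms(2) by simp
      then show ?thesis using y by blast
    qed
    then show ?thesis using d(1) by blast
  qed
  then obtain d where d: "\<And>w. w \<in> Kc t0 \<Longrightarrow> d w > 0" 
    "\<And>w t. w \<in> Kc t0 \<Longrightarrow> dist (circ t) (circ t0) < d w \<Longrightarrow> \<exists>y\<in>Kc t. dist w y < e / 2" by metis
  obtain W where W: "W \<subseteq> Kc t0" "finite W" "Kc t0 \<subseteq> (\<Union>w\<in>W. ball w (e / 2))"
    by (rule compactE_image[OF compact_Kc[of t0], of "Kc t0" "\<lambda>w. ball w (e / 2)"]) (use assms(2) in auto)
  have ne: "W \<noteq> {}" using W(3) Kc_nonempty[of t0] by blast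
  have "Min (d ` W) > 0" using W ne d(1) by (subst Min_gr_iff) auto
  moreover have "\<exists>y\<in>Kc t. dist w y < e" if t: "dist (circ t) (circ t0) < Min (d ` W)" and w: "w \<in> Kc t0" for t w
  proof -
    obtain w' where w': "w' \<in> W" "dist w' w < e / 2" using W(3) w by auto
    have "Min (d ` W) \<le> d w'" using W(2) w'(1) by (intro Min_le) auto
    then have "dist (circ t) (circ t0) < d w'" using t by linarith
    then obtain y where "y \<in> Kc t" "dist w' y < e / 2" using d(2) W(1) w'(1) by blast
    then show ?thesis using w'(2) by (intro bexI[of _ y]) metric
  qed
  ultimately show ?thesis by blast
qed

lemma gap_uniform:
  assumes "z \<notin> Kc t0"
  shows "\<exists>\<eta>>0. \<exists>d>0. \<forall>t. dist (circ t) (circ t0) < d \<longrightarrow> (\<forall>x\<in>Kc t. dist z x \<ge> \<eta>)"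
proof -
  obtain \<eta> where eta: "\<eta> > 0" "\<forall>x\<in>Kc t0. dist z x \<ge> \<eta>"
    using separate_point_closed[OF compact_imp_closed[OF compact_Kc] assms] by blast
  have "\<eta> / 2 > 0" using eta by simp
  then obtain d where d: "d > 0" "\<forall>s. dist (circ s) (circ t0) < d \<longrightarrow> (\<forall>z\<in>Kc s. \<exists>w\<in>Kc t0. dist z w < \<eta> / 2)"
    using K_upper_semicontinuous by blast
  have "dist z x \<ge> \<eta> / 2" if x: "dist (circ t) (circ t0) < d" "x \<in> Kc t" for t x
  proof -
    obtain w where w: "w \<in> Kc t0" "dist x w < \<eta> / 2" using d(2) x by blast
    then show ?thesis using eta(2)[rule_format, OF w(1)] by metric
  qed
  then show ?thesis using d(1) \<open>\<eta> / 2 > 0\<close> by blast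
qed

end

context lifted_minimal
begin

text \<open>
  The images of \<open>p1\<close>, \<open>p2\<close>, \<open>p3\<close> over the end point \<open>u\<close> lie in three different complementary intervals,
  of length at least \<open>2 * l\<close>, of the fixed fibre \<open>Kc t0\<close>. As long as they stay in these intervals, the
  map cannot collapse: it would bring all three images together, although the interval of the middle
  one is long. While the map is bounded in this way, the images keep a definite distance from \<open>K\<close>, hence
  from the nearby set \<open>Kc t0\<close>, and so they cannot leave their intervals.
\<close>
lemma bounded_along_arc:
  assumes good: "good t0" and spread: "spread \<delta>" and k1: "\<kappa>1 > 0"
    and p: "p1 < p2" "p2 < p3" "p3 < p1 + 1"
    and eta: "\<eta> > 0" and d1: "d1 > 0" 
    and gaps: "\<And>t x p. dist (circ t) (circ t0) < d1 \<Longrightarrow> x \<in> Kc t \<Longrightarrow> p \<in> {p1, p2, p3} \<Longrightarrow> dist (circ p) x \<ge> \<eta>"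
    and pts: "\<exists>x. p1 < x \<and> x < p2 \<and> circ x \<in> Kc t0" "\<exists>x. p2 < x \<and> x < p3 \<and> circ x \<in> Kc t0" 
      "\<exists>x. p3 < x \<and> x < p1 + 1 \<and> circ x \<in> Kc t0"
  shows "\<exists>\<kappa>>0. \<exists>d>0. \<forall>n u v. (\<forall>s\<in>closed_segment u v. dist (circ s) (circ t0) < d \<and> dist (circ (s + real n * \<omega>)) (circ t0) < d)
       \<longrightarrow> co_lipschitz \<kappa>1 (fb n u) \<longrightarrow> co_lipschitz \<kappa> (fb n v)"
proof -
  have \<delta>: "\<delta> > 0" using spread by (simp add: spread_def)
  define P where "P = {p1, p2, p3}"
  define l where "l = \<kappa>1 * \<eta> / 16"
  have l: "l > 0" using k1 eta by (simp add: l_def)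
  obtain \<nu> where nu: "\<nu> > 0" "\<And>x y. dist (circ x) (circ y) < \<nu> \<Longrightarrow> \<exists>j::int. \<bar>x - y - of_int j\<bar> < l"
    using circ_close_imp_close[OF l] by blast
  obtain \<kappa> where k: "\<kappa> > 0"
    "\<And>g X x y p p'. \<lbrakk>circle_mobius g; \<not> co_lipschitz \<kappa> g; X \<subseteq> circle; x \<in> X; y \<in> X; dist (g x) (g y) \<ge> \<delta>;
        p \<in> circle; p' \<in> circle; \<And>x. x \<in> X \<Longrightarrow> dist p x \<ge> \<eta>; \<And>x. x \<in> X \<Longrightarrow> dist p' x \<ge> \<eta>\<rbrakk>
       \<Longrightarrow> dist (g p) (g p') < \<nu>"
    using collapse_off_set[OF eta \<delta> nu(1)] by blast
  define l2 where "l2 = \<kappa> * \<eta> / 16"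
  have l2: "l2 > 0" using k eta by (simp add: l2_def)
  have "min (\<kappa>1 * \<eta> / 2) (\<kappa> * \<eta> / 2) > 0" using k1 k(1) eta by simp
  then obtain d2 where d2: "d2 > 0" 
    "\<forall>t. dist (circ t) (circ t0) < d2 \<longrightarrow> (\<forall>w\<in>Kc t0. \<exists>y\<in>Kc t. dist w y < min (\<kappa>1 * \<eta> / 2) (\<kappa> * \<eta> / 2))"
    using K_lower_uniform[OF good] by blast
  obtain \<nu>3 where nu3: "\<nu>3 > 0" "\<forall>z x. z \<in> circle \<longrightarrow> dist z (circ x) < \<nu>3 \<longrightarrow> (\<exists>y. z = circ y \<and> \<bar>y - x\<bar> < l)"
    using circ_close_lift[OF l] by blast
  obtain d3 where d3: "d3 > 0" "\<forall>s. dist (circ s) (circ t0) < d3 \<longrightarrow> (\<forall>z\<in>Kc s. \<exists>w\<in>Kc t0. dist z w < \<nu>3)"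
    using K_upper_semicontinuous[OF nu3(1)] by blast
  have lsc: "\<exists>d>0. \<forall>t. dist (circ t) (circ t0) < d \<longrightarrow> (\<exists>x. a < x \<and> x < b \<and> circ x \<in> Kc t)"
    if "\<exists>x. a < x \<and> x < b \<and> circ x \<in> Kc t0" for a b
  proof -
    have "a < b" using that by auto
    then show ?thesis using good that unfolding good_def by blast
  qed
  obtain d4 where d4: "d4 > 0" "\<forall>t. dist (circ t) (circ t0) < d4 \<longrightarrow> (\<exists>x. p1 < x \<and> x < p2 \<and> circ x \<in> Kc t)"
    using lsc[OF pts(1)] by blast
  obtain d5 where d5: "d5 > 0" "\<forall>t. dist (circ t) (circ t0) < d5 \<longrightarrow> (\<exists>x. p2 < x \<and> x < p3 \<and> circ x \<in> Kc t)"
    using lsc[OF pts(2)] by blast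
  obtain d6 where d6: "d6 > 0" "\<forall>t. dist (circ t) (circ t0) < d6 \<longrightarrow> (\<exists>x. p3 < x \<and> x < p1 + 1 \<and> circ x \<in> Kc t)"
    using lsc[OF pts(3)] by blast
  define d where "d = Min {d1, d2, d3, d4, d5, d6}"
  have d: "d > 0" "d \<le> d1" "d \<le> d2" "d \<le> d3" "d \<le> d4" "d \<le> d5" "d \<le> d6"
    using d1 d2(1) d3(1) d4(1) d5(1) d6(1) unfolding d_def by auto
  have main: "co_lipschitz \<kappa> (fb n v)" if near: "\<And>s. s \<in> closed_segment u v \<Longrightarrow> dist (circ s) (circ t0) < d \<and> dist (circ (s + real n * \<omega>)) (circ t0) < d"
    and cu: "co_lipschitz \<kappa>1 (fb n u)" for n u v
  proof -
    define q where "q s p = \<Phi> n s p" for s p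
    have qK: "\<kappa>' * \<eta> / 16 \<le> \<bar>q s p - x\<bar>"
      if s: "s \<in> closed_segment u v" and c: "co_lipschitz \<kappa>' (fb n s)" and "\<kappa>' > 0" 
        and cl: "\<And>w. w \<in> Kc t0 \<Longrightarrow> \<exists>y\<in>Kc (s + n * \<omega>). dist w y < \<kappa>' * \<eta> / 2" 
        and pP: "p \<in> P" and x: "circ x \<in> Kc t0" for s \<kappa>' p x
    proof -
      obtain y where y: "y \<in> Kc (s + n * \<omega>)" "dist (circ x) y < \<kappa>' * \<eta> / 2" using cl[OF x] by blast
      obtain z where z: "z \<in> Kc s" "fb n s z = y" using fb_Kc_surj[OF y(1)] by blast
      have "dist (circ p) z \<ge> \<eta>" using gaps[of s z p] near[OF s] d(2) z(1) pP unfolding P_def by linarith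
      then have "\<kappa>' * \<eta> \<le> \<kappa>' * dist (circ p) z" using \<open>\<kappa>' > 0\<close> by simp
      also have "\<dots> \<le> dist (fb n s (circ p)) (fb n s z)" using c Kc_circle[OF z(1)] unfolding co_lipschitz_def by simp
      also have "\<dots> = dist (circ (q s p)) y" by (simp add: q_def circ_\<Phi> z(2))
      finally have "\<kappa>' * \<eta> / 2 \<le> dist (circ (q s p)) (circ x)" using y(2) by metric
      also have "\<dots> \<le> 8 * \<bar>q s p - x\<bar>" by (rule dist_circ_le8)
      finally show ?thesis by simp
    qed
    have qmono: "q s p1 < q s p2" "q s p2 < q s p3" "q s p3 < q s p1 + 1" for s
    proof -
      show "q s p1 < q s p2" "q s p2 < q s p3" using p by (simp_all add: q_def)
      have "q s p3 < \<Phi> n s (p1 + 1)" using p unfolding q_def \<Phi>_less_iff by simp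
      then show "q s p3 < q s p1 + 1" by (simp add: q_def \<Phi>_add_one)
    qed
    have uin: "u \<in> closed_segment u v" by simp
    have far_u: "l \<le> \<bar>q u p - x\<bar>" if "p \<in> P" "circ x \<in> Kc t0" for p x
      unfolding l_def
    proof (rule qK[OF uin cu k1 _ that])
      fix w assume w: "w \<in> Kc t0"
      have "dist (circ (u + n * \<omega>)) (circ t0) < d2" using near[OF uin] d(3) by linarith
      then obtain y where "y \<in> Kc (u + n * \<omega>)" "dist w y < min (\<kappa>1 * \<eta> / 2) (\<kappa> * \<eta> / 2)" using d2(2) w by blast
      then show "\<exists>y\<in>Kc (u + n * \<omega>). dist w y < \<kappa>1 * \<eta> / 2" by (intro bexI[of _ y]) auto
    qed
    have sep_u: "\<exists>x. q u a < x \<and> x < \<Phi> n u b \<and> circ x \<in> Kc t0"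
      if c: "\<exists>x. a < x \<and> x < b \<and> circ x \<in> Kc u" and ab: "a \<in> P" "\<exists>b'\<in>P. circ b = circ b'" for a b
    proof -
      obtain x where x: "a < x" "x < b" "circ x \<in> Kc u" using c by blast
      have y: "circ (\<Phi> n u x) \<in> Kc (u + n * \<omega>)" using \<Phi>_Kc x(3) by blast
      then obtain w where w: "w \<in> Kc t0" "dist (circ (\<Phi> n u x)) w < \<nu>3" using d3(2) near[OF uin] d(4) by (meson less_le_trans)
      then obtain y where y: "w = circ y" "\<bar>y - \<Phi> n u x\<bar> < l" 
        using nu3(2)[rule_format, of w "\<Phi> n u x"] Kc_circle[OF w(1)] by (auto simp: dist_commute)
      have xa: "2 * l \<le> \<bar>q u a' - \<Phi> n u x\<bar>" if a': "\<exists>b'\<in>P. circ a' = circ b'" for a'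
      proof -
        obtain b' where b': "b' \<in> P" "circ a' = circ b'" using a' by blast
        have "dist (circ a') (circ x) \<ge> \<eta>" using gaps[of u "circ x" b'] near[OF uin] d(2) x(3) b' unfolding P_def by auto
        then have "\<kappa>1 * \<eta> \<le> \<kappa>1 * dist (circ a') (circ x)" using k1 by simp
        also have "\<dots> \<le> dist (fb n u (circ a')) (fb n u (circ x))" using cu unfolding co_lipschitz_def by simp
        also have "\<dots> = dist (circ (q u a')) (circ (\<Phi> n u x))" by (simp add: q_def circ_\<Phi>)
        also have "\<dots> \<le> 8 * \<bar>q u a' - \<Phi> n u x\<bar>" by (rule dist_circ_le8)
        finally show ?thesis by (simp add: l_def field_simps)
      qed
      have "q u a < \<Phi> n u x" "\<Phi> n u x < \<Phi> n u b" using x by (simp_all add: q_def)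
      moreover have "2 * l \<le> \<bar>q u a - \<Phi> n u x\<bar>" using ab(1) by (intro xa) auto
      moreover have "2 * l \<le> \<bar>q u b - \<Phi> n u x\<bar>" using ab(2) by (intro xa) auto
      ultimately have "q u a < y" "y < \<Phi> n u b" using y(2) l unfolding q_def by linarith+
      then show ?thesis using w(1) y(1) by blast
    qed
    have near_u: "dist (circ u) (circ t0) < d" using near[OF uin] by blast
    obtain x12 where x12: "q u p1 < x12" "x12 < q u p2" "circ x12 \<in> Kc t0"
      using sep_u[of p1 p2] d4(2) near_u d(5) unfolding q_def P_def by fastforce
    obtain x23 where x23: "q u p2 < x23" "x23 < q u p3" "circ x23 \<in> Kc t0"
      using sep_u[of p2 p3] d5(2) near_u d(6) unfolding q_def P_def by fastforce
    obtain x31 where x31: "q u p3 < x31" "x31 < q u p1 + 1" "circ x31 \<in> Kc t0"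
      using sep_u[of p3 "p1 + 1"] d6(2) near_u d(7) unfolding q_def P_def \<Phi>_add_one by fastforce
    have x31': "circ (x31 - 1) \<in> Kc t0" using x31(3) by simp
    have P: "p1 \<in> P" "p2 \<in> P" "p3 \<in> P" by (auto simp: P_def)
    have long: "x23 - x12 \<ge> 2 * l" "x31 - x23 \<ge> 2 * l" "x12 - (x31 - 1) \<ge> 2 * l"
      using far_u[OF P(2) x12(3)] far_u[OF P(2) x23(3)] far_u[OF P(3) x23(3)] far_u[OF P(3) x31(3)]
        far_u[OF P(1) x12(3)] far_u[OF P(1) x31'] x12 x23 x31 by linarith+
    \<comment> \<open>\<open>Q s\<close>: over \<open>s\<close> the three images are in the same complementary intervals as over \<open>u\<close>.\<close>
    define Q where "Q s \<longleftrightarrow> (\<forall>p\<in>P. \<forall>x. circ x \<in> Kc t0 \<longrightarrow> q s p \<noteq> x \<and> (q u p < x \<longleftrightarrow> q s p < x))" for s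
    have Q_co: "co_lipschitz \<kappa> (fb n s)" if s: "s \<in> closed_segment u v" and Q: "Q s" for s
    proof (rule ccontr)
      assume nc: "\<not> co_lipschitz \<kappa> (fb n s)"
      have side: "q s p < x" if "p \<in> P" "circ x \<in> Kc t0" "q u p < x" for p x using Q that unfolding Q_def by blast
      have side': "x < q s p" if "p \<in> P" "circ x \<in> Kc t0" "x < q u p" for p x 
        using Q that unfolding Q_def by (meson less_asym linorder_neqE_linordered_idom)
      have o: "x31 - 1 < q s p1" "q s p1 < x12" "x12 < q s p2" "q s p2 < x23" "x23 < q s p3" "q s p3 < x31"
        using side side' P x12 x23 x31 x31' by auto
      obtain w w' where w: "w \<in> Kc (s + n * \<omega>)" "w' \<in> Kc (s + n * \<omega>)" "dist w w' \<ge> \<delta>" using spread unfolding spread_def by blast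
      obtain z z' where z: "z \<in> Kc s" "z' \<in> Kc s" "fb n s z = w" "fb n s z' = w'" using fb_Kc_surj w by metis
      have close: "\<exists>j::int. \<bar>q s p - q s p' - of_int j\<bar> < l" if pp: "p \<in> P" "p' \<in> P" for p p'
      proof (rule nu(2))
        have "dist (fb n s (circ p)) (fb n s (circ p')) < \<nu>"
        proof (rule k(2)[OF fb_mobius nc Kc_subset z(1,2)])
          show "dist (fb n s z) (fb n s z') \<ge> \<delta>" using z w by simp
          show "dist (circ p) x \<ge> \<eta>" "dist (circ p') x \<ge> \<eta>" if "x \<in> Kc s" for x
            using gaps[of s x] near[OF s] d(2) that pp unfolding P_def by auto
        qed auto
        then show "dist (circ (q s p)) (circ (q s p')) < \<nu>" by (simp add: q_def circ_\<Phi>)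
      qed
      have small: "q s p - q s p' < l" if pp: "p \<in> P" "p' \<in> P" and b: "q s p > q s p'" "q s p - q s p' < 1 - l" for p p'
      proof -
        obtain j :: int where j: "\<bar>q s p - q s p' - of_int j\<bar> < l" using close[OF pp] by blast
        have "of_int j < (1::real)" using j b by linarith
        then have "j \<le> 0" by linarith
        then have "of_int j \<le> (0::real)" by simp
        then show ?thesis using j by linarith
      qed
      have "q s p2 - q s p1 < l" using small[OF P(2,1)] qmono(1)[of s] o long l by linarith
      moreover have "q s p3 - q s p2 < l" using small[OF P(3,2)] qmono(2)[of s] o long l by linarith
      ultimately show False using o long by linarith
    qed
    have Q_far: "l2 \<le> \<bar>q s p - x\<bar>" if s: "s \<in> closed_segment u v" and Q: "Q s" and p: "p \<in> P" and x: "circ x \<in> Kc t0" for s p x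
      unfolding l2_def
    proof (rule qK[OF s Q_co[OF s Q] k(1) _ p x])
      fix w assume w: "w \<in> Kc t0"
      have "dist (circ (s + n * \<omega>)) (circ t0) < d2" using near[OF s] d(3) by linarith
      then obtain y where "y \<in> Kc (s + n * \<omega>)" "dist w y < min (\<kappa>1 * \<eta> / 2) (\<kappa> * \<eta> / 2)" using d2(2) w by blast
      then show "\<exists>y\<in>Kc (s + n * \<omega>). dist w y < \<kappa> * \<eta> / 2" by (intro bexI[of _ y]) auto
    qed
    have "\<exists>\<tau>>0. \<forall>s\<in>closed_segment u v. \<forall>s'\<in>closed_segment u v. dist s s' < \<tau> \<longrightarrow> (\<forall>p\<in>P. \<bar>q s p - q s' p\<bar> < l2)"
    proof -
      have "\<exists>\<tau>>0. \<forall>s\<in>closed_segment u v. \<forall>s'\<in>closed_segment u v. dist s s' < \<tau> \<longrightarrow> \<bar>q s p - q s' p\<bar> < l2" for p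
      proof -
        have "continuous_on (closed_segment u v) (\<lambda>s. q s p)" unfolding q_def by (intro continuous_intros)
        then have "uniformly_continuous_on (closed_segment u v) (\<lambda>s. q s p)" by (intro compact_uniformly_continuous compact_segment)
        then show ?thesis using l2 unfolding uniformly_continuous_on_def dist_real_def by (metis abs_minus_commute)
      qed
      then obtain \<tau> where t: "\<And>p. \<tau> p > 0" 
        "\<And>p s s'. s \<in> closed_segment u v \<Longrightarrow> s' \<in> closed_segment u v \<Longrightarrow> dist s s' < \<tau> p \<Longrightarrow> \<bar>q s p - q s' p\<bar> < l2" by metis
      show ?thesis by (rule exI[of _ "Min (\<tau> ` P)"]) (use t in \<open>auto simp: P_def\<close>)
    qed
    then obtain \<tau> where t: "\<tau> > 0" 
       "\<And>s s' p. \<lbrakk>s \<in> closed_segment u v; s' \<in> closed_segment u v; dist s s' < \<tau>; p \<in> P\<rbrakk> \<Longrightarrow> \<bar>q s p - q s' p\<bar> < l2" by blast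
    have Q_step: "Q s'" if s: "s \<in> closed_segment u v" "s' \<in> closed_segment u v" "dist s s' < \<tau>" "Q s" for s s'
      unfolding Q_def
    proof (intro ballI allI impI)
      fix p x assume px: "p \<in> P" "circ x \<in> Kc t0"
      have "q s p \<noteq> x \<and> (q u p < x \<longleftrightarrow> q s p < x)" using s(4) px unfolding Q_def by blast
      then show "q s' p \<noteq> x \<and> (q u p < x \<longleftrightarrow> q s' p < x)"
        using Q_far[OF s(1) s(4) px] t(2)[OF s(1-3) px(1)] by linarith
    qed
    have "Q u" unfolding Q_def using far_u l by fastforce
    have "Q v"
    proof (rule connected_induction_simple[of "closed_segment u v" u v Q])
      fix s assume s: "s \<in> closed_segment u v"
      show "\<exists>T. openin (top_of_set (closed_segment u v)) T \<and> s \<in> T \<and> (\<forall>x\<in>T. \<forall>y\<in>T. Q x \<longrightarrow> Q y)"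
      proof (intro exI[of _ "closed_segment u v \<inter> ball s (\<tau> / 2)"] conjI ballI impI)
        show "openin (top_of_set (closed_segment u v)) (closed_segment u v \<inter> ball s (\<tau> / 2))" by (intro openin_open_Int) simp
        show "s \<in> closed_segment u v \<inter> ball s (\<tau> / 2)" using s t(1) by simp
        fix x y assume xy: "x \<in> closed_segment u v \<inter> ball s (\<tau> / 2)" "y \<in> closed_segment u v \<inter> ball s (\<tau> / 2)" "Q x"
        have "dist s x < \<tau> / 2" "dist s y < \<tau> / 2" using xy by auto
        then have "dist x y < \<tau>" by (rule dist_triangle_half_r)
        then show "Q y" using Q_step[of x y] xy by blast
      qed
    qed (use \<open>Q u\<close> in auto)
    then show ?thesis by (intro Q_co) auto
  qed
  have "\<forall>n u v. (\<forall>s\<in>closed_segment u v. dist (circ s) (circ t0) < d \<and> dist (circ (s + real n * \<omega>)) (circ t0) < d)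
       \<longrightarrow> co_lipschitz \<kappa>1 (fb n u) \<longrightarrow> co_lipschitz \<kappa> (fb n v)"
    by (intro allI impI) (rule main, simp_all)
  with k(1) d(1) show ?thesis by blast
qed

text \<open>
  The assumption \<open>coll\<close> is the conclusion of \<open>collapse_in_K\<close>. The points \<open>k1\<close>, \<open>k2\<close>, \<open>k3\<close> of the fibre
  are separated by three gaps with points \<open>p1\<close>, \<open>p2\<close>, \<open>p3\<close>, and the repeller \<open>r\<close> is the point at \<open>k1\<close>.
\<close>
lemma unbounded_two_points:
  assumes good: "good t0" and spread: "spread \<delta>" and unb: "\<not> bounded_cocycle"
    and rK: "r \<in> Kc t0" and aK: "a \<in> Kc t0"
    and coll: "\<And>\<epsilon> \<kappa>. \<epsilon> > 0 \<Longrightarrow> \<kappa> > 0 \<Longrightarrow> \<exists>n. dist (circ (t0 + real n * \<omega>)) (circ t0) < \<epsilon> \<and>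
       \<not> co_lipschitz \<kappa> (fb n t0) \<and> (\<forall>z\<in>circle. dist z r * dist (fb n t0 z) a \<le> \<epsilon>)"
    and k1: "r = circ k1" and k: "k1 < k2" "k2 < k3" "k3 < k1 + 1" and kK: "circ k2 \<in> Kc t0" "circ k3 \<in> Kc t0"
  shows False
proof -
  have \<delta>: "\<delta> > 0" using spread by (simp add: spread_def)
  have gap: "\<exists>x. a < x \<and> x < b \<and> circ x \<notin> Kc t0" if "a < b" for a b using good that unfolding good_def by blast
  obtain p1 where p1: "k1 < p1" "p1 < k2" "circ p1 \<notin> Kc t0" using gap[OF k(1)] by blast
  obtain p2 where p2: "k2 < p2" "p2 < k3" "circ p2 \<notin> Kc t0" using gap[OF k(2)] by blast
  obtain p3 where p3: "k3 < p3" "p3 < k1 + 1" "circ p3 \<notin> Kc t0" using gap[OF k(3)] by blast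
  have p: "p1 < p2" "p2 < p3" "p3 < p1 + 1" using p1 p2 p3 by linarith+
  obtain e1 g1 where g1: "e1 > 0" "g1 > 0" "\<And>t x. dist (circ t) (circ t0) < g1 \<Longrightarrow> x \<in> Kc t \<Longrightarrow> dist (circ p1) x \<ge> e1"
    using gap_uniform[OF p1(3)] by blast
  obtain e2 g2 where g2: "e2 > 0" "g2 > 0" "\<And>t x. dist (circ t) (circ t0) < g2 \<Longrightarrow> x \<in> Kc t \<Longrightarrow> dist (circ p2) x \<ge> e2"
    using gap_uniform[OF p2(3)] by blast
  obtain e3 g3 where g3: "e3 > 0" "g3 > 0" "\<And>t x. dist (circ t) (circ t0) < g3 \<Longrightarrow> x \<in> Kc t \<Longrightarrow> dist (circ p3) x \<ge> e3"
    using gap_uniform[OF p3(3)] by blast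
  define \<eta> where "\<eta> = min e1 (min e2 e3)"
  define g where "g = min g1 (min g2 g3)"
  have eta: "\<eta> > 0" and g: "g > 0" using g1 g2 g3 by (auto simp: \<eta>_def g_def)
  have gaps: "dist (circ p) x \<ge> \<eta>" if "dist (circ t) (circ t0) < g" "x \<in> Kc t" "p \<in> {p1, p2, p3}" for t x p
    using g1(3)[of t x] g2(3)[of t x] g3(3)[of t x] that by (auto simp: \<eta>_def g_def)
  obtain \<kappa>1 where kap1: "\<kappa>1 > 0"
    "\<And>g X x y x' y' p. \<lbrakk>circle_mobius g; X \<subseteq> circle; x \<in> X; y \<in> X; dist x y \<ge> \<delta>;
        x' \<in> X; y' \<in> X; dist (g x') (g y') \<ge> \<delta>;
        p \<in> circle; \<And>x. x \<in> X \<Longrightarrow> dist p x \<ge> \<eta>; \<And>x. x \<in> X \<Longrightarrow> dist (g p) (g x) \<ge> \<eta>\<rbrakk>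
       \<Longrightarrow> co_lipschitz \<kappa>1 g"
    using co_lipschitz_if_matches_gaps[OF eta \<delta>] by blast
  have pts: "\<exists>x. p1 < x \<and> x < p2 \<and> circ x \<in> Kc t0" "\<exists>x. p2 < x \<and> x < p3 \<and> circ x \<in> Kc t0" 
      "\<exists>x. p3 < x \<and> x < p1 + 1 \<and> circ x \<in> Kc t0"
  proof -
    show "\<exists>x. p1 < x \<and> x < p2 \<and> circ x \<in> Kc t0" using p1 p2 kK by blast
    show "\<exists>x. p2 < x \<and> x < p3 \<and> circ x \<in> Kc t0" using p2 p3 kK by blast
    show "\<exists>x. p3 < x \<and> x < p1 + 1 \<and> circ x \<in> Kc t0" using p3 p1 rK k1 by (intro exI[of _ "k1 + 1"]) simp
  qed
  have "\<exists>\<kappa>>0. \<exists>d>0. \<forall>n u v. (\<forall>s\<in>closed_segment u v. dist (circ s) (circ t0) < d \<and> dist (circ (s + real n * \<omega>)) (circ t0) < d)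
       \<longrightarrow> co_lipschitz \<kappa>1 (fb n u) \<longrightarrow> co_lipschitz \<kappa> (fb n v)"
    by (rule bounded_along_arc[OF good spread kap1(1) p eta g _ pts]) (rule gaps)
  then obtain \<kappa>2 d where kd: "\<kappa>2 > 0" "d > 0" "\<And>n u v. \<lbrakk>\<forall>s\<in>closed_segment u v. dist (circ s) (circ t0) < d \<and> dist (circ (s + real n * \<omega>)) (circ t0) < d;
       co_lipschitz \<kappa>1 (fb n u)\<rbrakk> \<Longrightarrow> co_lipschitz \<kappa>2 (fb n v)"
    by blast
  define D where "D = min d g"
  have D: "D > 0" "D \<le> d" "D \<le> g" using kd g by (auto simp: D_def)
  \<comment> \<open>A time \<open>m\<close> that carries the repeller to the other side of the gaps \<open>p1\<close> and \<open>p3\<close>.\<close>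
  have "min (k2 - p1) (p3 - k2) > 0" using p1 p2 p by simp
  then obtain c2 where c2: "c2 > 0" "\<forall>z x. z \<in> circle \<longrightarrow> dist z (circ x) < c2 \<longrightarrow> (\<exists>y. z = circ y \<and> \<bar>y - x\<bar> < min (k2 - p1) (p3 - k2))"
    using circ_close_lift by blast
  have "min (p1 - k1) (k1 + 1 - p3) > 0" using p1 p3 by simp
  then obtain c1 where c1: "c1 > 0" "\<forall>z x. z \<in> circle \<longrightarrow> dist z (circ x) < c1 \<longrightarrow> (\<exists>y. z = circ y \<and> \<bar>y - x\<bar> < min (p1 - k1) (k1 + 1 - p3))"
    using circ_close_lift by blast
  have "D / 16 > 0" using D by simp
  then obtain cD where cD: "cD > 0" "\<forall>z x. z \<in> circle \<longrightarrow> dist z (circ x) < cD \<longrightarrow> (\<exists>y. z = circ y \<and> \<bar>y - x\<bar> < D / 16)"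
    using circ_close_lift by blast
  have "min cD (c2 / 2) > 0" using cD c2 by simp
  then obtain m where m: "dist (circ (t0 + real m * \<omega>)) (circ t0) < min cD (c2 / 2)" "dist (fb m t0 r) (circ k2) < min cD (c2 / 2)"
    using visits[OF rK kK(1)] by blast
  obtain t1 where t1: "circ (t0 + real m * \<omega>) = circ t1" "\<bar>t1 - t0\<bar> < D / 16"
    using cD(2) m(1) by (meson circ_in_circle min_less_iff_conj)
  have seg: "dist (circ s) (circ t0) < D / 2" if "s \<in> closed_segment t0 t1" for s
  proof -
    have "\<bar>s - t0\<bar> \<le> \<bar>t1 - t0\<bar>" using segment_bound1[OF that] by simp
    then have "8 * \<bar>s - t0\<bar> \<le> 8 * \<bar>t1 - t0\<bar>" by simp
    also have "\<dots> < D / 2" using t1(2) by simp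
    finally show ?thesis using dist_circ_le8[of s t0] by (rule le_less_trans[rotated])
  qed
  have amK: "fb m t0 a \<in> Kc t1" using fb_Kc[OF Kc_circle[OF aK], of m t0] aK Kc_cong[OF t1(1)] by simp
  have "\<eta> > 0" "c2 / 2 > 0" using eta c2 by simp_all
  then obtain ea where ea: "ea > 0" "\<forall>s t. \<forall>z\<in>circle. \<forall>w\<in>circle. dist (circ s) (circ t) < ea \<longrightarrow> dist z w < ea
     \<longrightarrow> dist (fb m s z) (fb m t w) < \<eta>" using fb_uniform[of \<eta> m] by blast
  obtain er where er: "er > 0" "\<forall>s t. \<forall>z\<in>circle. \<forall>w\<in>circle. dist (circ s) (circ t) < er \<longrightarrow> dist z w < er
     \<longrightarrow> dist (fb m s z) (fb m t w) < c2 / 2" using fb_uniform[OF \<open>c2 / 2 > 0\<close>, of m] by blast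
  define \<epsilon> where "\<epsilon> = Min {D / 2, ea, c1 * \<eta> / 2, er * ea / 2}"
  have eps: "\<epsilon> > 0" "\<epsilon> \<le> D / 2" "\<epsilon> \<le> ea" "\<epsilon> \<le> c1 * \<eta> / 2" "\<epsilon> \<le> er * ea / 2"
    using D(1) ea(1) c1(1) eta er(1) unfolding \<epsilon>_def by auto
  obtain n where n: "dist (circ (t0 + real n * \<omega>)) (circ t0) < \<epsilon>" "\<not> co_lipschitz \<kappa>2 (fb n t0)" 
      "\<forall>z\<in>circle. dist z r * dist (fb n t0 z) a \<le> \<epsilon>" using coll[OF eps(1) kd(1)] by blast
  have segn: "dist (circ (s + real n * \<omega>)) (circ t0) < D" if "s \<in> closed_segment t0 t1" for s
  proof -
    have "dist (circ (s + real n * \<omega>)) (circ (t0 + real n * \<omega>)) < D / 2" using seg[OF that] by simp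
    then show ?thesis using n(1) eps(2) by metric
  qed
  \<comment> \<open>Over \<open>t0\<close> the preimage of \<open>p1\<close> lies near \<open>r\<close>, between \<open>p3 - 1\<close> and \<open>p1\<close>.\<close>
  obtain N where N: "\<Phi> n t0 p3 - 1 < p1 + of_int N" "p1 + of_int N < \<Phi> n t0 p1"
  proof -
    obtain y where y: "y \<in> circle" "fb n t0 y = circ p1" using fb_surj[OF circ_in_circle] by metis
    have "dist (circ p1) a \<ge> \<eta>" using gaps[of t0 a p1] g aK by simp
    moreover have "dist (circ p1) a * dist y r \<le> \<epsilon>" using n(3)[rule_format, OF y(1)] y(2) by (simp add: mult.commute)
    ultimately have "dist y r \<le> \<epsilon> / \<eta>" using dist_large_prod_small[OF _ _ eta] by blast
    also have "\<dots> \<le> c1 / 2" using eps(4) eta by (simp add: field_simps)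
    finally have "dist y (circ k1) < c1" using c1(1) k1 by simp
    then obtain x where x: "y = circ x" "\<bar>x - k1\<bar> < min (p1 - k1) (k1 + 1 - p3)" using c1(2) y(1) by blast
    have "circ (\<Phi> n t0 x) = circ p1" using y x(1) circ_\<Phi> by simp
    then obtain N :: int where N: "\<Phi> n t0 x - p1 = of_int N" by (auto simp: circ_eq_iff elim: Ints_cases)
    have "p3 - 1 < x" "x < p1" using x(2) by linarith+
    then have "\<Phi> n t0 (p3 - 1) < \<Phi> n t0 x" "\<Phi> n t0 x < \<Phi> n t0 p1" by simp_all
    moreover have "\<Phi> n t0 (p3 - 1) = \<Phi> n t0 p3 - 1" using \<Phi>_int[of n t0 p3 "-1"] by simp
    ultimately show thesis using that[of N] N by linarith
  qed
  \<comment> \<open>Over \<open>t1\<close> it lies near the image of \<open>r\<close>, between \<open>p1\<close> and \<open>p3\<close>.\<close>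
  obtain N' where N': "\<Phi> n t1 p1 < p1 + of_int N'" "p1 + of_int N' < \<Phi> n t1 p3"
  proof -
    obtain y1 where y1: "y1 \<in> circle" "fb n t1 y1 = circ p1" using fb_surj[OF circ_in_circle] by metis
    obtain y where y: "y \<in> circle" "fb m t0 y = y1" using fb_surj[OF y1(1)] by metis
    have c: "fb m (t0 + n * \<omega>) (fb n t0 y) = circ p1"
    proof -
      have "fb m (t0 + n * \<omega>) (fb n t0 y) = fb (m + n) t0 y" using fb_add[OF y(1), of m n t0] by simp
      also have "\<dots> = fb n (t0 + m * \<omega>) (fb m t0 y)" using fb_add[OF y(1), of n m t0] by (simp add: add.commute)
      also have "\<dots> = circ p1" using y y1 fb_cong[OF t1(1)] by simp
      finally show ?thesis .
    qed
    have "dist (fb n t0 y) a \<ge> ea"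
    proof (rule ccontr)
      assume "\<not> dist (fb n t0 y) a \<ge> ea"
      then have "dist (fb m (t0 + n * \<omega>) (fb n t0 y)) (fb m t0 a) < \<eta>"
        using ea(2) n(1) eps(3) fb_circle[OF y(1)] Kc_circle[OF aK] by simp
      moreover have "dist (circ p1) (fb m t0 a) \<ge> \<eta>" 
        using gaps[of t1 "fb m t0 a" p1] amK seg[of t1] D by simp
      ultimately show False using c by simp
    qed
    moreover have "dist (fb n t0 y) a * dist y r \<le> \<epsilon>" using n(3)[rule_format, OF y(1)] by (simp add: mult.commute)
    ultimately have "dist y r \<le> \<epsilon> / ea" using dist_large_prod_small[OF _ _ ea(1)] by blast
    also have "\<dots> \<le> er / 2" using eps(5) ea(1) by (simp add: field_simps)
    finally have "dist y r < er" using er(1) by simp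
    then have "dist y1 (fb m t0 r) < c2 / 2" using er y Kc_circle[OF rK] by force
    moreover have "dist (fb m t0 r) (circ k2) < c2 / 2" using m(2) by simp
    ultimately have "dist y1 (circ k2) < c2" by metric
    then obtain x where x: "y1 = circ x" "\<bar>x - k2\<bar> < min (k2 - p1) (p3 - k2)" using c2(2) y1(1) by blast
    have "circ (\<Phi> n t1 x) = circ p1" using y1 x(1) circ_\<Phi> by simp
    then obtain N :: int where N: "\<Phi> n t1 x - p1 = of_int N" by (auto simp: circ_eq_iff elim: Ints_cases)
    have "p1 < x" "x < p3" using x(2) by linarith+
    then have "\<Phi> n t1 p1 < \<Phi> n t1 x" "\<Phi> n t1 x < \<Phi> n t1 p3" by simp_all
    then show thesis using that[of N] N by linarith
  qed
  \<comment> \<open>In between, the image of \<open>p1\<close> or of \<open>p3\<close> has to pass through \<open>p1\<close>.\<close>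
  have "\<exists>s\<in>closed_segment t0 t1. \<exists>p\<in>{p1, p3}. \<exists>j::int. \<Phi> n s p - p1 = of_int j"
  proof (rule ccontr)
    assume no: "\<not> ?thesis"
    have "\<lfloor>\<Phi> n t0 p1 - p1\<rfloor> = \<lfloor>\<Phi> n t1 p1 - p1\<rfloor>"
      by (rule floor_constant) (use no in \<open>auto intro!: continuous_intros\<close>)
    moreover have "\<lfloor>\<Phi> n t0 p3 - p1\<rfloor> = \<lfloor>\<Phi> n t1 p3 - p1\<rfloor>"
      by (rule floor_constant) (use no in \<open>auto intro!: continuous_intros\<close>)
    moreover have "\<lfloor>\<Phi> n t0 p3 - p1\<rfloor> \<le> N" "N \<le> \<lfloor>\<Phi> n t0 p1 - p1\<rfloor>" using N by linarith+
    moreover have "\<lfloor>\<Phi> n t1 p1 - p1\<rfloor> < N'" "N' \<le> \<lfloor>\<Phi> n t1 p3 - p1\<rfloor>" using N' by linarith+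
    ultimately show False by linarith
  qed
  then obtain s p and j :: int where s: "s \<in> closed_segment t0 t1" "p \<in> {p1, p3}" "\<Phi> n s p - p1 = of_int j" by blast
  have near: "dist (circ s) (circ t0) < g" "dist (circ (s + real n * \<omega>)) (circ t0) < g"
    using seg[OF s(1)] segn[OF s(1)] D by linarith+
  have gp: "fb n s (circ p) = circ p1"
  proof -
    have "\<Phi> n s p = p1 + of_int j" using s(3) by linarith
    then have "circ (\<Phi> n s p) = circ p1" by simp
    then show ?thesis by (simp add: circ_\<Phi>)
  qed
  obtain w w' where w: "w \<in> Kc (s + n * \<omega>)" "w' \<in> Kc (s + n * \<omega>)" "dist w w' \<ge> \<delta>" using spread unfolding spread_def by blast
  obtain z z' where z: "z \<in> Kc s" "z' \<in> Kc s" "fb n s z = w" "fb n s z' = w'" using fb_Kc_surj w by metis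
  obtain x y where xy: "x \<in> Kc s" "y \<in> Kc s" "dist x y \<ge> \<delta>" using spread unfolding spread_def by blast
  have "co_lipschitz \<kappa>1 (fb n s)"
  proof (rule kap1(2)[OF fb_mobius Kc_subset xy z(1,2)])
    show "dist (fb n s z) (fb n s z') \<ge> \<delta>" using z w by simp
    show "circ p \<in> circle" by simp
    show "dist (circ p) v \<ge> \<eta>" if "v \<in> Kc s" for v using gaps[OF near(1) that] s(2) by auto
    show "dist (fb n s (circ p)) (fb n s v) \<ge> \<eta>" if "v \<in> Kc s" for v
      unfolding gp by (rule gaps[OF near(2)]) (use fb_Kc that Kc_circle in auto)
  qed
  moreover have "\<forall>s'\<in>closed_segment s t0. dist (circ s') (circ t0) < d \<and> dist (circ (s' + real n * \<omega>)) (circ t0) < d"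
  proof
    fix s' assume "s' \<in> closed_segment s t0"
    then have "s' \<in> closed_segment t0 t1" using s(1) subset_closed_segment[of s t0 t0 t1] by auto
    then show "dist (circ s') (circ t0) < d \<and> dist (circ (s' + real n * \<omega>)) (circ t0) < d" using seg segn D by fastforce
  qed
  ultimately show False using kd(3) n(2) by blast
qed

end

lemma lift_in_period:
  assumes "z \<in> circle" "z \<noteq> circ k"
  shows "\<exists>x. k < x \<and> x < k + 1 \<and> z = circ x"
proof -
  obtain y where y: "z = circ y" using circ_surj assms by blast
  define x where "x = k + frac (y - k)"
  have "circ x = circ y" by (simp add: x_def frac_def)
  moreover have "frac (y - k) \<noteq> 0" using assms(2) y by (simp add: circ_eq_iff frac_eq_0_iff)
  then have "k < x" "x < k + 1" using frac_ge_0[of "y - k"] frac_lt_1[of "y - k"] by (auto simp: x_def less_le)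
  ultimately show ?thesis using y by metis
qed

lemma circ_inj_short: "circ x = circ y \<Longrightarrow> \<bar>x - y\<bar> < 1 \<Longrightarrow> x = y"
proof -
  assume "circ x = circ y" "\<bar>x - y\<bar> < 1"
  then obtain j :: int where "x - y = of_int j" by (auto simp: circ_eq_iff elim: Ints_cases)
  moreover from this have "j = 0" using \<open>\<bar>x - y\<bar> < 1\<close> by simp
  ultimately show "x = y" by simp
qed

context lifted_minimal
begin

section \<open>The unbounded case\<close>

lemma unbounded_fibre_two:
  assumes "good t0" "spread \<delta>" "\<not> bounded_cocycle"
  shows "\<exists>c d. Kc t0 = {c, d} \<and> dist c d \<ge> \<delta> \<and> c \<noteq> d"
proof -
  obtain r a where r: "r \<in> Kc t0" and a: "a \<in> Kc t0" and coll: "\<forall>\<epsilon> \<kappa>. \<epsilon> > 0 \<longrightarrow> \<kappa> > 0 \<longrightarrow> (\<exists>n. dist (circ (t0 + real n * \<omega>)) (circ t0) < \<epsilon> \<and>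
       \<not> co_lipschitz \<kappa> (fb n t0) \<and> (\<forall>z\<in>circle. dist z r * dist (fb n t0 z) a \<le> \<epsilon>))"
    using collapse_in_K[OF assms(3,2)] by blast
  obtain k1 where k1: "r = circ k1" using circ_surj Kc_circle[OF r] by blast
  have no: False if "k1 < k2" "k2 < k3" "k3 < k1 + 1" "circ k2 \<in> Kc t0" "circ k3 \<in> Kc t0" for k2 k3
    by (rule unbounded_two_points[OF assms r a _ k1 that]) (use coll in blast)
  have eq: "z = w" if z: "z \<in> Kc t0" "z \<noteq> r" and w: "w \<in> Kc t0" "w \<noteq> r" for z w
  proof (rule ccontr)
    assume "z \<noteq> w"
    obtain x where x: "k1 < x" "x < k1 + 1" "z = circ x" using lift_in_period[of z k1] z Kc_circle k1 by blast
    obtain y where y: "k1 < y" "y < k1 + 1" "w = circ y" using lift_in_period[of w k1] w Kc_circle k1 by blast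
    have "x \<noteq> y" using x y \<open>z \<noteq> w\<close> by blast
    then consider "x < y" | "y < x" by linarith
    then show False using no[of x y] no[of y x] x y z w by cases blast+
  qed
  obtain x y where xy: "x \<in> Kc t0" "y \<in> Kc t0" "dist x y \<ge> \<delta>" "\<delta> > 0" using assms(2) unfolding spread_def by blast
  then have "x \<noteq> y" by auto
  then have "Kc t0 = {x, y}" using eq xy r by blast
  then show ?thesis using xy(3) \<open>x \<noteq> y\<close> by blast
qed

text \<open>Pairs that never come close are the substitute for the two points of a good fibre over other base points.\<close>
definition paired :: "real \<Rightarrow> real \<Rightarrow> complex \<Rightarrow> complex \<Rightarrow> bool" where
  "paired \<delta> t x y \<longleftrightarrow> x \<in> Kc t \<and> y \<in> Kc t \<and> (\<forall>n. dist (fb n t x) (fb n t y) \<ge> \<delta>)"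

lemma paired_forward:
  assumes "paired \<delta> t x y" 
  shows "paired \<delta> (t + real n * \<omega>) (fb n t x) (fb n t y)"
proof -
  have xy: "x \<in> circle" "y \<in> circle" using assms Kc_circle unfolding paired_def by blast+
  have "dist (fb m (t + real n * \<omega>) (fb n t x)) (fb m (t + real n * \<omega>) (fb n t y)) \<ge> \<delta>" for m
    using assms fb_add[OF xy(1), of m n t] fb_add[OF xy(2), of m n t] unfolding paired_def by metis
  then show ?thesis using assms fb_Kc xy unfolding paired_def by blast
qed

lemma paired_dist: "paired \<delta> t x y \<Longrightarrow> dist x y \<ge> \<delta>"
  unfolding paired_def by (metis fb_0)

lemma paired_star:
  assumes "paired \<delta> t x y" "paired \<delta> t x' y'" "\<delta> > 0" "\<not> bounded_cocycle"
  shows "x = x' \<or> x = y' \<or> y = x' \<or> y = y'"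
proof (rule ccontr)
  assume ne: "\<not> ?thesis"
  define d where "d = Min {dist x x', dist x y', dist y x', dist y y'}"
  have d: "d > 0" "dist x x' \<ge> d" "dist x y' \<ge> d" "dist y x' \<ge> d" "dist y y' \<ge> d" 
    using ne by (auto simp: d_def)
  obtain \<kappa> where k: "\<kappa> > 0"
    "\<And>g x y x' y'. \<lbrakk>circle_mobius g; x \<in> circle; y \<in> circle; x' \<in> circle; y' \<in> circle;
        dist x x' \<ge> d; dist x y' \<ge> d; dist y x' \<ge> d; dist y y' \<ge> d; 
        dist (g x) (g y) \<ge> \<delta>; dist (g x') (g y') \<ge> \<delta>\<rbrakk> \<Longrightarrow> co_lipschitz \<kappa> g"
    using co_lipschitz_if_two_pairs[OF d(1) assms(3)] by blast
  have c: "x \<in> circle" "y \<in> circle" "x' \<in> circle" "y' \<in> circle"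
    using assms(1,2) Kc_circle unfolding paired_def by blast+
  have "co_lipschitz \<kappa> (fb n t)" for n
    by (rule k(2)[OF fb_mobius c d(2-5)]) (use assms(1,2) in \<open>auto simp: paired_def\<close>)
  then have bounded_cocycle by (rule bounded_cocycle_if_at[OF k(1)])
  then show False using assms(4) by blast
qed

text \<open>
  The orbit of \<open>c\<close> over the good base point approaches \<open>x\<close>, and a limit of the simultaneous images of
  \<open>d\<close> is a partner of \<open>x\<close>.
\<close>
lemma partner_exists:
  assumes sp: "spread \<delta>" and t0: "Kc t0 = {c, d}" and x: "x \<in> Kc t"
  shows "\<exists>y. paired \<delta> t x y"
proof -
  have cd: "c \<in> Kc t0" "d \<in> Kc t0" using t0 by auto
  have cdc: "c \<in> circle" "d \<in> circle" using cd Kc_circle by blast+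
  have \<delta>: "\<delta> > 0" using sp by (simp add: spread_def)
  have base: "dist (fb n t0 c) (fb n t0 d) \<ge> \<delta>" for n
  proof -
    obtain w w' where w: "w \<in> Kc (t0 + n * \<omega>)" "w' \<in> Kc (t0 + n * \<omega>)" "dist w w' \<ge> \<delta>" using sp unfolding spread_def by blast
    obtain z z' where "z \<in> Kc t0" "z' \<in> Kc t0" "fb n t0 z = w" "fb n t0 z' = w'" using fb_Kc_surj w by metis
    then show ?thesis using w(3) \<delta> t0 by (auto simp: dist_commute)
  qed
  have "\<exists>n. dist (circ (t0 + real n * \<omega>)) (circ t) < 1 / real (Suc k) \<and> dist (fb n t0 c) x < 1 / real (Suc k)" for k
    using visits[OF cd(1) x, of "1 / real (Suc k)"] by simp
  then obtain n where n: "\<And>k. dist (circ (t0 + real (n k) * \<omega>)) (circ t) < 1 / real (Suc k)" 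
    "\<And>k. dist (fb (n k) t0 c) x < 1 / real (Suc k)" by metis
  have "\<forall>k. fb (n k) t0 d \<in> circle" using fb_circle cdc by blast
  then obtain y \<sigma> where y: "y \<in> circle" "strict_mono \<sigma>" "((\<lambda>k. fb (n k) t0 d) \<circ> \<sigma>) \<longlonglongrightarrow> y"
    using compact_sphere[of "0::complex" 1] unfolding compact_eq_seq_compact_metric seq_compact_def by meson
  have near: "\<exists>m. dist (circ (t0 + real m * \<omega>)) (circ t) < e \<and> dist (fb m t0 c) x < e \<and> dist (fb m t0 d) y < e" if e: "e > 0" for e
  proof -
    have "\<forall>\<^sub>F k in sequentially. dist (fb (n (\<sigma> k)) t0 d) y < e" using tendstoD[OF y(3) e] by simp
    moreover have "\<forall>\<^sub>F k in sequentially. 1 / real (Suc k) < e" using e by (rule order_tendstoD(2)[OF LIMSEQ_Suc[OF lim_1_over_n]])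
    ultimately have "\<forall>\<^sub>F k in sequentially. dist (fb (n (\<sigma> k)) t0 d) y < e \<and> 1 / real (Suc k) < e" by eventually_elim auto
    then obtain k where k: "dist (fb (n (\<sigma> k)) t0 d) y < e" "1 / real (Suc k) < e"
      by (metis (no_types, lifting) eventually_sequentially order_refl)
    have "1 / real (Suc (\<sigma> k)) \<le> 1 / real (Suc k)" using seq_suble[OF y(2), of k] by (simp add: frac_le)
    then have "1 / real (Suc (\<sigma> k)) < e" using k by linarith
    then show ?thesis using k(1) n[of "\<sigma> k"] by (intro exI[of _ "n (\<sigma> k)"]) linarith
  qed
  have yK: "y \<in> Kc t"
  proof (rule Kc_limit[OF y(1)])
    fix e :: real assume "e > 0"
    then obtain m where m: "dist (circ (t0 + real m * \<omega>)) (circ t) < e" "dist (fb m t0 d) y < e" using near by blast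
    have "fb m t0 d \<in> Kc (t0 + real m * \<omega>)" using fb_Kc cdc cd by blast
    then show "\<exists>s w. w \<in> Kc s \<and> dist (circ s) (circ t) < e \<and> dist w y < e" using m by blast
  qed
  have "\<delta> \<le> dist (fb m t x) (fb m t y)" for m
  proof (rule field_le_epsilon)
    fix e :: real assume e: "e > 0"
    then have "e / 2 > 0" by simp
    then obtain h where h: "h > 0" "\<forall>s t. \<forall>z\<in>circle. \<forall>w\<in>circle. dist (circ s) (circ t) < h \<longrightarrow> dist z w < h
     \<longrightarrow> dist (fb m s z) (fb m t w) < e / 2" using fb_uniform[of "e/2" m] by blast
    obtain j where j: "dist (circ (t0 + real j * \<omega>)) (circ t) < h" "dist (fb j t0 c) x < h" "dist (fb j t0 d) y < h"
      using near[OF h(1)] by blast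
    define p q where "p = fb m (t0 + real j * \<omega>) (fb j t0 c)" and "q = fb m (t0 + real j * \<omega>) (fb j t0 d)"
    have "dist p (fb m t x) < e / 2" "dist q (fb m t y) < e / 2"
      using h(2) j fb_circle cdc Kc_circle[OF x] y(1) unfolding p_def q_def by blast+
    moreover have "dist p q \<ge> \<delta>" unfolding p_def q_def
      using base[of "m + j"] fb_add[OF cdc(1), of m j t0] fb_add[OF cdc(2), of m j t0] by simp
    moreover have "dist p q \<le> dist p (fb m t x) + (dist (fb m t x) (fb m t y) + dist q (fb m t y))"
      using dist_triangle[of p q "fb m t x"] dist_triangle[of "fb m t x" q "fb m t y"] by (simp add: dist_commute)
    ultimately show "\<delta> \<le> dist (fb m t x) (fb m t y) + e" by linarith
  qed
  then show ?thesis using x yK unfolding paired_def by blast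
qed

text \<open>
  The window \<open>Q\<close> is a small arc around \<open>d\<close>. Over base points near \<open>t0\<close>, each pair has exactly one point
  in \<open>Q\<close>. If the image of \<open>a\<close> were between two points of \<open>K\<close> in \<open>Q\<close>, these would have a common partner
  off \<open>Q\<close> by \<open>paired_star\<close>. Pulling back by the monotone fibre map, \<open>a\<close> and the partner \<open>y\<close> would
  separate two points of \<open>K\<close> on the circle, both in the window or both off it according to the position
  of \<open>y\<close>; but \<open>a\<close> is an end point of the window.
\<close>
lemma unbounded_rho_bounded:
  assumes good: "good t0" and sp: "spread \<delta>" and unb: "\<not> bounded_cocycle"
  shows "bdd_above {\<bar>snd ((F ^^ n) (\<theta>, x)) - x - real n * fibred_rotation_number F\<bar> | n \<theta> x. \<theta> \<in> circle}"
proof -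
  have \<delta>: "\<delta> > 0" using sp by (simp add: spread_def)
  obtain c d where cd: "Kc t0 = {c, d}" "dist c d \<ge> \<delta>" "c \<noteq> d" using unbounded_fibre_two[OF good sp unb] by blast
  obtain k where k: "d = circ k" using circ_surj Kc_circle[of d t0] cd by blast
  obtain k' where k': "k < k'" "k' < k + 1" "c = circ k'" using lift_in_period[of c k] Kc_circle[of c t0] cd k by blast
  define \<tau> where "\<tau> = min (min (k' - k) (k + 1 - k')) (\<delta> / 64) / 2"
  have \<tau>: "\<tau> > 0" "\<tau> < k' - k" "\<tau> < k + 1 - k'" "\<tau> < \<delta> / 64" using k' \<delta> by (auto simp: \<tau>_def min_def)
  define a b where "a = k - \<tau>" and "b = k + \<tau>"
  have ab: "a < k" "k < b" "k' - 1 < a" "b < k'" "b - a < \<delta> / 32" "b < a + 1" using \<tau> k' by (auto simp: a_def b_def)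
  have nK: "circ a \<notin> Kc t0"
  proof
    assume "circ a \<in> Kc t0"
    then have "circ a = circ k' \<or> circ a = circ k" using cd k k' by auto
    then have "circ a = circ (k' - 1) \<or> circ a = circ k" by simp
    then show False using circ_inj_short[of a "k' - 1"] circ_inj_short[of a k] ab k' by auto
  qed
  define Q where "Q = circ ` {a..b}"
  have Q_short: "dist z w < \<delta>" if zw: "z \<in> Q" "w \<in> Q" for z w
  proof -
    obtain x y where "z = circ x" "w = circ y" "x \<in> {a..b}" "y \<in> {a..b}" using zw unfolding Q_def by blast
    moreover from this have "\<bar>x - y\<bar> \<le> b - a" by auto
    moreover have "8 * (b - a) < \<delta>" using ab(5) \<delta> by simp
    ultimately show ?thesis using dist_circ_le8[of x y] by simp
  qed
  obtain \<eta> d1 where d1: "\<eta> > 0" "d1 > 0" "\<forall>t. dist (circ t) (circ t0) < d1 \<longrightarrow> (\<forall>x\<in>Kc t. dist (circ a) x \<ge> \<eta>)"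
    using gap_uniform[OF nK] by blast
  have "\<exists>x. a < x \<and> x < b \<and> circ x \<in> Kc t0" using ab cd k by blast
  then obtain d2 where d2: "d2 > 0" "\<forall>s. dist (circ s) (circ t0) < d2 \<longrightarrow> (\<exists>x. a < x \<and> x < b \<and> circ x \<in> Kc s)"
    using good less_trans[OF ab(1,2)] unfolding good_def by blast
  obtain \<nu> where nu: "\<nu> > 0" "\<forall>z x. z \<in> circle \<longrightarrow> dist z (circ x) < \<nu> \<longrightarrow> (\<exists>y. z = circ y \<and> \<bar>y - x\<bar> < \<tau>)"
    using circ_close_lift[OF \<tau>(1)] by blast
  have "min \<nu> (\<delta> / 2) > 0" using nu \<delta> by simp
  then obtain d3 where d3: "d3 > 0" "\<forall>s. dist (circ s) (circ t0) < d3 \<longrightarrow> (\<forall>z\<in>Kc s. \<exists>w\<in>Kc t0. dist z w < min \<nu> (\<delta> / 2))"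
    using K_upper_semicontinuous by blast
  define e where "e = min d1 (min d2 d3)"
  have e: "e > 0" "e \<le> d1" "e \<le> d2" "e \<le> d3" using d1 d2 d3 by (auto simp: e_def)
  have offQ: "dist z c < \<delta> / 2" if z: "dist (circ t) (circ t0) < e" "z \<in> Kc t" "z \<notin> Q" for t z
  proof -
    obtain w where w: "w \<in> Kc t0" "dist z w < min \<nu> (\<delta> / 2)" using d3(2) z e by (meson less_le_trans)
    have "w \<noteq> d"
    proof
      assume "w = d"
      then obtain y where "z = circ y" "\<bar>y - k\<bar> < \<tau>" using nu(2) w(2) k Kc_circle[OF z(2)] by (metis min_less_iff_conj)
      then have "z \<in> Q" unfolding Q_def a_def b_def by (intro image_eqI[of _ _ y]) (auto simp: abs_less_iff)
      then show False using z by blast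
    qed
    then show ?thesis using w cd by auto
  qed
  have notboth: "\<not> (z \<in> Q \<and> w \<in> Q)" if "paired \<delta> t z w" for t z w
    using paired_dist[OF that] Q_short by force
  have oneof: "z \<in> Q \<or> w \<in> Q" if t: "dist (circ t) (circ t0) < e" and p: "paired \<delta> t z w" for t z w
  proof (rule ccontr)
    assume "\<not> ?thesis"
    then have "dist z c < \<delta> / 2" "dist w c < \<delta> / 2" using offQ[OF t] p unfolding paired_def by blast+
    then show False using paired_dist[OF p] by metric
  qed
  show ?thesis
  proof (rule barrier[OF e(1)])
    show "b \<le> a + 1" using ab by simp
    show "\<exists>x. a \<le> x \<and> x \<le> b \<and> circ x \<in> Kc t" if "dist (circ t) (circ t0) < e" for t
      using d2(2) that e(3) by (meson less_imp_le less_le_trans)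
    show "circ a \<notin> Kc t" if "dist (circ t) (circ t0) < e" for t
      using d1 that e(2) by (metis dist_self less_le_trans not_less)
    fix t n j x x'
    assume t: "dist (circ t) (circ t0) < e" "dist (circ (t + real n * \<omega>)) (circ t0) < e"
      and x: "a + of_int j \<le> x" "x < \<Phi> n t a" "\<Phi> n t a < x'" "x' \<le> b + of_int j"
      and xK: "circ x \<in> Kc (t + n * \<omega>)" "circ x' \<in> Kc (t + n * \<omega>)"
    obtain \<xi> where \<xi>: "\<Phi> n t \<xi> = x" using \<Phi>_surj by blast
    obtain \<xi>' where \<xi>': "\<Phi> n t \<xi>' = x'" using \<Phi>_surj by blast
    have l1: "\<xi> < a" "a < \<xi>'" using x \<xi> \<xi>' by (metis \<Phi>_less_iff)+
    have K1: "circ \<xi> \<in> Kc t" "circ \<xi>' \<in> Kc t" using xK \<Phi>_Kc \<xi> \<xi>' by metis+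
    obtain y where y: "paired \<delta> t (circ \<xi>) y" using partner_exists[OF sp cd(1) K1(1)] by blast
    obtain y' where y': "paired \<delta> t (circ \<xi>') y'" using partner_exists[OF sp cd(1) K1(2)] by blast
    have fx: "fb n t (circ \<xi>) = circ x" "fb n t (circ \<xi>') = circ x'" using \<xi> \<xi>' circ_\<Phi> by metis+
    have f1: "paired \<delta> (t + real n * \<omega>) (circ x) (fb n t y)" using paired_forward[OF y, of n] fx by simp
    have f2: "paired \<delta> (t + real n * \<omega>) (circ x') (fb n t y')" using paired_forward[OF y', of n] fx by simp
    have "x - of_int j \<in> {a..b}" "x' - of_int j \<in> {a..b}" using x by auto
    then have "circ (x - of_int j) \<in> Q" "circ (x' - of_int j) \<in> Q" unfolding Q_def by blast+
    then have xQ: "circ x \<in> Q" "circ x' \<in> Q" by simp_all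
    have yQ: "fb n t y \<notin> Q" "fb n t y' \<notin> Q" using notboth f1 f2 xQ by blast+
    have "\<bar>x - x'\<bar> < 1" using x ab by (simp add: abs_if)
    then have "circ x \<noteq> circ x'" using circ_inj_short[of x x'] x by linarith
    then have "circ \<xi> \<noteq> circ \<xi>'" using fx by metis
    moreover have "circ \<xi> \<noteq> y'" using fx xQ yQ by metis
    moreover have "y \<noteq> circ \<xi>'" using fx xQ yQ by metis
    ultimately have yy: "y' = y" using paired_star[OF y y' \<delta> unb] by metis
    have yc: "y \<in> circle" using y Kc_circle unfolding paired_def by blast
    have "fb n t y \<noteq> circ (a + of_int j)" using yQ(1) ab unfolding Q_def by auto
    then obtain w where w: "a + of_int j < w" "w < a + of_int j + 1" "fb n t y = circ w"
      using lift_in_period[OF fb_circle[OF yc]] by blast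
    have wb: "b + of_int j < w"
    proof (rule ccontr)
      assume "\<not> ?thesis"
      then have "w - of_int j \<in> {a..b}" using w by auto
      then have "circ (w - of_int j) \<in> Q" unfolding Q_def by (rule imageI)
      then show False using yQ w by simp
    qed
    obtain \<zeta> where \<zeta>: "\<Phi> n t \<zeta> = w" using \<Phi>_surj by blast
    have "fb n t (circ \<zeta>) = fb n t y" using \<zeta> w(3) circ_\<Phi> by metis
    then have y\<zeta>: "y = circ \<zeta>" using fb_inj yc circ_in_circle by metis
    have "\<Phi> n t \<xi>' < \<Phi> n t \<zeta>" using \<xi>' \<zeta> wb x(4) by linarith
    then have l2: "\<xi>' < \<zeta>" by simp
    have "\<Phi> n t (\<zeta> + of_int (-1)) = w - 1" using \<Phi>_int[of n t \<zeta> "-1"] \<zeta> by simp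
    then have "\<Phi> n t (\<zeta> + of_int (-1)) < \<Phi> n t \<xi>" using \<xi> x(1) w(2) by linarith
    then have l3: "\<zeta> - 1 < \<xi>" by simp
    show False
    proof (cases "y \<in> Q")
      case True
      then obtain u where u: "u \<in> {a..b}" "circ \<zeta> = circ u" unfolding Q_def y\<zeta> by blast
      have "\<zeta> = u" by (rule circ_inj_short[OF u(2)]) (use u(1) l1 l2 l3 ab in \<open>auto simp: abs_if\<close>)
      then have "\<xi>' \<in> {a..b}" using u l1 l2 by auto
      then have "circ \<xi>' \<in> Q" unfolding Q_def by (rule imageI)
      then show False using notboth[OF y'] True yy by blast
    next
      case False
      then have "circ \<xi> \<in> Q" using oneof[OF t(1) y] by blast
      then obtain u where u: "u \<in> {a..b}" "circ \<xi> = circ u" unfolding Q_def by blast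
      then have "circ (\<xi> + 1) = circ u" by simp
      then have "\<xi> + 1 = u" by (rule circ_inj_short) (use u(1) l1 l2 l3 ab in \<open>auto simp: abs_if\<close>)
      then have "\<zeta> \<in> {a..b}" using u l1 l2 l3 by auto
      then have "circ \<zeta> \<in> Q" unfolding Q_def by (rule imageI)
      then show False using False y\<zeta> by blast
    qed
  qed
qed

section \<open>The bounded case\<close>

text \<open>
  Choose a gap to the right of some point \<open>x0\<close> of the fibre. All its images have length at least \<open>l\<close>,
  the images of \<open>x0\<close> accumulate at each point \<open>x\<close> of the fibre, and by lower semicontinuity at \<open>t0\<close> the
  gaps that they leave persist in the limit.
\<close>
lemma bounded_right_gap:
  assumes good: "good t0" and k: "\<kappa> > 0" "\<And>n t. co_lipschitz \<kappa> (fb n t)"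
  shows "\<exists>l>0. \<forall>x y. circ x \<in> Kc t0 \<longrightarrow> x < y \<longrightarrow> y < x + l \<longrightarrow> circ y \<notin> Kc t0"
proof -
  define S where "S = {x. circ x \<in> Kc t0}"
  have clS: "closed S"
  proof -
    have "closed (circ -` Kc t0)" by (intro closed_vimage compact_imp_closed compact_Kc continuous_intros)
    then show ?thesis by (simp add: S_def vimage_def)
  qed
  obtain u where u: "u \<notin> S" using good unfolding good_def S_def by (metis mem_Collect_eq zero_less_one)
  obtain z where z: "z \<in> Kc t0" using Kc_nonempty by blast
  then have "z \<noteq> circ (u - 1)" using u by (auto simp: S_def)
  then obtain v where v: "u - 1 < v" "v < u - 1 + 1" "z = circ v" using lift_in_period[OF Kc_circle[OF z]] by blast
  define x0 where "x0 = Sup (S \<inter> {..u})"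
  have ne: "S \<inter> {..u} \<noteq> {}" "bdd_above (S \<inter> {..u})" using v z by (auto simp: S_def)
  have "x0 \<in> S \<inter> {..u}" unfolding x0_def by (intro closed_contains_Sup ne closed_Int clS closed_atMost)
  then have x0: "x0 \<in> S" "x0 < u" using u by (auto simp: less_le)
  have gap: "y \<notin> S" if "x0 < y" "y \<le> u" for y
    using cSup_upper[OF _ ne(2), of y] that unfolding x0_def by auto
  define l0 where "l0 = min (u - x0) (1 / 2)"
  have l0: "l0 > 0" "l0 < 1" "x0 + l0 \<le> u" using x0 by (auto simp: l0_def)
  define c where "c = dist (circ x0) (circ (x0 + l0))"
  have "circ x0 \<noteq> circ (x0 + l0)" using circ_inj_short[of x0 "x0 + l0"] l0 by auto
  then have c: "c > 0" by (simp add: c_def)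
  define l where "l = \<kappa> * c / 8"
  have l: "l > 0" using k c by (simp add: l_def)
  have long: "\<Phi> n t0 x0 + l \<le> \<Phi> n t0 (x0 + l0)" for n
  proof -
    have "\<kappa> * c \<le> dist (fb n t0 (circ x0)) (fb n t0 (circ (x0 + l0)))"
      using k(2)[of n t0] unfolding co_lipschitz_def c_def by simp
    also have "\<dots> = dist (circ (\<Phi> n t0 x0)) (circ (\<Phi> n t0 (x0 + l0)))" by (simp add: circ_\<Phi>)
    also have "\<dots> \<le> 8 * \<bar>\<Phi> n t0 x0 - \<Phi> n t0 (x0 + l0)\<bar>" by (rule dist_circ_le8)
    also have "\<dots> = 8 * (\<Phi> n t0 (x0 + l0) - \<Phi> n t0 x0)" using l0 \<Phi>_less_iff[of n t0 x0 "x0 + l0"] by (simp del: \<Phi>_less_iff)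
    finally show ?thesis by (simp add: l_def)
  qed
  have "circ y \<notin> Kc t0" if x: "circ x \<in> Kc t0" and y: "x < y" "y < x + l" for x y
  proof
    assume yK: "circ y \<in> Kc t0"
    define e where "e = min (y - x) (x + l - y) / 2"
    have e: "e > 0" "2 * e \<le> y - x" "2 * e \<le> x + l - y" using y by (auto simp: e_def min_def)
    have "y - e < y + e" "\<exists>v. y - e < v \<and> v < y + e \<and> circ v \<in> Kc t0" using e(1) yK by (auto intro!: exI[of _ y])
    then obtain d where d: "d > 0" "\<forall>s. dist (circ s) (circ t0) < d \<longrightarrow> (\<exists>v. y - e < v \<and> v < y + e \<and> circ v \<in> Kc s)"
      using good unfolding good_def by blast
    obtain \<nu> where nu: "\<nu> > 0" "\<forall>z x. z \<in> circle \<longrightarrow> dist z (circ x) < \<nu> \<longrightarrow> (\<exists>y. z = circ y \<and> \<bar>y - x\<bar> < e)"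
      using circ_close_lift[OF e(1)] by blast
    have x0K: "circ x0 \<in> Kc t0" using x0 by (simp add: S_def)
    have "min d \<nu> > 0" using d nu by simp
    then obtain n where n: "dist (circ (t0 + real n * \<omega>)) (circ t0) < min d \<nu>" "dist (fb n t0 (circ x0)) (circ x) < min d \<nu>"
      using visits[OF x0K x] by blast
    have "fb n t0 (circ x0) \<in> circle" by (rule fb_circle) simp
    then obtain w where w: "fb n t0 (circ x0) = circ w" "\<bar>w - x\<bar> < e" using nu(2) n(2) by (metis min_less_iff_conj)
    then have "circ (\<Phi> n t0 x0) = circ w" by (simp add: circ_\<Phi>)
    then obtain i :: int where i: "\<Phi> n t0 x0 - w = of_int i" by (auto simp: circ_eq_iff elim: Ints_cases)
    obtain v where v: "y - e < v" "v < y + e" "circ v \<in> Kc (t0 + real n * \<omega>)" using d(2) n(1) by (metis min_less_iff_conj)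
    have wv: "w < v" "v < w + l" using w(2) v e by (auto simp: abs_less_iff)
    obtain \<xi> where \<xi>: "\<Phi> n t0 \<xi> = v + of_int i" using \<Phi>_surj by blast
    have "circ (\<Phi> n t0 \<xi>) \<in> Kc (t0 + n * \<omega>)" using \<xi> v(3) by simp
    then have "\<xi> \<in> S" using \<Phi>_Kc by (simp add: S_def)
    moreover have "\<Phi> n t0 x0 < \<Phi> n t0 \<xi>" "\<Phi> n t0 \<xi> < \<Phi> n t0 (x0 + l0)" using \<xi> i wv long[of n] by linarith+
    then have "x0 < \<xi>" "\<xi> < x0 + l0" by simp_all
    ultimately show False using gap l0(3) by (meson less_imp_le order_trans)
  qed
  then show ?thesis using l by blast
qed

text \<open>Two points of any fibre are moved near the good fibre by an iterate, at the cost of a bounded factor.\<close>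
lemma bounded_separated:
  assumes bounded_cocycle
  shows "\<exists>\<sigma>>0. \<forall>t. \<forall>x\<in>Kc t. \<forall>y\<in>Kc t. x \<noteq> y \<longrightarrow> dist x y \<ge> \<sigma>"
proof -
  obtain \<kappa> where k: "\<kappa> > 0" "\<And>n t. co_lipschitz \<kappa> (fb n t)" using assms unfolding bounded_cocycle_def by blast
  obtain t0 where good: "good t0" using ex_good by blast
  obtain l where l: "l > 0" "\<forall>x y. circ x \<in> Kc t0 \<longrightarrow> x < y \<longrightarrow> y < x + l \<longrightarrow> circ y \<notin> Kc t0"
    using bounded_right_gap[OF good k] by blast
  define l' where "l' = min l (1 / 2)"
  have l': "l' > 0" "l' \<le> l" "l' \<le> 1 / 2" using l by (auto simp: l'_def)
  obtain \<sigma> where s: "\<sigma> > 0" "\<forall>z x. z \<in> circle \<longrightarrow> dist z (circ x) < \<sigma> \<longrightarrow> (\<exists>y. z = circ y \<and> \<bar>y - x\<bar> < l')"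
    using circ_close_lift[OF l'(1)] by blast
  have base: "dist z w \<ge> \<sigma>" if zw: "z \<in> Kc t0" "w \<in> Kc t0" "z \<noteq> w" for z w
  proof (rule ccontr)
    assume "\<not> ?thesis"
    obtain x where x: "w = circ x" using circ_surj Kc_circle zw by blast
    then obtain y where y: "z = circ y" "\<bar>y - x\<bar> < l'" using s(2) \<open>\<not> dist z w \<ge> \<sigma>\<close> Kc_circle zw by (metis not_le)
    have "x \<noteq> y" using x y zw by blast
    moreover have "y < x + l" "x < y + l" using y(2) l'(2) by (auto simp: abs_less_iff)
    ultimately show False using l(2) x y(1) zw by (metis linorder_neqE_linordered_idom)
  qed
  have "dist x y \<ge> \<kappa> * \<sigma> / 4" if xy: "x \<in> Kc t" "y \<in> Kc t" "x \<noteq> y" for t x y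
  proof -
    define e where "e = min (\<kappa> * dist x y / 4) (\<sigma> / 4)"
    have e: "e > 0" "e \<le> \<kappa> * dist x y / 4" "e \<le> \<sigma> / 4" using k s xy by (auto simp: e_def)
    obtain d where d: "d > 0" "\<forall>s. dist (circ s) (circ t0) < d \<longrightarrow> (\<forall>z\<in>Kc s. \<exists>w\<in>Kc t0. dist z w < e)"
      using K_upper_semicontinuous[OF e(1)] by blast
    obtain n where n: "dist (circ (t + real n * \<omega>)) (circ t0) < d" using rotation_dense_circ[OF d(1)] by blast
    have xyc: "x \<in> circle" "y \<in> circle" using xy Kc_circle by blast+
    have "fb n t x \<in> Kc (t + real n * \<omega>)" "fb n t y \<in> Kc (t + real n * \<omega>)" using fb_Kc xyc xy by blast+
    then obtain w w' where w: "w \<in> Kc t0" "w' \<in> Kc t0" "dist (fb n t x) w < e" "dist (fb n t y) w' < e" using d(2) n by meson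
    have low: "\<kappa> * dist x y \<le> dist (fb n t x) (fb n t y)" using k(2) xyc unfolding co_lipschitz_def by blast
    have up: "dist (fb n t x) (fb n t y) \<le> 2 / \<kappa> * dist x y" by (rule circle_mobius_lipschitz[OF fb_mobius k(2) k(1) xyc])
    have pos: "\<kappa> * dist x y > 0" using k xy by simp
    have "w \<noteq> w'"
    proof
      assume "w = w'"
      then have "dist (fb n t x) (fb n t y) < 2 * e" using w by metric
      then show False using low e pos by linarith
    qed
    then have "\<sigma> \<le> dist w w'" using base w by blast
    also have "\<dots> \<le> dist (fb n t x) (fb n t y) + 2 * e" using w by metric
    finally have "\<sigma> / 2 \<le> 2 / \<kappa> * dist x y" using up e by linarith
    then show ?thesis using k(1) by (simp add: field_simps)
  qed
  moreover have "\<kappa> * \<sigma> / 4 > 0" using k s by simp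
  ultimately show ?thesis by blast
qed

lemma bounded_rho_bounded:
  assumes bounded_cocycle
  shows "bdd_above {\<bar>snd ((F ^^ n) (\<theta>, x)) - x - real n * fibred_rotation_number F\<bar> | n \<theta> x. \<theta> \<in> circle}"
proof -
  obtain \<sigma> where s: "\<sigma> > 0" "\<And>t x y. x \<in> Kc t \<Longrightarrow> y \<in> Kc t \<Longrightarrow> x \<noteq> y \<Longrightarrow> dist x y \<ge> \<sigma>" using bounded_separated[OF assms] by blast
  obtain t0 where good: "good t0" using ex_good by blast
  obtain z where z: "z \<in> Kc t0" using Kc_nonempty by blast
  obtain k where k: "z = circ k" using circ_surj Kc_circle[OF z] by blast
  define \<tau> where "\<tau> = min (\<sigma> / 32) (1 / 4)"
  have \<tau>: "\<tau> > 0" "\<tau> \<le> \<sigma> / 32" "\<tau> \<le> 1 / 4" using s by (auto simp: \<tau>_def)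
  have same: "x = y" if "circ x \<in> Kc t" "circ y \<in> Kc t" "\<bar>x - y\<bar> \<le> 2 * \<tau>" for x y t
  proof (rule circ_inj_short)
    show "circ x = circ y"
    proof (rule ccontr)
      assume "circ x \<noteq> circ y"
      then have "\<sigma> \<le> dist (circ x) (circ y)" using s(2) that by blast
      also have "\<dots> \<le> 8 * \<bar>x - y\<bar>" by (rule dist_circ_le8)
      finally have "\<sigma> \<le> 8 * \<bar>x - y\<bar>" .
      moreover have "8 * \<bar>x - y\<bar> \<le> 16 * \<tau>" using that(3) by simp
      moreover have "16 * \<tau> \<le> \<sigma> / 2" using \<tau>(2) by simp
      ultimately show False using s(1) by linarith
    qed
    show "\<bar>x - y\<bar> < 1" using that(3) \<tau> by linarith
  qed
  have nK: "circ (k - \<tau>) \<notin> Kc t0" using same[of "k - \<tau>" t0 k] z k \<tau> by auto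
  obtain \<eta> d1 where d1: "\<eta> > 0" "d1 > 0" "\<forall>t. dist (circ t) (circ t0) < d1 \<longrightarrow> (\<forall>x\<in>Kc t. dist (circ (k - \<tau>)) x \<ge> \<eta>)"
    using gap_uniform[OF nK] by blast
  have "k - \<tau> < k + \<tau>" "\<exists>x. k - \<tau> < x \<and> x < k + \<tau> \<and> circ x \<in> Kc t0" using \<tau> z k by (auto intro!: exI[of _ k])
  then obtain d2 where d2: "d2 > 0" "\<forall>s. dist (circ s) (circ t0) < d2 \<longrightarrow> (\<exists>x. k - \<tau> < x \<and> x < k + \<tau> \<and> circ x \<in> Kc s)"
    using good unfolding good_def by blast
  define e where "e = min d1 d2"
  have e: "e > 0" "e \<le> d1" "e \<le> d2" using d1 d2 by (auto simp: e_def)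
  show ?thesis
  proof (rule barrier[OF e(1)])
    show "k + \<tau> \<le> k - \<tau> + 1" using \<tau> by simp
    show "\<exists>x. k - \<tau> \<le> x \<and> x \<le> k + \<tau> \<and> circ x \<in> Kc t" if "dist (circ t) (circ t0) < e" for t
      using d2(2) that e(3) by (meson less_imp_le less_le_trans)
    show "circ (k - \<tau>) \<notin> Kc t" if "dist (circ t) (circ t0) < e" for t
      using d1 that e(2) by (metis dist_self less_le_trans not_less)
    fix t n j x x'
    assume x: "k - \<tau> + of_int j \<le> x" "x < \<Phi> n t (k - \<tau>)" "\<Phi> n t (k - \<tau>) < x'" "x' \<le> k + \<tau> + of_int j"
      and xK: "circ x \<in> Kc (t + n * \<omega>)" "circ x' \<in> Kc (t + n * \<omega>)"
    have "\<bar>x - x'\<bar> \<le> 2 * \<tau>" using x by (simp add: abs_if)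
    then have "x = x'" using same xK by blast
    then show False using x by simp
  qed
qed

end

lemma locally_connected_circle: "locally connected circle"
proof -
  have "locally connected (rel_frontier (cball (0::complex) 1))"
    by (rule locally_connected_sphere_gen) auto
  then show ?thesis by (simp add: rel_frontier_cball)
qed

context minimal_cocycle
begin

text \<open>Nearby fibres are mapped injectively by sending each point to a nearest point of the fibre over \<open>circ t\<close>.\<close>
lemma separated_card_usc:
  assumes L: "compact L" "L \<subseteq> K" and s: "\<sigma> > 0" "\<forall>t. \<forall>x\<in>Kc t. \<forall>y\<in>Kc t. x \<noteq> y \<longrightarrow> dist x y \<ge> \<sigma>"
    and fin: "\<forall>t. finite (Kc t)"
  shows "\<exists>d>0. \<forall>s. dist (circ s) (circ t) < d \<longrightarrow> card {z. (circ s, z) \<in> L} \<le> card {z. (circ t, z) \<in> L}"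
proof -
  have "\<sigma> / 2 > 0" using s by simp
  then obtain d where d: "d > 0" "\<forall>s. dist (circ s) (circ t) < d \<longrightarrow> (\<forall>z. (circ s, z) \<in> L \<longrightarrow> (\<exists>w. (circ t, w) \<in> L \<and> dist z w < \<sigma> / 2))"
    using fibre_upper_semicontinuous[OF L(1), of "\<sigma> / 2" t] by blast
  have sub: "{z. (circ u, z) \<in> L} \<subseteq> Kc u" for u using L(2) by (auto simp: Kc_def)
  have "card {z. (circ s, z) \<in> L} \<le> card {z. (circ t, z) \<in> L}" if near: "dist (circ s) (circ t) < d" for s
  proof -
    obtain h where h: "\<And>z. (circ s, z) \<in> L \<Longrightarrow> (circ t, h z) \<in> L \<and> dist z (h z) < \<sigma> / 2" using d(2) near by metis
    show ?thesis
    proof (rule card_inj_on_le[of h])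
      show "inj_on h {z. (circ s, z) \<in> L}"
      proof (rule inj_onI, rule ccontr)
        fix z w assume zw: "z \<in> {z. (circ s, z) \<in> L}" "w \<in> {z. (circ s, z) \<in> L}" "h z = h w" "z \<noteq> w"
        have "dist z (h z) < \<sigma> / 2" using h zw(1) by blast
        moreover have "dist w (h z) < \<sigma> / 2" using h[of w] zw(2,3) by simp
        ultimately have "dist z w < \<sigma>" by (rule dist_triangle_half_l)
        moreover have "dist z w \<ge> \<sigma>" using s(2) zw sub by blast
        ultimately show False by simp
      qed
      show "h ` {z. (circ s, z) \<in> L} \<subseteq> {z. (circ t, z) \<in> L}" using h by blast
      show "finite {z. (circ t, z) \<in> L}" using sub fin finite_subset by blast
    qed
  qed
  then show ?thesis using d(1) by blast
qed

lemma card_fibre_mono: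
  assumes "\<And>x. x \<in> A \<Longrightarrow> x \<in> circle" "\<And>x. x \<in> A \<Longrightarrow> fb n t x \<in> B" "finite B"
  shows "card A \<le> card B"
  by (rule card_inj_on_le[of "fb n t"]) (use assms fb_inj in \<open>auto intro!: inj_onI\<close>)

end

context lifted_minimal
begin

text \<open>
  The number of points of a fibre is upper semicontinuous and does not decrease along orbits; as orbits
  are dense, it is constant. Hence over a small arc around \<open>\<theta>\<close> there is exactly one point of \<open>K\<close> near
  each point of the fibre over \<open>\<theta>\<close>.
\<close>
lemma bounded_covering:
  assumes bounded_cocycle
  shows "covering_space K fst circle" "\<exists>k. \<forall>t. finite (Kc t) \<and> card (Kc t) = k"
    "\<exists>\<sigma>>0. \<forall>t. \<forall>x\<in>Kc t. \<forall>y\<in>Kc t. x \<noteq> y \<longrightarrow> dist x y \<ge> \<sigma>"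
proof -
  obtain \<sigma> where s: "\<sigma> > 0" "\<forall>t. \<forall>x\<in>Kc t. \<forall>y\<in>Kc t. x \<noteq> y \<longrightarrow> dist x y \<ge> \<sigma>" using bounded_separated[OF assms] by blast
  then show "\<exists>\<sigma>>0. \<forall>t. \<forall>x\<in>Kc t. \<forall>y\<in>Kc t. x \<noteq> y \<longrightarrow> dist x y \<ge> \<sigma>" by blast
  have fin: "finite (Kc t)" for t
  proof (rule ccontr)
    assume "infinite (Kc t)"
    then obtain x where x: "x islimpt Kc t" using compact_Kc[of t] by (meson compact_eq_Bolzano_Weierstrass subset_refl)
    have "\<sigma> / 2 > 0" using s by simp
    then obtain y where y: "y \<in> Kc t" "y \<noteq> x" "dist y x < \<sigma> / 2" using x by (meson islimpt_approachable)
    have "min (\<sigma> / 2) (dist y x) > 0" using s y by simp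
    then obtain z where z: "z \<in> Kc t" "z \<noteq> x" "dist z x < min (\<sigma> / 2) (dist y x)" using x by (meson islimpt_approachable)
    have "z \<noteq> y" using z by auto
    then have "\<sigma> \<le> dist z y" using s z y by blast
    moreover have "dist z x < \<sigma> / 2" using z by simp
    ultimately show False using y(3) by metric
  qed
  define t1 where "t1 = (0::real)"
  have le: "card (Kc a) \<le> card (Kc b)" for a b
  proof -
    obtain d where d: "d > 0" "\<forall>s. dist (circ s) (circ b) < d \<longrightarrow> card (Kc s) \<le> card (Kc b)"
      using separated_card_usc[OF K_props(3) subset_refl s, of b] fin unfolding Kc_def by blast
    obtain n where n: "dist (circ (a + real n * \<omega>)) (circ b) < d" using rotation_dense_circ[OF d(1)] by blast
    have "card (Kc a) \<le> card (Kc (a + real n * \<omega>))"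
      by (rule card_fibre_mono[of _ n a]) (use Kc_circle fb_Kc fin in auto)
    also have "\<dots> \<le> card (Kc b)" using d n by blast
    finally show ?thesis .
  qed
  define k where "k = card (Kc t1)"
  have k: "card (Kc t) = k" for t unfolding k_def using le[of t t1] le[of t1 t] by simp
  then show "\<exists>k. \<forall>t. finite (Kc t) \<and> card (Kc t) = k" using fin by blast
  have cont: "continuous_on K fst" by (intro continuous_intros)
  show "covering_space K fst circle"
  proof
    show "continuous_on K fst" by (rule cont)
    show "fst ` K = circle"
    proof
      show "fst ` K \<subseteq> circle" using K_props(2) by auto
      show "circle \<subseteq> fst ` K"
      proof
        fix \<theta> assume "\<theta> \<in> (circle :: complex set)"
        then obtain t where t: "\<theta> = circ t" using circ_surj by blast
        obtain z where "z \<in> Kc t" using Kc_nonempty by blast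
        then show "\<theta> \<in> fst ` K" by (force simp: Kc_def t)
      qed
    qed
    fix \<theta> assume "\<theta> \<in> (circle :: complex set)"
    then obtain t where t: "\<theta> = circ t" using circ_surj by blast
    define r where "r = \<sigma> / 4"
    have r: "r > 0" using s by (simp add: r_def)
    obtain d where d: "d > 0" "\<forall>s. dist (circ s) (circ t) < d \<longrightarrow> (\<forall>z\<in>Kc s. \<exists>w\<in>Kc t. dist z w < r)"
      using K_upper_semicontinuous[OF r] by blast
    have uniq: "z = z'" if "z \<in> Kc s" "z' \<in> Kc s" "dist z w \<le> r" "dist z' w \<le> r" for s z z' w
    proof (rule ccontr)
      assume "z \<noteq> z'"
      then have "\<sigma> \<le> dist z z'" using that s(2) by blast
      moreover have "dist z z' \<le> 2 * r" using that by metric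
      ultimately show False using s(1) by (simp add: r_def)
    qed
    have uniq': "w = w'" if "w \<in> Kc t" "w' \<in> Kc t" "dist z w \<le> r" "dist z w' \<le> r" for w w' z
      using uniq[of w t w' z] that by (simp add: dist_commute)
    have ex: "\<exists>z\<in>Kc s. dist z w < r" if near: "dist (circ s) (circ t) < d" and w: "w \<in> Kc t" for s w
    proof -
      obtain h where h: "\<And>z. z \<in> Kc s \<Longrightarrow> h z \<in> Kc t \<and> dist z (h z) < r" using d(2) near by metis
      have "inj_on h (Kc s)"
      proof (rule inj_onI)
        fix x y assume "x \<in> Kc s" "y \<in> Kc s" "h x = h y"
        then show "x = y" using uniq[of x s y "h x"] h by (metis less_imp_le)
      qed
      then have "card (h ` Kc s) = card (Kc t)" using k by (simp add: card_image)
      then have "h ` Kc s = Kc t" using h fin by (intro card_subset_eq) auto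
      then obtain z where "z \<in> Kc s" "w = h z" using w by blast
      then show ?thesis using h by blast
    qed
    define T where "T = circle \<inter> ball \<theta> (d / 2)"
    define T' where "T' = circle \<inter> cball \<theta> (d / 2)"
    define U where "U w = K \<inter> (ball \<theta> (d / 2) \<times> ball w r)" for w
    define U' where "U' w = K \<inter> (cball \<theta> (d / 2) \<times> cball w r)" for w
    define V where "V = U ` Kc t"
    have home: "\<exists>q. homeomorphism (U w) T fst q" if w: "w \<in> Kc t" for w
    proof -
      have cU: "compact (U' w)" unfolding U'_def by (intro compact_Int_closed K_props closed_Times closed_cball)
      have cf: "continuous_on (U' w) fst" by (intro continuous_intros)
      have im: "fst ` U' w = T'"
      proof
        show "fst ` U' w \<subseteq> T'" using K_props(2) by (auto simp: U'_def T'_def)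
        show "T' \<subseteq> fst ` U' w"
        proof
          fix \<phi> assume p: "\<phi> \<in> T'"
          then obtain s where s: "\<phi> = circ s" using circ_surj by (auto simp: T'_def)
          have "dist (circ s) (circ t) \<le> d / 2" using p by (auto simp: T'_def s t dist_commute)
          then have "dist (circ s) (circ t) < d" using d(1) by linarith
          then obtain z where z: "z \<in> Kc s" "dist z w < r" using ex w by blast
          then have "(\<phi>, z) \<in> U' w" using p by (auto simp: U'_def T'_def Kc_def s dist_commute)
          then show "\<phi> \<in> fst ` U' w" by force
        qed
      qed
      have inj: "inj_on fst (U' w)"
      proof (rule inj_onI)
        fix p p' assume p: "p \<in> U' w" "p' \<in> U' w" "fst p = fst p'"
        obtain \<phi> z z' where e: "p = (\<phi>, z)" "p' = (\<phi>, z')" using p(3) by (metis prod.collapse)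
        obtain s where s: "\<phi> = circ s" using p(1) circ_surj K_props(2) unfolding U'_def e by blast
        have "z = z'" by (rule uniq[of z s z' w]) (use p in \<open>auto simp: U'_def e s Kc_def dist_commute\<close>)
        then show "p = p'" by (simp add: e)
      qed
      obtain q where q: "homeomorphism (U' w) T' fst q" using homeomorphism_compact[OF cU cf im inj] by blast
      have "fst ` U w = T"
      proof
        show "fst ` U w \<subseteq> T" using K_props(2) by (auto simp: U_def T_def)
        show "T \<subseteq> fst ` U w"
        proof
          fix \<phi> assume p: "\<phi> \<in> T"
          then obtain s where s: "\<phi> = circ s" using circ_surj by (auto simp: T_def)
          have "dist (circ s) (circ t) < d" using p d(1) by (auto simp: T_def s t dist_commute)
          then obtain z where z: "z \<in> Kc s" "dist z w < r" using ex w by blast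
          then have "(\<phi>, z) \<in> U w" using p by (auto simp: U_def T_def Kc_def s dist_commute)
          then show "\<phi> \<in> fst ` U w" by force
        qed
      qed
      moreover have "U w \<subseteq> U' w" "T \<subseteq> T'" unfolding U_def U'_def T_def T'_def using ball_subset_cball by blast+
      ultimately have "homeomorphism (U w) T fst q" using homeomorphism_of_subsets[OF q] by blast
      then show ?thesis by blast
    qed
    have union: "\<Union>V = K \<inter> fst -` T"
    proof
      show "\<Union>V \<subseteq> K \<inter> fst -` T" using K_props(2) by (auto simp: V_def U_def T_def)
      show "K \<inter> fst -` T \<subseteq> \<Union>V"
      proof
        fix p assume p: "p \<in> K \<inter> fst -` T"
        obtain \<phi> z where e: "p = (\<phi>, z)" by (metis prod.collapse)
        obtain s where s: "\<phi> = circ s" using p circ_surj unfolding e T_def by auto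
        have "dist (circ s) (circ t) < d" using p d(1) by (auto simp: e T_def s t dist_commute)
        then obtain w where "w \<in> Kc t" "dist z w < r" using d(2) p unfolding e s Kc_def by auto
        then show "p \<in> \<Union>V" using p by (auto simp: V_def U_def e T_def dist_commute)
      qed
    qed
    have "openin (top_of_set K) (U w)" for w unfolding U_def by (intro openin_open_Int open_Times open_ball)
    moreover have "pairwise disjnt V"
    proof -
      have "U w = U w' \<or> disjnt (U w) (U w')" if "w \<in> Kc t" "w' \<in> Kc t" for w w'
      proof (cases "\<exists>p. p \<in> U w \<and> p \<in> U w'")
        case True
        then obtain p where "p \<in> U w" "p \<in> U w'" by blast
        then have "w = w'" using uniq'[OF that, of "snd p"] by (auto simp: U_def mem_Times_iff dist_commute)
        then show ?thesis by simp
      next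
        case False then show ?thesis unfolding disjnt_iff by blast
      qed
      then show ?thesis unfolding V_def pairwise_def by blast
    qed
    moreover have "openin (top_of_set circle) T" unfolding T_def by (intro openin_open_Int) simp
    moreover have "\<theta> \<in> T" using d(1) t by (simp add: T_def)
    ultimately show "\<exists>T. \<theta> \<in> T \<and> openin (top_of_set circle) T \<and>
         (\<exists>v. \<Union>v = K \<inter> fst -` T \<and> (\<forall>u\<in>v. openin (top_of_set K) u) \<and> pairwise disjnt v \<and> (\<forall>u\<in>v. \<exists>q. homeomorphism u T fst q))"
      using union home by (intro exI[of _ T] conjI exI[of _ V]) (auto simp: V_def)
  qed
qed

text \<open>
  Each component is open and closed in \<open>K\<close> and covers the circle. By upper semicontinuity for the
  component and for its complement, the number of its points in a fibre is locally constant. An iterate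
  that takes one component into another shows that this number does not depend on the component.
\<close>
lemma bounded_graph:
  assumes bounded_cocycle
  shows "\<exists>p q. p \<ge> 1 \<and> q \<ge> 1 \<and> continuous_invariant_graph f p q K"
proof -
  have cov: "covering_space K fst circle" using bounded_covering(1)[OF assms] .
  obtain k where fin: "\<And>t. finite (Kc t)" and k: "\<And>t. card (Kc t) = k" using bounded_covering(2)[OF assms] by blast
  obtain \<sigma> where s: "\<sigma> > 0" "\<forall>t. \<forall>x\<in>Kc t. \<forall>y\<in>Kc t. x \<noteq> y \<longrightarrow> dist x y \<ge> \<sigma>" using bounded_covering(3)[OF assms] by blast
  have fin': "\<forall>t. finite (Kc t)" using fin by blast
  have "locally connected K" using covering_space_locally_connected_eq[OF cov] locally_connected_circle by blast
  then have opn: "openin (top_of_set K) C" if "C \<in> components K" for C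
    using openin_components_locally_connected that by blast
  have cpt: "compact C" if "C \<in> components K" for C
    using that K_props(3) by (meson closedin_compact closedin_component)
  have sub: "C \<subseteq> K" if "C \<in> components K" for C using that in_components_subset by blast
  define Cc where "Cc C t = {z. (circ t, z) \<in> C}" for C :: "(complex \<times> complex) set" and t
  have CcK: "Cc C t \<subseteq> Kc t" if "C \<in> components K" for C t using sub[OF that] by (auto simp: Cc_def Kc_def)
  have fCc: "finite (Cc C t)" if "C \<in> components K" for C t using CcK[OF that] fin finite_subset by blast
  have ne: "Cc C t \<noteq> {}" if C: "C \<in> components K" for C t
  proof -
    have "openin (top_of_set circle) (fst ` C)" by (rule covering_space_open_map[OF cov opn[OF C]])
    moreover have "closedin (top_of_set circle) (fst ` C)"
    proof (rule closed_subset)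
      show "fst ` C \<subseteq> circle" using sub[OF C] K_props(2) by auto
      show "closed (fst ` C)" by (intro compact_imp_closed compact_continuous_image continuous_intros cpt C)
    qed
    moreover have "connected (circle :: complex set)"
      by (rule connected_sphere) simp
    ultimately have "fst ` C = {} \<or> fst ` C = circle" unfolding connected_clopen by blast
    then have "fst ` C = circle" using in_components_nonempty[OF C] by simp
    then have "circ t \<in> fst ` C" by simp
    then show ?thesis by (force simp: Cc_def)
  qed
  have part: "Kc t = (\<Union>C\<in>components K. Cc C t)" for t
  proof -
    have "z \<in> Kc t \<longleftrightarrow> (\<exists>C\<in>components K. z \<in> Cc C t)" for z
      using Union_components[of K] unfolding Kc_def Cc_def by blast
    then show ?thesis by blast
  qed
  have disj: "Cc C t \<inter> Cc C' t = {}" if "C \<in> components K" "C' \<in> components K" "C \<noteq> C'" for C C' t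
    using components_nonoverlap[OF that(1,2)] that(3) by (auto simp: Cc_def)
  have finC: "finite (components K)"
  proof (rule inj_on_finite[of "\<lambda>C. Cc C 0" _ "Pow (Kc 0)"])
    show "inj_on (\<lambda>C. Cc C 0) (components K)"
    proof (rule inj_onI, rule ccontr)
      fix C C' assume c: "C \<in> components K" "C' \<in> components K" "Cc C 0 = Cc C' 0" "C \<noteq> C'"
      show False using disj[OF c(1,2,4), of 0] ne[OF c(1), of 0] c(3) by simp
    qed
    show "(\<lambda>C. Cc C 0) ` components K \<subseteq> Pow (Kc 0)" using CcK by auto
    show "finite (Pow (Kc 0))" using fin by simp
  qed
  have const: "card (Cc C a) = card (Cc C b)" if C: "C \<in> components K" for C a b
  proof -
    define D where "D = K - C"
    have "closed D"
    proof -
      obtain S where "open S" "C = K \<inter> S" using opn[OF C] unfolding openin_open by blast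
      then have "D = K \<inter> - S" "closed (- S)" by (auto simp: D_def)
      then show ?thesis using K_props(4) by (simp add: closed_Int)
    qed
    then have cD: "compact D" using compact_Int_closed[OF K_props(3), of D] by (auto simp: D_def Int_absorb1)
    have sum: "card (Cc C t) + card (Cc D t) = k" for t
    proof -
      have "Kc t = Cc C t \<union> Cc D t" "Cc C t \<inter> Cc D t = {}" using sub[OF C] by (auto simp: Cc_def D_def Kc_def)
      moreover from this have "finite (Cc C t)" "finite (Cc D t)" using fin[of t] by auto
      ultimately show ?thesis using k[of t] card_Un_disjoint by metis
    qed
    have loc: "\<exists>d>0. \<forall>u. dist (circ u) (circ t) < d \<longrightarrow> card (Cc C u) = card (Cc C t)" for t
    proof -
      obtain d1 where d1: "d1 > 0" "\<forall>u. dist (circ u) (circ t) < d1 \<longrightarrow> card (Cc C u) \<le> card (Cc C t)"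
        using separated_card_usc[OF cpt[OF C] sub[OF C] s fin', of t] unfolding Cc_def by blast
      have "D \<subseteq> K" by (auto simp: D_def)
      then obtain d2 where d2: "d2 > 0" "\<forall>u. dist (circ u) (circ t) < d2 \<longrightarrow> card (Cc D u) \<le> card (Cc D t)"
        using separated_card_usc[OF cD _ s fin', of t] unfolding Cc_def by blast
      have "card (Cc C u) = card (Cc C t)" if "dist (circ u) (circ t) < min d1 d2" for u
      proof -
        have "card (Cc C u) \<le> card (Cc C t)" "card (Cc D u) \<le> card (Cc D t)" using d1(2) d2(2) that by auto
        then show ?thesis using sum[of u] sum[of t] by linarith
      qed
      moreover have "min d1 d2 > 0" using d1(1) d2(1) by simp
      ultimately show ?thesis by blast
    qed
    have "card (Cc C b) = card (Cc C a)"
    proof (rule connected_induction_simple[of "UNIV::real set" a b "\<lambda>t. card (Cc C t) = card (Cc C a)"])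
      fix t :: real
      obtain d where d: "d > 0" "\<forall>u. dist (circ u) (circ t) < d \<longrightarrow> card (Cc C u) = card (Cc C t)" using loc by blast
      have "card (Cc C u) = card (Cc C t)" if "u \<in> ball t (d / 8)" for u
      proof -
        have "8 * \<bar>u - t\<bar> < d" using that by (simp add: dist_real_def abs_minus_commute)
        then have "dist (circ u) (circ t) < d" using dist_circ_le8[of u t] by linarith
        then show ?thesis using d by blast
      qed
      then have "\<forall>x\<in>ball t (d / 8). \<forall>y\<in>ball t (d / 8). card (Cc C x) = card (Cc C a) \<longrightarrow> card (Cc C y) = card (Cc C a)"
        by metis
      moreover have "openin (top_of_set UNIV) (ball t (d / 8))" "t \<in> ball t (d / 8)" using d(1) by simp_all
      ultimately show "\<exists>T. openin (top_of_set UNIV) T \<and> t \<in> T \<and> (\<forall>x\<in>T. \<forall>y\<in>T. card (Cc C x) = card (Cc C a) \<longrightarrow> card (Cc C y) = card (Cc C a))"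
        by blast
    qed auto
    then show ?thesis by simp
  qed
  have mono: "card (Cc C 0) \<le> card (Cc C' 0)" if C: "C \<in> components K" and C': "C' \<in> components K" for C C'
  proof -
    obtain x where x: "x \<in> Cc C 0" using ne[OF C] by blast
    obtain y where y: "y \<in> Cc C' 0" using ne[OF C'] by blast
    have xK: "x \<in> Kc 0" and yK: "y \<in> Kc 0" using x y CcK C C' by blast+
    obtain e where e: "e > 0" "ball (circ 0, y) e \<inter> K \<subseteq> C'"
      using opn[OF C'] y unfolding openin_contains_ball Cc_def by blast
    have "e / 2 > 0" using e by simp
    then obtain n where n: "dist (circ (0 + real n * \<omega>)) (circ 0) < e / 2" "dist (fb n 0 x) y < e / 2"
      using visits[OF xK yK] by blast
    have xc: "x \<in> circle" using xK Kc_circle by blast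
    have P: "(f ^^ n) (circ 0, x) = (circ (0 + real n * \<omega>), fb n 0 x)" by (rule iter_eq[OF xc])
    have "dist (circ (0 + real n * \<omega>), fb n 0 x) (circ 0, y) \<le> dist (circ (0 + real n * \<omega>)) (circ 0) + dist (fb n 0 x) y"
      unfolding dist_Pair_Pair by (rule sqrt_sum_squares_le_sum) auto
    then have "(f ^^ n) (circ 0, x) \<in> ball (circ 0, y) e" unfolding P using n by (simp add: dist_commute)
    moreover have "(f ^^ n) (circ 0, x) \<in> K" using iter_K[of "(circ 0, x)" n] xK xc by (simp add: Kc_def)
    ultimately have meet: "(f ^^ n) (circ 0, x) \<in> C'" using e(2) by blast
    have "connected ((f ^^ n) ` C)"
      using in_components_connected[OF C] sub[OF C] K_props(2) 
      by (intro connected_continuous_image continuous_on_subset[OF iter_cont]) auto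
    moreover have "(f ^^ n) ` C \<subseteq> K"
    proof
      fix p assume "p \<in> (f ^^ n) ` C"
      then obtain p' where "p' \<in> C" "p = (f ^^ n) p'" by blast
      then show "p \<in> K" using iter_K[of p' n] sub[OF C] K_props(2) by blast
    qed
    moreover have "C' \<inter> (f ^^ n) ` C \<noteq> {}" using meet x by (auto simp: Cc_def)
    ultimately have im: "(f ^^ n) ` C \<subseteq> C'" using components_maximal[OF C'] by blast
    have "card (Cc C 0) \<le> card (Cc C' (0 + real n * \<omega>))"
    proof (rule card_fibre_mono[of _ n 0])
      show "z \<in> circle" if "z \<in> Cc C 0" for z using that CcK[OF C] Kc_circle by blast
      show "fb n 0 z \<in> Cc C' (0 + real n * \<omega>)" if z: "z \<in> Cc C 0" for z
      proof -
        have "z \<in> circle" using z CcK[OF C] Kc_circle by blast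
        then have "(f ^^ n) (circ 0, z) = (circ (0 + real n * \<omega>), fb n 0 z)" by (rule iter_eq)
        moreover have "(f ^^ n) (circ 0, z) \<in> C'" using im z unfolding Cc_def by blast
        ultimately show ?thesis unfolding Cc_def by simp
      qed
      show "finite (Cc C' (0 + real n * \<omega>))" using fCc[OF C'] .
    qed
    then show ?thesis using const[OF C', of "0 + real n * \<omega>" 0] by simp
  qed
  obtain z where z: "z \<in> Kc 0" using Kc_nonempty by blast
  then obtain C0 where C0: "C0 \<in> components K" using part by blast
  define q where "q = card (Cc C0 0)"
  define p where "p = card (components K)"
  have q: "card (Cc C 0) = q" if "C \<in> components K" for C
    unfolding q_def using mono[OF that C0] mono[OF C0 that] by simp
  have "k = card (\<Union>C\<in>components K. Cc C 0)" using k[of 0] part by simp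
  also have "\<dots> = (\<Sum>C\<in>components K. card (Cc C 0))"
    using finC fCc disj by (intro card_UN_disjoint) auto
  also have "\<dots> = p * q" using q by (simp add: p_def)
  finally have kpq: "k = p * q" .
  have "k > 0" using z fin[of 0] k[of 0] by (metis card_gt_0_iff empty_iff)
  then have pq: "p \<ge> 1" "q \<ge> 1" using kpq by (auto simp: Suc_le_eq)
  have fibre: "finite (K \<inter> ({\<theta>} \<times> circle)) \<and> card (K \<inter> ({\<theta>} \<times> circle)) = p * q" if th: "\<theta> \<in> circle" for \<theta>
  proof -
    obtain t where t: "\<theta> = circ t" using th circ_surj by blast
    have "inj_on (Pair \<theta>) (Kc t)" by (simp add: inj_on_def)
    moreover have "K \<inter> ({\<theta>} \<times> circle) = Pair \<theta> ` Kc t" unfolding t by (rule fibre_eq)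
    ultimately show ?thesis using fin[of t] k[of t] kpq by (simp add: card_image)
  qed
  show ?thesis
    unfolding continuous_invariant_graph_def using pq minimal cov fibre finC p_def by blast
qed

end

section \<open>The alternatives for a minimal set\<close>
lemma graph_or_two_points:
  assumes m: "mobius_cocycle \<omega> f" and F: "is_lift f F" 
    and K: "minimal_set f K" "K \<noteq> torus" and n1: "\<not> generic_fibre_card K 1"
  shows "((\<exists>p q. p \<ge> 1 \<and> q \<ge> 1 \<and> continuous_invariant_graph f p q K) \<or> generic_fibre_card K 2)
    \<and> bdd_above {\<bar>snd ((F ^^ n) (\<theta>, x)) - x - real n * fibred_rotation_number F\<bar> | n \<theta> x. \<theta> \<in> circle}"
proof -
  interpret mobius_cocycle \<omega> f by (rule m)
  interpret lifted_minimal \<omega> f K F by unfold_locales (use F K in auto)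
  obtain \<delta> where sp: "spread \<delta>" using generic_one_or_spread n1 by blast
  show ?thesis
  proof (cases bounded_cocycle)
    case True
    show ?thesis by (intro conjI disjI1 bounded_graph bounded_rho_bounded True)
  next
    case False
    obtain t0 where t0: "good t0" using ex_good by blast
    obtain G where G: "gdelta_in (top_of_set circle) G" "circle \<subseteq> closure G" "\<forall>t. circ t \<in> G \<longrightarrow> good t"
      using good_generic by blast
    have "finite (K \<inter> ({\<theta>} \<times> circle)) \<and> card (K \<inter> ({\<theta>} \<times> circle)) = 2" if th: "\<theta> \<in> G" for \<theta>
    proof -
      have "G \<subseteq> circle" using gdelta_in_subset[OF G(1)] by simp
      then obtain t where t: "\<theta> = circ t" using th circ_surj by blast
      then have "good t" using G(3) th by blast
      then obtain c d where cd: "Kc t = {c, d}" "c \<noteq> d" using unbounded_fibre_two[OF _ sp False] by blast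
      have "K \<inter> ({\<theta>} \<times> circle) = {(circ t, c), (circ t, d)}" unfolding t fibre_eq cd(1) by blast
      then show ?thesis using cd(2) by simp
    qed
    then have "generic_fibre_card K 2" unfolding generic_fibre_card_def using G by blast
    then show ?thesis by (intro conjI disjI2 unbounded_rho_bounded[OF t0 sp False])
  qed
qed

theorem proposition1p6:
  fixes \<omega> :: real and f :: "complex \<times> complex \<Rightarrow> complex \<times> complex"
  assumes "qpf_circle_homeo \<omega> f"
    and "projective_SL2_action f"
  shows "(\<forall>K. minimal_set f K \<longrightarrow>
            K = torus \<or>
            (\<exists>p q. p \<ge> 1 \<and> q \<ge> 1 \<and> continuous_invariant_graph f p q K) \<or>
            generic_fibre_card K 1 \<or>
            generic_fibre_card K 2) \<and>
         (\<not> rho_bounded f \<longrightarrow>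
            (\<forall>K. minimal_set f K \<longrightarrow> K = torus \<or> generic_fibre_card K 1))"
proof -
  note qpf = assms(1)[unfolded qpf_circle_homeo_def]
  note homeo = qpf[THEN conjunct2, THEN conjunct1]
  note isotopy = qpf[THEN conjunct2, THEN conjunct2, THEN conjunct1]
  note skew = qpf[THEN conjunct2, THEN conjunct2, THEN conjunct2]
  have base: "fst (f (\<theta>, z)) = \<theta> * circ \<omega>" if "\<theta> \<in> circle" "z \<in> circle" for \<theta> z
    by (rule skew[rule_format, OF that])
  have torus: "f (\<theta>, z) \<in> torus" if "\<theta> \<in> circle" "z \<in> circle" for \<theta> z
  proof -
    from homeo obtain g where "homeomorphism torus torus f g" by (elim exE)
    then have "f ` torus = torus" by (simp add: homeomorphism_def)
    then show ?thesis using that by blast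
  qed
  have m: "mobius_cocycle \<omega> f"
  proof
    show "\<omega> \<notin> \<rat>" "\<exists>g. homeomorphism torus torus f g" by (rule qpf[THEN conjunct1], rule homeo)
    show "fst (f (\<theta>, z)) = \<theta> * circ \<omega>" if "\<theta> \<in> circle" "z \<in> circle" for \<theta> z using that by (rule base)
    fix \<theta> assume th: "\<theta> \<in> (circle :: complex set)"
    then obtain A :: "real^2^2" where A: "det A = 1" 
      "\<And>x. x \<in> circle \<Longrightarrow> proj_line (snd (f (\<theta>, x))) = (\<lambda>v. A *v v) ` proj_line x"
      using assms(2) unfolding projective_SL2_action_def by blast
    have "snd (f (\<theta>, z)) \<in> circle" if "z \<in> circle" for z
      using torus[OF th that] by (rule mem_Times_iff[THEN iffD1, THEN conjunct2])
    then show "circle_mobius (\<lambda>z. snd (f (\<theta>, z)))" by (rule circle_mobius_projective[OF A(1) _ A(2)])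
  qed
  have "\<exists>F. is_lift f F" by (rule lift_exists[OF isotopy torus base])
  then obtain F where F: "is_lift f F" by (elim exE)
  have bounded: "rho_bounded f" if K: "minimal_set f K" "K \<noteq> torus" "\<not> generic_fibre_card K 1" for K
    unfolding rho_bounded_def by (intro allI impI) (rule conjunct2[OF graph_or_two_points[OF m _ K]])
  have cases: "(\<exists>p q. p \<ge> 1 \<and> q \<ge> 1 \<and> continuous_invariant_graph f p q K) \<or> generic_fibre_card K 2"
    if K: "minimal_set f K" "K \<noteq> torus" "\<not> generic_fibre_card K 1" for K
    by (rule conjunct1[OF graph_or_two_points[OF m F K]])
  show ?thesis
  proof (intro conjI allI impI)
    fix K assume K: "minimal_set f K"
    show "K = torus \<or> (\<exists>p q. p \<ge> 1 \<and> q \<ge> 1 \<and> continuous_invariant_graph f p q K) \<or>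
        generic_fibre_card K 1 \<or> generic_fibre_card K 2"
      using cases[OF K] by argo
  next
    fix K assume "\<not> rho_bounded f" and K: "minimal_set f K"
    then show "K = torus \<or> generic_fibre_card K 1" using bounded[OF K] by argo
  qed
qed

end
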